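(* Let $G$ be a compact Lie group with normalized Haar measure $\mu$ and a left invariant Riemannian metric with geodesic distance $d_{\mathrm{Riem}}$, let $\{X_j\}_{j=1}^d$ be an orthonormal basis of the Lie algebra $\mathfrak{g}$ of left invariant vector fields, and $\nabla f=(X_jf)_{j=1}^d$. Let $(Kf)(h)=\int_Gk(h^{-1}g)f(g)\,d\mu(g)$ be a left invariant Markov map on $L_\infty(G)$ with invariant (Haar) measure $\mu$. Let $u:G\to\mathcal{U}(\mathcal{H})$ be a continuous projective unitary representation on a finite dimensional Hilbert space $\mathcal{H}$, let $\mathcal{P}(x)=\int_Gk(g)u(g)xu(g)^*d\mu(g)$ be the transferred quantum channel on $\mathcal{B}(\mathcal{H})$, and let $\partial x=(\partial_jx)_{j=1}^d$, $\partial_jx=[L_j,x]$. (i) Suppose that for any $f\in\mathrm{dom}(\nabla)$ the pointwise estimate $|\nabla K(f)|^2\le(1-\kappa)K(|\nabla f|^2)$ holds, where $|\nabla f|^2=\sum_{j=1}^d|X_jf|^2$. Then for $s\in[0,1]$, any positive operators $A,B$ and any $x\in\mathcal{B}(\mathcal{H})$, $$\langle\partial\mathcal{P}(x),\partial\mathcal{P}(x)\rangle_{A,B,s}\le(1-\kappa)\,\langle\partial x,\partial x\rangle_{\mathcal{P}^\dagger(A),\mathcal{P}^\dagger(B),s},$$ where $\langle\mathbf{x},\mathbf{y}\rangle_{A,B,s}:=\sum_{j=1}^d\mathrm{Tr}(x_j^*A^sy_jB^{1-s})$ for $\mathbf x=(x_j),\mathbf y=(y_j)\in\bigoplus_{j=1}^d\mathcal{B}(\mathcal{H})$.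 (ii) For $1\le p\le\infty$, $1/p+1/p'=1$, and $\mathbf{x}=(x_j)\in\bigoplus_{j=1}^d\mathcal{B}(\mathcal{H})$ let $\|\mathbf{x}\|_{2,p}=\sup_{\|A\|_{p'}\le1}\big(\sum_{j=1}^d|\mathrm{Tr}(Ax_j)|^2\big)^{1/2}$. Suppose that for any $f\in\mathrm{dom}(\nabla)$, $\|K(f)\|_{\mathrm{Lip}}\le(1-\kappa)\|f\|_{\mathrm{Lip}}$, where $$\|f\|_{\mathrm{Lip}}=\sup_{g\ne h\in G}\frac{|f(g)-f(h)|}{d_{\mathrm{Riem}}(g,h)}=\sup_{g\in G}|\nabla f|(g)$$ is the Lipschitz constant. Then for all $1\le p\le\infty$ and any $x\in\mathcal{B}(\mathcal{H})$, $$\|\partial\mathcal{P}(x)\|_{2,p}\le(1-\kappa)\,\|\partial x\|_{2,p}.$$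
   Context: $k\ge0$ is the kernel function of the Markov map $K$, with $\int_Gk\,d\mu=1$. For $X\in\mathfrak{g}$, $Xf(g)=\frac{d}{dt}f(ge^{tX})|_{t=0}$, and $\nabla$ is defined on the smooth functions on $G$. $L_j\in\mathcal{B}(\mathcal{H})$ is the self-adjoint operator satisfying $e^{itL_j}=u(e^{tX_j})$, i.e. the image of $X_j$ under the projective Lie algebra representation up to the imaginary unit. $\mathcal{P}^\dagger(x)=\int_Gk(g)u(g)^*xu(g)\,d\mu(g)$ is the adjoint channel of $\mathcal{P}$ for the trace inner product. $\|A\|_{p'}$ is the Schatten $p'$-norm.
   Formalization: In (ii) the Lipschitz constant of a complex smooth f is taken to be sup|∇f|; its asserted equality with the geodesic difference-quotient supremum fails for complex f and is proved only for real f. With the metric expression alone, (ii) is false (e.g. on the 2-torus). *)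

theory Defs
  imports "HOL-Analysis.Analysis" "HOL-Algebra.Group"
begin

section \<open>Smooth maps and Lie groups\<close>

text \<open>\<open>C_k_on k S f\<close>: for open \<open>S\<close>, \<open>f\<close> is \<open>k\<close> times continuously differentiable on \<open>S\<close>;
  the derivative is tested in every fixed direction, which suffices in finite dimension.\<close>

primrec C_k_on ::
  "nat \<Rightarrow> 'a::euclidean_space set \<Rightarrow> ('a \<Rightarrow> 'b::real_normed_vector) \<Rightarrow> bool" where
  "C_k_on 0 S = (\<lambda>f. continuous_on S f)"
| "C_k_on (Suc k) S = (\<lambda>f. \<exists>D. (\<forall>x\<in>S. (f has_derivative D x) (at x)) \<and>
      (\<forall>v. C_k_on k S (\<lambda>x. D x v)))"

definition smooth_on :: "'a::euclidean_space set \<Rightarrow> ('a \<Rightarrow> 'b::real_normed_vector) \<Rightarrow> bool" where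
  "smooth_on S f \<longleftrightarrow> (\<forall>k. C_k_on k S f)"

text \<open>A chart is a pair \<open>(U, \<phi>)\<close> of an open set and a map into the model space \<open>'e\<close>; outside of \<open>U\<close>
  the values of \<open>\<phi>\<close> are irrelevant. The set of charts below is an arbitrary smooth atlas.\<close>

type_synonym ('g, 'e) atlas = "('g set \<times> ('g \<Rightarrow> 'e)) set"

locale lie_group = group G
  for G :: "('g::{t2_space, second_countable_topology}, 'm) monoid_scheme" (structure) +
  fixes \<A> :: "('g, 'e::euclidean_space) atlas"
  assumes carrier_UNIV: "carrier G = UNIV"
    and charts_cover: "(\<Union>(U, \<phi>)\<in>\<A>. U) = UNIV"
    and chart_homeo: "(U, \<phi>) \<in> \<A> \<Longrightarrow>
          open U \<and> open (\<phi> ` U) \<and> homeomorphism U (\<phi> ` U) \<phi> (inv_into U \<phi>)"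
    and transition_smooth: "\<lbrakk>(U, \<phi>) \<in> \<A>; (V, \<psi>) \<in> \<A>\<rbrakk> \<Longrightarrow>
          smooth_on (\<phi> ` (U \<inter> V)) (\<lambda>x. \<psi> (inv_into U \<phi> x))"
    and mult_continuous: "continuous_on UNIV (\<lambda>(g, h). g \<otimes> h)"
    and mult_smooth: "\<lbrakk>(U, \<phi>) \<in> \<A>; (V, \<psi>) \<in> \<A>; (W, \<theta>) \<in> \<A>\<rbrakk> \<Longrightarrow>
          smooth_on {(x, y). x \<in> \<phi> ` U \<and> y \<in> \<psi> ` V \<and> inv_into U \<phi> x \<otimes> inv_into V \<psi> y \<in> W}
            (\<lambda>(x, y). \<theta> (inv_into U \<phi> x \<otimes> inv_into V \<psi> y))"
    and inv_continuous: "continuous_on UNIV (\<lambda>g. inv g)"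
    and inv_smooth: "\<lbrakk>(U, \<phi>) \<in> \<A>; (V, \<psi>) \<in> \<A>\<rbrakk> \<Longrightarrow>
          smooth_on {x \<in> \<phi> ` U. inv (inv_into U \<phi> x) \<in> V} (\<lambda>x. \<psi> (inv (inv_into U \<phi> x)))"

definition smooth_fun ::
  "('g, 'e::euclidean_space) atlas \<Rightarrow> ('g \<Rightarrow> 'b::real_normed_vector) \<Rightarrow> bool" where
  "smooth_fun \<A> f \<longleftrightarrow> (\<forall>(U, \<phi>)\<in>\<A>. smooth_on (\<phi> ` U) (\<lambda>x. f (inv_into U \<phi> x)))"

definition smooth_curve ::
  "('g::topological_space, 'e::euclidean_space) atlas \<Rightarrow> (real \<Rightarrow> 'g) \<Rightarrow> bool" where
  "smooth_curve \<A> c \<longleftrightarrow> continuous_on UNIV c \<and>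
     (\<forall>(U, \<phi>)\<in>\<A>. smooth_on (c -` U) (\<lambda>t. \<phi> (c t)))"


section \<open>Tangent vectors, the Lie algebra, and left invariant metrics\<close>

text \<open>A tangent vector is the velocity of a smooth curve, viewed as a functional on the smooth real
  functions. It is given the value 0 on all other functions, so that equality of tangent vectors is
  equality of functionals on smooth functions.\<close>

type_synonym 'g tangent = "('g \<Rightarrow> real) \<Rightarrow> real"

definition velocity ::
  "('g, 'e::euclidean_space) atlas \<Rightarrow> (real \<Rightarrow> 'g) \<Rightarrow> real \<Rightarrow> 'g tangent" where
  "velocity \<A> c t = (\<lambda>f. if smooth_fun \<A> f then deriv (\<lambda>r. f (c r)) t else 0)"

definition tangent_space ::
  "('g::topological_space, 'e::euclidean_space) atlas \<Rightarrow> 'g \<Rightarrow> 'g tangent set" where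
  "tangent_space \<A> p = {velocity \<A> c 0 | c. smooth_curve \<A> c \<and> c 0 = p}"

text \<open>The differential of left translation by \<open>h\<close>.\<close>

definition left_push :: "('g, 'm) monoid_scheme \<Rightarrow> 'g \<Rightarrow> 'g tangent \<Rightarrow> 'g tangent" where
  "left_push G h v = (\<lambda>f. v (\<lambda>g. f (h \<otimes>\<^bsub>G\<^esub> g)))"

definition smooth_vector_field ::
  "('g::topological_space, 'e::euclidean_space) atlas \<Rightarrow> ('g \<Rightarrow> 'g tangent) \<Rightarrow> bool" where
  "smooth_vector_field \<A> X \<longleftrightarrow> (\<forall>p. X p \<in> tangent_space \<A> p) \<and>
     (\<forall>f. smooth_fun \<A> f \<longrightarrow> smooth_fun \<A> (\<lambda>p. X p f))"

definition lie_algebra ::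
  "('g::topological_space, 'm) monoid_scheme \<Rightarrow> ('g, 'e::euclidean_space) atlas \<Rightarrow>
     ('g \<Rightarrow> 'g tangent) set" where
  "lie_algebra G \<A> =
     {X. smooth_vector_field \<A> X \<and> (\<forall>h p. left_push G h (X p) = X (h \<otimes>\<^bsub>G\<^esub> p))}"

definition riemannian_metric ::
  "('g::topological_space, 'e::euclidean_space) atlas \<Rightarrow>
     ('g \<Rightarrow> 'g tangent \<Rightarrow> 'g tangent \<Rightarrow> real) \<Rightarrow> bool" where
  "riemannian_metric \<A> m \<longleftrightarrow>
     (\<forall>p. \<forall>v\<in>tangent_space \<A> p. \<forall>w\<in>tangent_space \<A> p. m p v w = m p w v) \<and>
     (\<forall>p. \<forall>v\<in>tangent_space \<A> p. \<forall>v'\<in>tangent_space \<A> p. \<forall>w\<in>tangent_space \<A> p. \<forall>a b.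
        m p (\<lambda>f. a * v f + b * v' f) w = a * m p v w + b * m p v' w) \<and>
     (\<forall>p. \<forall>v\<in>tangent_space \<A> p. v \<noteq> (\<lambda>f. 0) \<longrightarrow> 0 < m p v v) \<and>
     (\<forall>X Y. smooth_vector_field \<A> X \<and> smooth_vector_field \<A> Y \<longrightarrow>
        smooth_fun \<A> (\<lambda>p. m p (X p) (Y p)))"

definition left_invariant_metric ::
  "('g::topological_space, 'm) monoid_scheme \<Rightarrow> ('g, 'e::euclidean_space) atlas \<Rightarrow>
     ('g \<Rightarrow> 'g tangent \<Rightarrow> 'g tangent \<Rightarrow> real) \<Rightarrow> bool" where
  "left_invariant_metric G \<A> m \<longleftrightarrow>
     riemannian_metric \<A> m \<and>
     (\<forall>h p. \<forall>v\<in>tangent_space \<A> p. \<forall>w\<in>tangent_space \<A> p.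
        m (h \<otimes>\<^bsub>G\<^esub> p) (left_push G h v) (left_push G h w) = m p v w)"

text \<open>The inner product of two left invariant fields is a constant function on the group; it is
  evaluated at the identity. The dimension of the group is \<open>CARD('d)\<close>.\<close>

definition lie_algebra_onb ::
  "('g::topological_space, 'm) monoid_scheme \<Rightarrow> ('g, 'e::euclidean_space) atlas \<Rightarrow>
     ('g \<Rightarrow> 'g tangent \<Rightarrow> 'g tangent \<Rightarrow> real) \<Rightarrow> ('d::finite \<Rightarrow> 'g \<Rightarrow> 'g tangent) \<Rightarrow> bool" where
  "lie_algebra_onb G \<A> m X \<longleftrightarrow>
     (\<forall>j. X j \<in> lie_algebra G \<A>) \<and>
     (\<forall>i j. m \<one>\<^bsub>G\<^esub> (X i \<one>\<^bsub>G\<^esub>) (X j \<one>\<^bsub>G\<^esub>) = (if i = j then 1 else 0)) \<and>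
     (\<forall>Y\<in>lie_algebra G \<A>. \<exists>a. \<forall>p f. Y p f = (\<Sum>j\<in>UNIV. a j * X j p f))"

text \<open>\<open>is_exponential G \<A> X E\<close>: the map \<open>E\<close> is \<open>t \<mapsto> e\<^bsup>tX\<^esup>\<close>, i.e. the one-parameter
  subgroup with initial velocity \<open>X\<close>.\<close>

definition is_exponential ::
  "('g::topological_space, 'm) monoid_scheme \<Rightarrow> ('g, 'e::euclidean_space) atlas \<Rightarrow>
     ('g \<Rightarrow> 'g tangent) \<Rightarrow> (real \<Rightarrow> 'g) \<Rightarrow> bool" where
  "is_exponential G \<A> X E \<longleftrightarrow>
     continuous_on UNIV E \<and> (\<forall>s t. E (s + t) = E s \<otimes>\<^bsub>G\<^esub> E t) \<and>
     (\<forall>f. smooth_fun \<A> f \<longrightarrow> ((\<lambda>t. f (E t)) has_real_derivative X \<one>\<^bsub>G\<^esub> f) (at 0))"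


section \<open>Gradient and Lipschitz constant\<close>

text \<open>\<open>E j t\<close> stands for \<open>e\<^bsup>tX_j\<^esup>\<close>. The functions may be real or complex valued.\<close>

definition lie_deriv ::
  "('g, 'm) monoid_scheme \<Rightarrow> (real \<Rightarrow> 'g) \<Rightarrow> ('g \<Rightarrow> 'b::real_normed_vector) \<Rightarrow> 'g \<Rightarrow> 'b" where
  "lie_deriv G \<gamma> f g = vector_derivative (\<lambda>t. f (g \<otimes>\<^bsub>G\<^esub> \<gamma> t)) (at 0)"

definition grad_sq ::
  "('g, 'm) monoid_scheme \<Rightarrow> ('d::finite \<Rightarrow> real \<Rightarrow> 'g) \<Rightarrow> ('g \<Rightarrow> 'b::real_normed_vector) \<Rightarrow>
     'g \<Rightarrow> real" where
  "grad_sq G E f g = (\<Sum>j\<in>UNIV. (norm (lie_deriv G (E j) f g))\<^sup>2)"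

text \<open>The Lipschitz constant in its two forms. They agree on real valued smooth functions. For complex
  valued \<open>f\<close>, with \<open>|\<nabla>f|\<^sup>2 = \<Sum>\<^sub>j |X\<^sub>j f|\<^sup>2\<close>, the metric form can be smaller: on a torus with
  coordinates \<open>x, y\<close>, a function with differential \<open>dx + i dy\<close> at a point has \<open>|\<nabla>f|\<^sup>2 = 2\<close> there, but it
  changes at rate at most 1 in any direction.\<close>

definition lip_grad ::
  "('g, 'm) monoid_scheme \<Rightarrow> ('d::finite \<Rightarrow> real \<Rightarrow> 'g) \<Rightarrow> ('g \<Rightarrow> 'b::real_normed_vector) \<Rightarrow> real"
  where
  "lip_grad G E f = (SUP g. sqrt (grad_sq G E f g))"

definition curve_length ::
  "('g, 'e::euclidean_space) atlas \<Rightarrow> ('g \<Rightarrow> 'g tangent \<Rightarrow> 'g tangent \<Rightarrow> real) \<Rightarrow>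
     (real \<Rightarrow> 'g) \<Rightarrow> real" where
  "curve_length \<A> m c =
     integral {0..1} (\<lambda>t. sqrt (m (c t) (velocity \<A> c t) (velocity \<A> c t)))"

text \<open>The value is \<open>\<infinity>\<close> for points in different components. (Smooth instead of piecewise smooth curves
  give the same infimum, since curves may be reparametrised to stop at their corners.)\<close>

definition riem_dist ::
  "('g::topological_space, 'e::euclidean_space) atlas \<Rightarrow>
     ('g \<Rightarrow> 'g tangent \<Rightarrow> 'g tangent \<Rightarrow> real) \<Rightarrow> 'g \<Rightarrow> 'g \<Rightarrow> ennreal" where
  "riem_dist \<A> m g h =
     (INF c\<in>{c. smooth_curve \<A> c \<and> c 0 = g \<and> c 1 = h}. ennreal (curve_length \<A> m c))"

definition lip_dist ::
  "('g::topological_space, 'e::euclidean_space) atlas \<Rightarrow>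
     ('g \<Rightarrow> 'g tangent \<Rightarrow> 'g tangent \<Rightarrow> real) \<Rightarrow> ('g \<Rightarrow> 'b::real_normed_vector) \<Rightarrow> ennreal" where
  "lip_dist \<A> m f = (SUP (g, h)\<in>{(g, h). g \<noteq> h}. ennreal (norm (f g - f h)) / riem_dist \<A> m g h)"


section \<open>Haar measure and Markov maps\<close>

definition normalized_haar ::
  "('g::topological_space, 'm) monoid_scheme \<Rightarrow> 'g measure \<Rightarrow> bool" where
  "normalized_haar G \<mu> \<longleftrightarrow> emeasure \<mu> UNIV = 1 \<and> sets \<mu> = sets borel \<and>
     (\<forall>h. distr \<mu> borel (\<lambda>g. h \<otimes>\<^bsub>G\<^esub> g) = \<mu>)"

definition markov_kernel :: "'g measure \<Rightarrow> ('g \<Rightarrow> real) \<Rightarrow> bool" where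
  "markov_kernel \<mu> k \<longleftrightarrow> (\<forall>g. 0 \<le> k g) \<and> integrable \<mu> k \<and> (LINT g|\<mu>. k g) = 1"

definition markov_map ::
  "('g, 'm) monoid_scheme \<Rightarrow> 'g measure \<Rightarrow> ('g \<Rightarrow> real) \<Rightarrow>
     ('g \<Rightarrow> 'b::{banach, second_countable_topology}) \<Rightarrow> 'g \<Rightarrow> 'b" where
  "markov_map G \<mu> k f h = (LINT g|\<mu>. k (inv\<^bsub>G\<^esub> h \<otimes>\<^bsub>G\<^esub> g) *\<^sub>R f g)"


section \<open>Operators on a finite dimensional Hilbert space\<close>

text \<open>The Hilbert space is \<open>complex ^ 'n\<close>, and its operators are the matrices \<open>complex ^ 'n ^ 'n\<close>.
  The scalar multiple of a matrix \<open>M\<close> by a complex number \<open>c\<close> is written \<open>mat c ** M\<close>.\<close>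

definition adj :: "complex ^ 'n ^ 'n \<Rightarrow> complex ^ 'n ^ 'n" where
  "adj A = (\<chi> i j. cnj (A $ j $ i))"

definition unitary :: "complex ^ 'n::finite ^ 'n \<Rightarrow> bool" where
  "unitary U \<longleftrightarrow> adj U ** U = mat 1 \<and> U ** adj U = mat 1"

definition self_adjoint :: "complex ^ 'n ^ 'n \<Rightarrow> bool" where
  "self_adjoint A \<longleftrightarrow> adj A = A"

definition positive_op :: "complex ^ 'n::finite ^ 'n \<Rightarrow> bool" where
  "positive_op A \<longleftrightarrow> self_adjoint A \<and> (\<forall>v. 0 \<le> Re (\<Sum>i\<in>UNIV. cnj (v $ i) * (A *v v) $ i))"

definition commutator :: "complex ^ 'n::finite ^ 'n \<Rightarrow> complex ^ 'n ^ 'n \<Rightarrow> complex ^ 'n ^ 'n" where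
  "commutator A B = A ** B - B ** A"

definition mat_exp :: "complex ^ 'n::finite ^ 'n \<Rightarrow> complex ^ 'n ^ 'n" where
  "mat_exp A = (\<Sum>m. (1 / fact m) *\<^sub>R (((**) A ^^ m) (mat 1)))"

definition diag_mat :: "('n \<Rightarrow> real) \<Rightarrow> complex ^ 'n ^ 'n" where
  "diag_mat l = (\<chi> i j. if i = j then complex_of_real (l i) else 0)"

text \<open>Functional calculus of a self-adjoint operator; the result does not depend on the chosen
  diagonalisation.\<close>

definition fun_calc :: "(real \<Rightarrow> real) \<Rightarrow> complex ^ 'n::finite ^ 'n \<Rightarrow> complex ^ 'n ^ 'n" where
  "fun_calc \<phi> A = (SOME M. \<exists>U l. unitary U \<and> A = U ** diag_mat l ** adj U \<and>
      M = U ** diag_mat (\<lambda>i. \<phi> (l i)) ** adj U)"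

text \<open>Convention \<open>A\<^sup>0 = 1\<close>, also when \<open>A\<close> is singular (\<open>0 powr 0 = 0\<close> in the library).\<close>

definition op_powr :: "complex ^ 'n::finite ^ 'n \<Rightarrow> real \<Rightarrow> complex ^ 'n ^ 'n" where
  "op_powr A s = fun_calc (\<lambda>t. if s = 0 then 1 else t powr s) A"

definition op_abs :: "complex ^ 'n::finite ^ 'n \<Rightarrow> complex ^ 'n ^ 'n" where
  "op_abs A = fun_calc sqrt (adj A ** A)"

definition schatten_norm :: "ennreal \<Rightarrow> complex ^ 'n::finite ^ 'n \<Rightarrow> real" where
  "schatten_norm p A =
     (if p = \<infinity> then onorm (\<lambda>v. A *v v)
      else (Re (trace (op_powr (op_abs A) (enn2real p)))) powr (1 / enn2real p))"

text \<open>\<open>1/p + 1/p' = 1\<close> solved for \<open>p'\<close>, including the pairs \<open>(1, \<infinity>)\<close> and \<open>(\<infinity>, 1)\<close>.\<close>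

definition conj_exponent :: "ennreal \<Rightarrow> ennreal" where
  "conj_exponent p = inverse (1 - inverse p)"

text \<open>Elements of \<open>\<Oplus>\<^sub>j B(H)\<close> are families indexed by \<open>'d\<close>.\<close>

definition norm_2p :: "ennreal \<Rightarrow> ('d::finite \<Rightarrow> complex ^ 'n::finite ^ 'n) \<Rightarrow> real" where
  "norm_2p p x =
     (SUP A\<in>{A. schatten_norm (conj_exponent p) A \<le> 1}.
        sqrt (\<Sum>j\<in>UNIV. (cmod (trace (A ** x j)))\<^sup>2))"

definition weighted_form ::
  "complex ^ 'n::finite ^ 'n \<Rightarrow> complex ^ 'n ^ 'n \<Rightarrow> real \<Rightarrow>
     ('d::finite \<Rightarrow> complex ^ 'n ^ 'n) \<Rightarrow> ('d \<Rightarrow> complex ^ 'n ^ 'n) \<Rightarrow> complex" where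
  "weighted_form A B s x y =
     (\<Sum>j\<in>UNIV. trace (adj (x j) ** op_powr A s ** y j ** op_powr B (1 - s)))"

definition derivation ::
  "('d \<Rightarrow> complex ^ 'n::finite ^ 'n) \<Rightarrow> complex ^ 'n ^ 'n \<Rightarrow> 'd \<Rightarrow> complex ^ 'n ^ 'n" where
  "derivation L x = (\<lambda>j. commutator (L j) x)"


section \<open>Projective representations and the transferred channel\<close>

text \<open>Continuity is that of the induced homomorphism into the quotient of the unitary group by the
  scalars of modulus one: the open sets of the quotient are the saturated open sets \<open>W\<close>. In
  particular every \<open>u\<close> that is continuous as a map into the unitary group is covered, and so are the
  representations which have no continuous lift.\<close>

definition projective_unitary_rep ::
  "('g::topological_space, 'm) monoid_scheme \<Rightarrow> ('g \<Rightarrow> complex ^ 'n::finite ^ 'n) \<Rightarrow> bool" where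
  "projective_unitary_rep G u \<longleftrightarrow>
     (\<forall>g. unitary (u g)) \<and>
     (\<forall>g h. \<exists>c. cmod c = 1 \<and> u g ** u h = mat c ** u (g \<otimes>\<^bsub>G\<^esub> h)) \<and>
     (\<forall>W. openin (top_of_set {U. unitary U}) W \<and>
          (\<forall>U\<in>W. \<forall>c. cmod c = 1 \<longrightarrow> mat c ** U \<in> W) \<longrightarrow> open (u -` W))"

text \<open>\<open>e\<^bsup>itL\<^esup> = u(e\<^bsup>tX\<^esup>)\<close> in the projective unitary group, i.e. up to a scalar of modulus one.\<close>

definition rep_generator ::
  "('g \<Rightarrow> complex ^ 'n::finite ^ 'n) \<Rightarrow> (real \<Rightarrow> 'g) \<Rightarrow> complex ^ 'n ^ 'n \<Rightarrow> bool" where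
  "rep_generator u \<gamma> L \<longleftrightarrow> self_adjoint L \<and>
     (\<forall>t. \<exists>c. cmod c = 1 \<and> mat_exp (mat (\<i> * complex_of_real t) ** L) = mat c ** u (\<gamma> t))"

definition channel ::
  "'g measure \<Rightarrow> ('g \<Rightarrow> real) \<Rightarrow> ('g \<Rightarrow> complex ^ 'n::finite ^ 'n) \<Rightarrow>
     complex ^ 'n ^ 'n \<Rightarrow> complex ^ 'n ^ 'n" where
  "channel \<mu> k u x = (LINT g|\<mu>. k g *\<^sub>R (u g ** x ** adj (u g)))"

definition channel_adj ::
  "'g measure \<Rightarrow> ('g \<Rightarrow> real) \<Rightarrow> ('g \<Rightarrow> complex ^ 'n::finite ^ 'n) \<Rightarrow>
     complex ^ 'n ^ 'n \<Rightarrow> complex ^ 'n ^ 'n" where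
  "channel_adj \<mu> k u x = (LINT g|\<mu>. k g *\<^sub>R (adj (u g) ** x ** u g))"

end

theory Submission
  imports Defs
begin

text \<open>Write \<open>\<pi>(g) x = u(g) x u(g)\<^sup>*\<close>; the phases cancel, so \<open>\<pi>\<close> is a continuous representation, hence
  smooth. For a complex linear functional \<open>l\<close> on the operators put \<open>f(g) = l (\<pi>(g) x)\<close>. Then
  \<open>K f(g) = l (\<pi>(g) (\<P> x))\<close> and \<open>X\<^sub>j f(g) = \<i> l (\<pi>(g) (\<partial>\<^sub>j x))\<close>, so an estimate for \<open>K\<close> on scalar functions turns
  into one for \<open>\<P>\<close>. For (ii) take \<open>l = Tr (A \<cdot>)\<close> and use the unitary invariance of Schatten norms. For (i)
  take for \<open>l\<close> the matrix entries in eigenbases of \<open>A\<close> and \<open>B\<close>; this bounds the left hand side by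
  \<open>(1 - \<kappa>) \<integral> k(g) \<langle>\<partial>x, \<partial>x\<rangle>\<close> with weights \<open>u(g)\<^sup>* A u(g)\<close>, \<open>u(g)\<^sup>* B u(g)\<close>, and Lieb's joint concavity of
  \<open>(A, B) \<mapsto> Tr (y\<^sup>* A\<^sup>s y B\<^bsup>1 - s\<^esup>)\<close> moves the integral inside. The concavity follows from
  \<open>a\<^sup>s b\<^bsup>1 - s\<^esup> = c \<integral> t\<^bsup>s - 1\<^esup> a b / (a + t b) dt\<close> over \<open>t > 0\<close> and the variational formula for parallel sums. If
  \<open>\<kappa> > 1\<close>, the hypotheses force the gradients of all these \<open>f\<close> to vanish, and both sides are \<open>0\<close>.

  The two Lipschitz constants are compared by writing the velocity of a curve as a left translate of a
  tangent vector at the identity and expanding it in the orthonormal frame.\<close>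
section \<open>Smooth functions on Euclidean spaces\<close>

text \<open>The hypotheses speak only of functions that are smooth in an arbitrary atlas, so they
  apply to the test functions only once the conjugation representation is known to be smooth, and
  exponential coordinates are not at hand to read this off. Haar averages close the gap. The
  representation space being finite dimensional, each order \<open>k\<close> can be treated
  separately, with truncated powers of class \<open>C_k_on k\<close> as bump functions.

  In (i) the gradient estimate controls one matrix entry at a time. This suffices because
  conjugating \<open>A\<close> by \<open>u g\<close> rotates its eigenbasis and keeps its
  eigenvalues, so the scalar weights come out of the average over \<open>g\<close>. The averaged
  operators have unrelated eigenbases; here concavity enters. Parallel sums suit this: they are
  minima, over splittings \<open>y = z + (y - z)\<close>, of expressions linear in the pair of
  operators. Entry by entry this is completing a square, with no operator inverses, so singular
  \<open>A\<close> and \<open>B\<close> are covered as well.\<close>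

lemma C_k_on_cong:
  assumes "open S" "C_k_on k S f" "\<And>x. x \<in> S \<Longrightarrow> f x = g x"
  shows "C_k_on k S g"
proof (cases k)
  case 0
  then show ?thesis using assms by (auto cong: continuous_on_cong)
next
  case (Suc n)
  with assms(2) obtain D where D: "\<And>x. x \<in> S \<Longrightarrow> (f has_derivative D x) (at x)"
    "\<And>v. C_k_on n S (\<lambda>x. D x v)" by auto
  have "(g has_derivative D x) (at x)" if "x \<in> S" for x
    by (rule has_derivative_transform_within_open[OF D(1)[OF that] assms(1) that assms(3)])
  with D(2) Suc show ?thesis by auto
qed

lemma C_k_on_subset: "C_k_on k S f \<Longrightarrow> T \<subseteq> S \<Longrightarrow> C_k_on k T f"
proof (induction k arbitrary: f)
  case 0
  then show ?case by (auto intro: continuous_on_subset)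
next
  case (Suc k)
  then show ?case by (simp, blast)
qed

lemma C_k_on_SucE:
  assumes "C_k_on (Suc k) S f"
  obtains D where "\<And>x. x \<in> S \<Longrightarrow> (f has_derivative D x) (at x)" "\<And>v. C_k_on k S (\<lambda>x. D x v)"
  using assms by auto

lemma C_k_on_SucD: "C_k_on (Suc k) S f \<Longrightarrow> C_k_on k S f"
proof (induction k arbitrary: f)
  case 0
  then show ?case by (auto intro!: continuous_at_imp_continuous_on dest!: bspec intro: has_derivative_continuous)
next
  case (Suc k)
  then obtain D where "\<forall>x\<in>S. (f has_derivative D x) (at x)" "\<forall>v. C_k_on (Suc k) S (\<lambda>x. D x v)"
    by (metis C_k_on.simps(2))
  with Suc.IH show ?case by (metis C_k_on.simps(2))
qed

lemma C_k_on_imp_continuous: "C_k_on k S f \<Longrightarrow> continuous_on S f"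
proof (induction k)
  case (Suc k)
  then show ?case using C_k_on_SucD by blast
qed auto

text \<open>Derivatives on an open set are unique, so the existentially chosen \<open>D\<close> can
  be replaced by a canonical one. Independence of the choice is what lets local statements be
  glued.\<close>

lemma C_k_on_Suc_frechet:
  assumes "open S"
  shows "C_k_on (Suc k) S f \<longleftrightarrow>
    (\<forall>x\<in>S. f differentiable (at x)) \<and> (\<forall>v. C_k_on k S (\<lambda>x. frechet_derivative f (at x) v))"
proof
  assume "C_k_on (Suc k) S f"
  then obtain D where D: "\<And>x. x \<in> S \<Longrightarrow> (f has_derivative D x) (at x)"
    "\<And>v. C_k_on k S (\<lambda>x. D x v)" by auto
  have "D x = frechet_derivative f (at x)" if "x \<in> S" for x
    using D(1)[OF that] by (rule frechet_derivative_at)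
  then have "C_k_on k S (\<lambda>x. frechet_derivative f (at x) v)" for v
    using C_k_on_cong[OF assms D(2)[of v]] by simp
  then show "(\<forall>x\<in>S. f differentiable (at x)) \<and> (\<forall>v. C_k_on k S (\<lambda>x. frechet_derivative f (at x) v))"
    using D(1) by (auto simp: differentiable_def)
next
  assume "(\<forall>x\<in>S. f differentiable (at x)) \<and> (\<forall>v. C_k_on k S (\<lambda>x. frechet_derivative f (at x) v))"
  then show "C_k_on (Suc k) S f"
    by (auto simp: frechet_derivative_works intro!: exI[of _ "\<lambda>x. frechet_derivative f (at x)"])
qed

text \<open>Overlapping pieces \<open>T\<close> share the canonical derivative, so the induction
  runs on \<open>frechet_derivative\<close>. This is the device for checking smoothness chart by
  chart.\<close>

lemma C_k_on_local:
  assumes "\<And>x. x \<in> S \<Longrightarrow> \<exists>T. open T \<and> x \<in> T \<and> C_k_on k T f"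
  shows "C_k_on k S f"
  using assms
proof (induction k arbitrary: f)
  case 0
  then show ?case
    by (auto intro!: continuous_at_imp_continuous_on) (metis continuous_on_eq_continuous_at)
next
  case (Suc k)
  have 1: "f differentiable (at x)" if "x \<in> S" for x
    using Suc.prems[OF that] C_k_on_Suc_frechet by metis
  have 2: "C_k_on k S (\<lambda>x. frechet_derivative f (at x) v)" for v
    using Suc.prems by (intro Suc.IH) (metis C_k_on_Suc_frechet)
  show ?case
    using 1 2 by (auto simp: frechet_derivative_works intro!: exI[of _ "\<lambda>x. frechet_derivative f (at x)"])
qed

lemma C_k_on_const: "C_k_on k S (\<lambda>_. c)"
proof (induction k arbitrary: c)
  case (Suc k)
  then show ?case by (auto intro!: exI[of _ "\<lambda>_ _. 0"])
qed auto

lemma C_k_on_bounded_linear: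
  assumes "bounded_linear h"
  shows "C_k_on k S h"
proof (cases k)
  case 0
  then show ?thesis by (simp add: assms linear_continuous_on)
next
  case (Suc n)
  then show ?thesis
    using assms by (auto intro!: exI[of _ "\<lambda>_. h"] bounded_linear_imp_has_derivative C_k_on_const)
qed

lemma C_k_on_bounded_linear_comp:
  assumes "bounded_linear h" "C_k_on k S f"
  shows "C_k_on k S (\<lambda>x. h (f x))"
  using assms(2)
proof (induction k arbitrary: f)
  case 0
  then show ?case by (simp add: bounded_linear.continuous_on[OF assms(1)])
next
  case (Suc k)
  then obtain D where D: "\<And>x. x \<in> S \<Longrightarrow> (f has_derivative D x) (at x)"
    "\<And>v. C_k_on k S (\<lambda>x. D x v)" by auto
  then show ?case
    by (auto intro!: exI[of _ "\<lambda>x v. h (D x v)"] bounded_linear.has_derivative[OF assms(1)] Suc.IH)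
qed

lemma C_k_on_add:
  assumes "C_k_on k S f" "C_k_on k S g"
  shows "C_k_on k S (\<lambda>x. f x + g x)"
  using assms
proof (induction k arbitrary: f g)
  case 0
  then show ?case by (simp add: continuous_on_add)
next
  case (Suc k)
  obtain D where D: "\<And>x. x \<in> S \<Longrightarrow> (f has_derivative D x) (at x)"
    "\<And>v. C_k_on k S (\<lambda>x. D x v)" by (rule C_k_on_SucE[OF Suc.prems(1)]) (rule that)
  obtain D' where D': "\<And>x. x \<in> S \<Longrightarrow> (g has_derivative D' x) (at x)"
    "\<And>v. C_k_on k S (\<lambda>x. D' x v)" by (rule C_k_on_SucE[OF Suc.prems(2)]) (rule that)
  show ?case
    by (auto intro!: exI[of _ "\<lambda>x v. D x v + D' x v"] has_derivative_add Suc.IH D D')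
qed

lemma C_k_on_sum:
  assumes "\<And>i. i \<in> I \<Longrightarrow> C_k_on k S (f i)"
  shows "C_k_on k S (\<lambda>x. \<Sum>i\<in>I. f i x)"
  using assms
  by (induction I rule: infinite_finite_induct) (auto intro!: C_k_on_add C_k_on_const)

lemma C_k_on_bilinear:
  assumes "bounded_bilinear b" "C_k_on k S f" "C_k_on k S g"
  shows "C_k_on k S (\<lambda>x. b (f x) (g x))"
  using assms(2,3)
proof (induction k arbitrary: f g)
  case 0
  then show ?case by (simp add: bounded_bilinear.continuous_on[OF assms(1)])
next
  case (Suc k)
  obtain D where D: "\<And>x. x \<in> S \<Longrightarrow> (f has_derivative D x) (at x)"
    "\<And>v. C_k_on k S (\<lambda>x. D x v)" by (rule C_k_on_SucE[OF Suc.prems(1)]) (rule that)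
  obtain D' where D': "\<And>x. x \<in> S \<Longrightarrow> (g has_derivative D' x) (at x)"
    "\<And>v. C_k_on k S (\<lambda>x. D' x v)" by (rule C_k_on_SucE[OF Suc.prems(2)]) (rule that)
  have "C_k_on k S f" "C_k_on k S g" using Suc.prems C_k_on_SucD by blast+
  then show ?case using D D'
    by (auto intro!: exI[of _ "\<lambda>x v. b (f x) (D' x v) + b (D x v) (g x)"] C_k_on_add Suc.IH
        bounded_bilinear.FDERIV[OF assms(1)])
qed

lemma C_k_on_compose:
  fixes f :: "'b::euclidean_space \<Rightarrow> 'c::real_normed_vector" and g :: "'a::euclidean_space \<Rightarrow> 'b"
  assumes "C_k_on k T f" "C_k_on k S g" "g ` S \<subseteq> T"
  shows "C_k_on k S (\<lambda>x. f (g x))"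
  using assms(1,2)
proof (induction k arbitrary: f)
  case 0
  then show ?case using assms(3) by (auto intro: continuous_on_compose2)
next
  case (Suc k)
  obtain D where D: "\<And>x. x \<in> T \<Longrightarrow> (f has_derivative D x) (at x)"
    "\<And>v. C_k_on k T (\<lambda>x. D x v)" by (rule C_k_on_SucE[OF Suc.prems(1)]) (rule that)
  obtain D' where D': "\<And>x. x \<in> S \<Longrightarrow> (g has_derivative D' x) (at x)"
    "\<And>v. C_k_on k S (\<lambda>x. D' x v)" by (rule C_k_on_SucE[OF Suc.prems(2)]) (rule that)
  have g: "C_k_on k S g" using Suc.prems C_k_on_SucD by blast
  \<comment> \<open>Derivatives are tested in fixed directions, whereas \<open>D' x v\<close> moves
    with \<open>x\<close>; expanding it in \<open>Basis\<close> leaves fixed directions with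
    coefficients of class \<open>C_k_on k\<close>. The case split makes the expansion an identity
    for all \<open>x\<close>, so no congruence on \<open>S\<close>, which may fail to be open, is
    involved.\<close>
  define E where "E = (\<lambda>x v. if x \<in> S then D (g x) (D' x v) else \<Sum>b\<in>Basis. (D' x v \<bullet> b) *\<^sub>R D (g x) b)"
  have E: "E x v = (\<Sum>b\<in>Basis. (D' x v \<bullet> b) *\<^sub>R D (g x) b)" for x v
  proof (cases "x \<in> S")
    case True
    then have "linear (D (g x))" using D(1) assms(3) has_derivative_linear by blast
    then have "D (g x) (\<Sum>b\<in>Basis. (D' x v \<bullet> b) *\<^sub>R b) = (\<Sum>b\<in>Basis. (D' x v \<bullet> b) *\<^sub>R D (g x) b)"
      by (simp add: linear_sum linear_scale)
    then show ?thesis using True by (simp add: E_def euclidean_representation)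
  qed (simp add: E_def)
  have "((\<lambda>x. f (g x)) has_derivative E x) (at x)" if "x \<in> S" for x
  proof -
    have "E x = D (g x) \<circ> D' x" using that by (auto simp: E_def)
    then show ?thesis
      using diff_chain_at[OF D'(1)[OF that] D(1)] that assms(3) by (auto simp: o_def)
  qed
  moreover have "C_k_on k S (\<lambda>x. E x v)" for v
    unfolding E
    by (intro C_k_on_sum C_k_on_bilinear[OF bounded_bilinear_scaleR] Suc.IH D D' g
        C_k_on_bounded_linear_comp[OF bounded_linear_inner_left])
  ultimately show ?case by auto
qed

lemma C_k_on_Pair:
  fixes f :: "'a::euclidean_space \<Rightarrow> 'b::real_normed_vector" and g :: "'a \<Rightarrow> 'c::real_normed_vector"
  assumes "C_k_on k S f" "C_k_on k S g"
  shows "C_k_on k S (\<lambda>x. (f x, g x))"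
proof -
  have "bounded_linear (\<lambda>x::'b. (x, 0::'c))" "bounded_linear (\<lambda>x::'c. (0::'b, x))"
    by (intro bounded_linear_Pair bounded_linear_ident bounded_linear_zero)+
  from C_k_on_bounded_linear_comp[OF this(1) assms(1)] C_k_on_bounded_linear_comp[OF this(2) assms(2)]
  have "C_k_on k S (\<lambda>x. (f x, 0) + (0, g x))" by (rule C_k_on_add)
  then show ?thesis by simp
qed

text \<open>These truncated powers are the raw material of the bump functions. Differentiation
  lowers the exponent by one, also at the corner 0, so each further power gains one order.\<close>

lemma C_k_on_power_max: "C_k_on k UNIV (\<lambda>t::real. (max 0 t) ^ Suc k)"
proof (induction k)
  case 0
  then show ?case by (auto intro!: continuous_intros)
next
  case (Suc k)
  have deriv: "((\<lambda>t::real. (max 0 t) ^ (k + 2)) has_real_derivative real (k + 2) * (max 0 t) ^ Suc k) (at t)" for t :: real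
  proof -
    consider "t > 0" | "t < 0" | "t = 0" by linarith
    then show ?thesis
    proof cases
      case 1
      have "((\<lambda>t::real. t ^ (k + 2)) has_real_derivative real (k + 2) * t ^ Suc k) (at t)"
        using DERIV_pow[of "k + 2" t] by simp
      then have "((\<lambda>t::real. (max 0 t) ^ (k + 2)) has_real_derivative real (k + 2) * t ^ Suc k) (at t)"
        by (rule has_field_derivative_transform_within_open[where S = "{0<..}"]) (use 1 in auto)
      with 1 show ?thesis by simp
    next
      case 2
      have "((\<lambda>t::real. (max 0 t) ^ (k + 2)) has_real_derivative 0) (at t)"
        by (rule has_field_derivative_transform_within_open[where S = "{..<0}" and f = "\<lambda>_. 0"])
          (use 2 in auto)
      with 2 show ?thesis by simp
    next
      case 3
      have "((\<lambda>h::real. (max 0 h) ^ (k + 2) / h) \<longlongrightarrow> 0) (at 0)"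
      proof (rule tendsto_0_le[where K = 1])
        show "((\<lambda>h::real. (max 0 h) ^ Suc k) \<longlongrightarrow> 0) (at 0)"
          by (auto intro!: tendsto_eq_intros)
        show "\<forall>\<^sub>F h in at 0. norm ((max 0 h) ^ (k + 2) / h) \<le> norm ((max 0 h) ^ Suc k :: real) * 1"
          by (intro always_eventually) (auto simp: max_def power_add)
      qed
      with 3 show ?thesis by (simp add: DERIV_def)
    qed
  qed
  show ?case
    using deriv Suc
    by (auto intro!: exI[of _ "\<lambda>t v. (real (k + 2) * (max 0 t) ^ Suc k) * v"]
        C_k_on_bilinear[OF bounded_bilinear_mult] C_k_on_const simp: has_field_derivative_def simp del: power_Suc)
qed

lemma smooth_onD: "smooth_on S f \<Longrightarrow> C_k_on k S f"
  by (simp add: smooth_on_def)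

section \<open>Smooth maps into a Lie group\<close>

text \<open>Curves, inverse charts and their products are all handled as maps of this kind, order by
  order. Continuity is a separate clause: it makes the chart preimages open when \<open>S\<close> is
  open.\<close>

definition C_k_map ::
  "('g::topological_space, 'e::euclidean_space) atlas \<Rightarrow> nat \<Rightarrow> 'a::euclidean_space set \<Rightarrow> ('a \<Rightarrow> 'g) \<Rightarrow> bool" where
  "C_k_map \<A> k S a \<longleftrightarrow> continuous_on S a \<and> (\<forall>(U, \<phi>)\<in>\<A>. C_k_on k (S \<inter> a -` U) (\<lambda>x. \<phi> (a x)))"

definition C_k_fun ::
  "('g, 'e::euclidean_space) atlas \<Rightarrow> nat \<Rightarrow> ('g \<Rightarrow> 'b::real_normed_vector) \<Rightarrow> bool" where
  "C_k_fun \<A> k f \<longleftrightarrow> (\<forall>(U, \<phi>)\<in>\<A>. C_k_on k (\<phi> ` U) (\<lambda>x. f (inv_into U \<phi> x)))"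

lemma smooth_fun_iff: "smooth_fun \<A> f \<longleftrightarrow> (\<forall>k. C_k_fun \<A> k f)"
  by (auto simp: smooth_fun_def C_k_fun_def smooth_on_def)

lemma smooth_curve_iff: "smooth_curve \<A> c \<longleftrightarrow> (\<forall>k. C_k_map \<A> k UNIV c)"
  by (auto simp: smooth_curve_def C_k_map_def smooth_on_def)

lemma C_k_map_continuous: "C_k_map \<A> k S a \<Longrightarrow> continuous_on S a"
  by (simp add: C_k_map_def)

lemma C_k_map_chartD:
  "C_k_map \<A> k S a \<Longrightarrow> (U, \<phi>) \<in> \<A> \<Longrightarrow> C_k_on k (S \<inter> a -` U) (\<lambda>x. \<phi> (a x))"
  by (auto simp: C_k_map_def)

lemma C_k_map_compose:
  assumes "C_k_map \<A> k T a" "C_k_on k S g" "g ` S \<subseteq> T"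
  shows "C_k_map \<A> k S (\<lambda>x. a (g x))"
  unfolding C_k_map_def
proof safe
  show "continuous_on S (\<lambda>x. a (g x))"
    by (rule continuous_on_compose2[OF C_k_map_continuous[OF assms(1)] C_k_on_imp_continuous[OF assms(2)] assms(3)])
  fix U \<phi> assume "(U, \<phi>) \<in> \<A>"
  then have "C_k_on k (T \<inter> a -` U) (\<lambda>x. \<phi> (a x))" using assms(1) by (rule C_k_map_chartD[rotated])
  then show "C_k_on k (S \<inter> (\<lambda>x. a (g x)) -` U) (\<lambda>x. \<phi> (a (g x)))"
    by (rule C_k_on_compose[OF _ C_k_on_subset[OF assms(2)]]) (use assms(3) in auto)
qed

context lie_group begin

lemma in_carrier [simp]: "x \<in> carrier G"
  using carrier_UNIV by simp

lemma chart_at: obtains U \<phi> where "(U, \<phi>) \<in> \<A>" "g \<in> U"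
proof -
  have "g \<in> (\<Union>(U, \<phi>)\<in>\<A>. U)" by (simp only: charts_cover UNIV_I)
  then show thesis by (auto intro: that)
qed

lemma
  assumes "(U, \<phi>) \<in> \<A>"
  shows chart_open: "open U" and chart_image_open: "open (\<phi> ` U)"
    and chart_inv: "x \<in> U \<Longrightarrow> inv_into U \<phi> (\<phi> x) = x"
    and chart_inv_in: "y \<in> \<phi> ` U \<Longrightarrow> inv_into U \<phi> y \<in> U"
    and chart_inv_right: "y \<in> \<phi> ` U \<Longrightarrow> \<phi> (inv_into U \<phi> y) = y"
    and chart_continuous: "continuous_on U \<phi>"
    and chart_inv_continuous: "continuous_on (\<phi> ` U) (inv_into U \<phi>)"
  using chart_homeo[OF assms] unfolding homeomorphism_def
  by (auto simp: inv_into_into f_inv_into_f)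

text \<open>Near each point both factors and the product stay in fixed charts; there the claim is
  the chain rule applied to \<open>mult_smooth\<close>.\<close>

lemma C_k_map_mult:
  assumes "open S" "C_k_map \<A> k S a" "C_k_map \<A> k S b"
  shows "C_k_map \<A> k S (\<lambda>x. a x \<otimes> b x)"
  unfolding C_k_map_def
proof safe
  have ca: "continuous_on S a" and cb: "continuous_on S b"
    using assms C_k_map_continuous by auto
  show cont: "continuous_on S (\<lambda>x. a x \<otimes> b x)"
    using continuous_on_compose2[OF mult_continuous, of S "\<lambda>x. (a x, b x)"] ca cb
    by (auto intro!: continuous_on_Pair)
  fix W \<theta> assume W: "(W, \<theta>) \<in> \<A>"
  show "C_k_on k (S \<inter> (\<lambda>x. a x \<otimes> b x) -` W) (\<lambda>x. \<theta> (a x \<otimes> b x))"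
  proof (rule C_k_on_local)
    fix x assume x: "x \<in> S \<inter> (\<lambda>x. a x \<otimes> b x) -` W"
    obtain U \<phi> where U: "(U, \<phi>) \<in> \<A>" "a x \<in> U" by (rule chart_at)
    obtain V \<psi> where V: "(V, \<psi>) \<in> \<A>" "b x \<in> V" by (rule chart_at)
    define T where "T = (S \<inter> a -` U) \<inter> (S \<inter> b -` V) \<inter> (S \<inter> (\<lambda>x. a x \<otimes> b x) -` W)"
    have "open T" unfolding T_def
      using assms(1) ca cb cont chart_open U V W by (intro open_Int continuous_open_preimage) auto
    moreover have "x \<in> T" using x U V by (auto simp: T_def)
    moreover have "C_k_on k T (\<lambda>x. \<theta> (a x \<otimes> b x))"
    proof -
      have "C_k_on k T (\<lambda>x. \<phi> (a x))" "C_k_on k T (\<lambda>x. \<psi> (b x))"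
        by (rule C_k_on_subset[OF C_k_map_chartD[OF assms(2) U(1)]] C_k_on_subset[OF C_k_map_chartD[OF assms(3) V(1)]];
            auto simp: T_def)+
      then have p: "C_k_on k T (\<lambda>x. (\<phi> (a x), \<psi> (b x)))" by (rule C_k_on_Pair)
      have img: "(\<lambda>x. (\<phi> (a x), \<psi> (b x))) ` T
          \<subseteq> {(x, y). x \<in> \<phi> ` U \<and> y \<in> \<psi> ` V \<and> inv_into U \<phi> x \<otimes> inv_into V \<psi> y \<in> W}"
        by (auto simp: T_def chart_inv[OF U(1)] chart_inv[OF V(1)])
      from C_k_on_compose[OF smooth_onD[OF mult_smooth[OF U(1) V(1) W]] p img]
      have "C_k_on k T (\<lambda>x. \<theta> (inv_into U \<phi> (\<phi> (a x)) \<otimes> inv_into V \<psi> (\<psi> (b x))))"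
        by (simp only: prod.case)
      then show ?thesis
        by (rule C_k_on_cong[OF \<open>open T\<close>]) (auto simp: T_def chart_inv[OF U(1)] chart_inv[OF V(1)])
    qed
    ultimately show "\<exists>T. open T \<and> x \<in> T \<and> C_k_on k T (\<lambda>x. \<theta> (a x \<otimes> b x))" by blast
  qed
qed

lemma C_k_map_inv:
  assumes "open S" "C_k_map \<A> k S a"
  shows "C_k_map \<A> k S (\<lambda>x. inv (a x))"
  unfolding C_k_map_def
proof safe
  have ca: "continuous_on S a" using assms C_k_map_continuous by auto
  show cont: "continuous_on S (\<lambda>x. inv (a x))"
    using continuous_on_compose2[OF inv_continuous ca] by auto
  fix W \<theta> assume W: "(W, \<theta>) \<in> \<A>"
  show "C_k_on k (S \<inter> (\<lambda>x. inv (a x)) -` W) (\<lambda>x. \<theta> (inv (a x)))"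
  proof (rule C_k_on_local)
    fix x assume x: "x \<in> S \<inter> (\<lambda>x. inv (a x)) -` W"
    obtain U \<phi> where U: "(U, \<phi>) \<in> \<A>" "a x \<in> U" by (rule chart_at)
    define T where "T = (S \<inter> a -` U) \<inter> (S \<inter> (\<lambda>x. inv (a x)) -` W)"
    have "open T" unfolding T_def
      using assms(1) ca cont chart_open U W by (intro open_Int continuous_open_preimage) auto
    moreover have "x \<in> T" using x U by (auto simp: T_def)
    moreover have "C_k_on k T (\<lambda>x. \<theta> (inv (a x)))"
    proof -
      have "C_k_on k T (\<lambda>x. \<phi> (a x))"
        by (rule C_k_on_subset[OF C_k_map_chartD[OF assms(2) U(1)]]) (auto simp: T_def)
      moreover have "(\<lambda>x. \<phi> (a x)) ` T \<subseteq> {x \<in> \<phi> ` U. inv (inv_into U \<phi> x) \<in> W}"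
        by (auto simp: T_def chart_inv[OF U(1)])
      ultimately
      have "C_k_on k T (\<lambda>x. \<theta> (inv (inv_into U \<phi> (\<phi> (a x)))))"
        using C_k_on_compose[OF smooth_onD[OF inv_smooth[OF U(1) W]]] by blast
      then show ?thesis
        by (rule C_k_on_cong[OF \<open>open T\<close>]) (auto simp: T_def chart_inv[OF U(1)])
    qed
    ultimately show "\<exists>T. open T \<and> x \<in> T \<and> C_k_on k T (\<lambda>x. \<theta> (inv (a x)))" by blast
  qed
qed

lemma C_k_map_const: "C_k_map \<A> k S (\<lambda>_. g)"
  by (auto simp: C_k_map_def C_k_on_const)

lemma C_k_map_chart:
  assumes "(U, \<phi>) \<in> \<A>"
  shows "C_k_map \<A> k (\<phi> ` U) (inv_into U \<phi>)"
  unfolding C_k_map_def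
proof safe
  show "continuous_on (\<phi> ` U) (inv_into U \<phi>)" using assms by (rule chart_inv_continuous)
  fix V \<psi> assume V: "(V, \<psi>) \<in> \<A>"
  show "C_k_on k (\<phi> ` U \<inter> inv_into U \<phi> -` V) (\<lambda>x. \<psi> (inv_into U \<phi> x))"
    by (rule C_k_on_subset[OF smooth_onD[OF transition_smooth[OF assms V]]])
       (auto simp: chart_inv[OF assms])
qed

lemma C_k_fun_map:
  assumes "open S" "C_k_map \<A> k S a" "C_k_fun \<A> k f"
  shows "C_k_on k S (\<lambda>x. f (a x))"
proof (rule C_k_on_local)
  fix x assume x: "x \<in> S"
  have ca: "continuous_on S a" using assms C_k_map_continuous by auto
  obtain U \<phi> where U: "(U, \<phi>) \<in> \<A>" "a x \<in> U" by (rule chart_at)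
  define T where "T = S \<inter> a -` U"
  have "open T" unfolding T_def
    using assms(1) ca chart_open U by (intro continuous_open_preimage) auto
  moreover have "x \<in> T" using x U by (auto simp: T_def)
  moreover have "C_k_on k T (\<lambda>x. f (a x))"
  proof -
    have 1: "C_k_on k T (\<lambda>x. \<phi> (a x))" unfolding T_def by (rule C_k_map_chartD[OF assms(2) U(1)])
    have "C_k_on k (\<phi> ` U) (\<lambda>x. f (inv_into U \<phi> x))" using assms(3) U by (auto simp: C_k_fun_def)
    from C_k_on_compose[OF this 1] have "C_k_on k T (\<lambda>x. f (inv_into U \<phi> (\<phi> (a x))))"
      by (auto simp: T_def)
    then show ?thesis
      by (rule C_k_on_cong[OF \<open>open T\<close>]) (auto simp: T_def chart_inv[OF U(1)])
  qed
  ultimately show "\<exists>T. open T \<and> x \<in> T \<and> C_k_on k T (\<lambda>x. f (a x))" by blast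
qed

lemma C_k_fun_continuous:
  assumes "C_k_fun \<A> k f"
  shows "continuous_on UNIV f"
proof (rule continuous_at_imp_continuous_on, rule ballI)
  fix g
  obtain U \<phi> where U: "(U, \<phi>) \<in> \<A>" "g \<in> U" by (rule chart_at)
  have "continuous_on (\<phi> ` U) (\<lambda>x. f (inv_into U \<phi> x))"
    using assms U by (intro C_k_on_imp_continuous[of k]) (auto simp: C_k_fun_def)
  from continuous_on_compose2[OF this chart_continuous[OF U(1)]]
  have "continuous_on U f" by (auto simp: chart_inv[OF U(1)] cong: continuous_on_cong)
  then show "continuous (at g) f" using U chart_open[OF U(1)] by (auto simp: continuous_on_eq_continuous_at)
qed

lemma smooth_fun_continuous: "smooth_fun \<A> f \<Longrightarrow> continuous_on UNIV f"
  using C_k_fun_continuous smooth_fun_iff by blast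

lemma smooth_fun_left_mult:
  assumes "smooth_fun \<A> f"
  shows "smooth_fun \<A> (\<lambda>g. f (h \<otimes> g))"
  unfolding smooth_fun_iff
proof
  fix k
  show "C_k_fun \<A> k (\<lambda>g. f (h \<otimes> g))"
    unfolding C_k_fun_def
  proof safe
    fix U \<phi> assume U: "(U, \<phi>) \<in> \<A>"
    show "C_k_on k (\<phi> ` U) (\<lambda>x. f (h \<otimes> inv_into U \<phi> x))"
      by (rule C_k_fun_map[OF _ C_k_map_mult[OF _ C_k_map_const C_k_map_chart[OF U]]])
        (use assms chart_image_open[OF U] in \<open>auto simp: smooth_fun_iff\<close>)
  qed
qed

lemma smooth_fun_left_mult_iff: "smooth_fun \<A> (\<lambda>g. f (h \<otimes> g)) \<longleftrightarrow> smooth_fun \<A> f"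
proof
  assume "smooth_fun \<A> (\<lambda>g. f (h \<otimes> g))"
  from smooth_fun_left_mult[OF this, of "inv h"]
  show "smooth_fun \<A> f" by (simp add: m_assoc[symmetric])
qed (rule smooth_fun_left_mult)

lemma smooth_curve_left_mult: "smooth_curve \<A> c \<Longrightarrow> smooth_curve \<A> (\<lambda>t. h \<otimes> c t)"
  by (auto simp: smooth_curve_iff intro: C_k_map_mult[OF open_UNIV C_k_map_const])

lemma smooth_curve_compose:
  assumes "smooth_curve \<A> c" "\<And>k. C_k_on k UNIV r"
  shows "smooth_curve \<A> (\<lambda>t. c (r t))"
  unfolding smooth_curve_iff
proof
  fix k
  from assms(1) have "C_k_map \<A> k UNIV c" by (simp add: smooth_curve_iff)
  from C_k_map_compose[OF this assms(2)] show "C_k_map \<A> k UNIV (\<lambda>t. c (r t))" by simp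
qed

end

text \<open>The shift \<open>a\<close> closes the induction, since the derivative of a sine is a
  shifted sine. Sine is used later to keep a curve inside a chart for all times.\<close>

lemma C_k_on_sin: "C_k_on k UNIV (\<lambda>t::real. sin (t + a))"
proof (induction k arbitrary: a)
  case 0
  then show ?case by (auto intro!: continuous_intros)
next
  case (Suc k)
  have cos: "cos (t + a) = sin (t + (a + pi / 2))" for t
    using sin_add[of "t + a" "pi / 2"] by (simp add: add.assoc)
  have "((\<lambda>t::real. sin (t + a)) has_real_derivative cos (t + a)) (at t)" for t
    by (auto intro!: derivative_eq_intros)
  then have "((\<lambda>t::real. sin (t + a)) has_derivative (\<lambda>v. sin (t + (a + pi/2)) * v)) (at t)" for t
    by (simp add: has_field_derivative_def cos)
  moreover have "C_k_on k UNIV (\<lambda>t. sin (t + (a + pi/2)) * v)" for v :: real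
    by (intro C_k_on_bilinear[OF bounded_bilinear_mult] Suc.IH C_k_on_const)
  ultimately show ?case by (auto intro!: exI[of _ "\<lambda>t v. sin (t + (a + pi/2)) * v"])
qed

section \<open>Tangent vectors and left invariant fields\<close>

text \<open>One chart at the identity serves for all tangent spaces, because left translation
  carries it to every point.\<close>

locale lie_group_chart = lie_group G \<A>
  for G :: "('g::{t2_space, second_countable_topology}, 'm) monoid_scheme" (structure)
    and \<A> :: "('g, 'e::euclidean_space) atlas" +
  fixes U :: "'g set" and \<theta> :: "'g \<Rightarrow> 'e"
  assumes chart_one: "(U, \<theta>) \<in> \<A>" and one_in_chart: "\<one> \<in> U"
begin

text \<open>The tangent vector at the identity with chart coordinates \<open>w\<close>. The value 0
  off the smooth functions matches \<open>velocity\<close>, so that equality of functionals can be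
  proved outright.\<close>

definition chart_vector :: "'e \<Rightarrow> 'g tangent" where
  "chart_vector w f =
     (if smooth_fun \<A> f then frechet_derivative (\<lambda>z. f (inv_into U \<theta> z)) (at (\<theta> \<one>)) w else 0)"

text \<open>The left logarithmic derivative of the curve: its velocity translated back to the
  identity and read in the chart.\<close>

definition curve_vector :: "(real \<Rightarrow> 'g) \<Rightarrow> real \<Rightarrow> 'e" where
  "curve_vector c t = vector_derivative (\<lambda>r. \<theta> (inv (c t) \<otimes> c r)) (at t)"

lemma theta_one_in: "\<theta> \<one> \<in> \<theta> ` U"
  using one_in_chart by simp

lemma inv_theta_one [simp]: "inv_into U \<theta> (\<theta> \<one>) = \<one>"
  using chart_inv[OF chart_one one_in_chart] .

lemma chart_vector_has_derivative:
  assumes "smooth_fun \<A> f"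
  shows "((\<lambda>z. f (inv_into U \<theta> z)) has_derivative (\<lambda>w. chart_vector w f)) (at (\<theta> \<one>))"
proof -
  have "C_k_on (Suc 0) (\<theta> ` U) (\<lambda>z. f (inv_into U \<theta> z))"
    using assms chart_one unfolding smooth_fun_iff C_k_fun_def by fast
  then have "(\<lambda>z. f (inv_into U \<theta> z)) differentiable (at (\<theta> \<one>))"
    using theta_one_in by (simp only: C_k_on_Suc_frechet[OF chart_image_open[OF chart_one]])
  then show ?thesis using assms by (simp add: frechet_derivative_works chart_vector_def[abs_def])
qed

lemma linear_chart_vector: "linear (\<lambda>w. chart_vector w f)"
proof (cases "smooth_fun \<A> f")
  case True
  from has_derivative_linear[OF chart_vector_has_derivative[OF this]] show ?thesis .
next
  case False
  then show ?thesis by (simp add: chart_vector_def module_hom_zero)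
qed

lemma left_push_mult: "left_push G h (left_push G p v) = left_push G (h \<otimes> p) v"
  by (simp add: left_push_def m_assoc)

lemma left_push_one: "left_push G \<one> v = v"
  by (simp add: left_push_def)

text \<open>The point \<open>inv (c t) \<otimes> c r\<close> is a smooth function of the pair
  \<open>(t, r)\<close>. Its partial derivative in \<open>r\<close> on the diagonal is therefore
  continuous in \<open>t\<close>, which the continuity of the speed needs.\<close>

lemma
  assumes "smooth_curve \<A> c"
  shows curve_vector: "((\<lambda>r. \<theta> (inv (c t) \<otimes> c r)) has_vector_derivative curve_vector c t) (at t)"
    and curve_vector_continuous: "continuous_on UNIV (curve_vector c)"
proof -
  define P where "P = (\<lambda>p::real \<times> real. inv (c (fst p)) \<otimes> c (snd p))"
  define \<Omega> where "\<Omega> = P -` U"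
  have c: "C_k_map \<A> k UNIV c" for k using assms by (simp add: smooth_curve_iff)
  have P: "C_k_map \<A> k UNIV P" for k
    unfolding P_def
    by (intro C_k_map_mult C_k_map_inv open_UNIV C_k_map_compose[OF c] C_k_on_bounded_linear
        bounded_linear_fst bounded_linear_snd) auto
  have "open \<Omega>" unfolding \<Omega>_def
    using continuous_open_vimage[of U P] C_k_map_continuous[OF P] chart_open[OF chart_one]
    by (auto simp: continuous_on_eq_continuous_at open_vimage)
  have "C_k_on 1 \<Omega> (\<lambda>p. \<theta> (P p))"
    using C_k_map_chartD[OF P chart_one, of 1] by (simp add: \<Omega>_def)
  then obtain D where D: "\<And>x. x \<in> \<Omega> \<Longrightarrow> ((\<lambda>p. \<theta> (P p)) has_derivative D x) (at x)"
    "\<And>v. C_k_on 0 \<Omega> (\<lambda>x. D x v)" unfolding One_nat_def by (rule C_k_on_SucE) (rule that)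
  have diag: "(t, t) \<in> \<Omega>" for t by (simp add: \<Omega>_def P_def one_in_chart)
  have der: "((\<lambda>r. \<theta> (inv (c t) \<otimes> c r)) has_vector_derivative D (t, t) (0, 1)) (at t)" for t
  proof -
    have "((\<lambda>r. (t, r)) has_derivative (\<lambda>r. (0, r))) (at t)"
      by (auto intro!: derivative_eq_intros)
    from has_derivative_compose[OF this D(1)[OF diag]]
    have 1: "((\<lambda>r. \<theta> (P (t, r))) has_derivative (\<lambda>r. D (t, t) (0, r))) (at t)" .
    have "D (t, t) (0, r) = r *\<^sub>R D (t, t) (0, 1)" for r
      using linear_scale[OF has_derivative_linear[OF D(1)[OF diag, of t]], of r "(0, 1)"] by simp
    then have "(\<lambda>r. D (t, t) (0, r)) = (\<lambda>r. r *\<^sub>R D (t, t) (0, 1))" by (rule ext)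
    with 1 have "((\<lambda>r. \<theta> (P (t, r))) has_vector_derivative D (t, t) (0, 1)) (at t)"
      by (simp only: has_vector_derivative_def)
    then show ?thesis by (simp add: P_def)
  qed
  then have eq: "curve_vector c t = D (t, t) (0, 1)" for t
    unfolding curve_vector_def by (rule vector_derivative_at)
  show "((\<lambda>r. \<theta> (inv (c t) \<otimes> c r)) has_vector_derivative curve_vector c t) (at t)"
    using der by (simp add: eq)
  have "continuous_on UNIV (\<lambda>t. D (t, t) (0, 1))"
    using D(2)[of "(0, 1)"] diag
    by (auto intro!: continuous_on_compose2[of \<Omega> "\<lambda>x. D x (0, 1)" UNIV "\<lambda>t. (t, t)"] continuous_intros)
  then show "continuous_on UNIV (curve_vector c)" by (simp add: eq[abs_def])
qed

text \<open>Writing \<open>f (c r)\<close> as \<open>h (inv (c t) \<otimes> c r)\<close> with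
  \<open>h\<close> a left translate of \<open>f\<close> brings the curve to the identity at time
  \<open>t\<close>, where the chain rule in the fixed chart applies.\<close>

lemma smooth_along_curve:
  assumes c: "smooth_curve \<A> c" and f: "smooth_fun \<A> f"
  shows "((\<lambda>r. f (c r)) has_real_derivative left_push G (c t) (chart_vector (curve_vector c t)) f) (at t)"
proof -
  define h where "h = (\<lambda>g. f (c t \<otimes> g))"
  define q where "q = (\<lambda>r. inv (c t) \<otimes> c r)"
  have h: "smooth_fun \<A> h" unfolding h_def by (rule smooth_fun_left_mult[OF f])
  have "((\<lambda>r. \<theta> (q r)) has_derivative (\<lambda>x. x *\<^sub>R curve_vector c t)) (at t)"
    using curve_vector[OF c, of t] by (simp add: q_def has_vector_derivative_def)
  moreover have "\<theta> (q t) = \<theta> \<one>" by (simp add: q_def)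
  ultimately have "((\<lambda>z. h (inv_into U \<theta> z)) \<circ> (\<lambda>r. \<theta> (q r)) has_derivative
      (\<lambda>w. chart_vector w h) \<circ> (\<lambda>x. x *\<^sub>R curve_vector c t)) (at t)"
    using diff_chain_at[of "\<lambda>r. \<theta> (q r)"] chart_vector_has_derivative[OF h] by metis
  then have 1: "((\<lambda>r. h (inv_into U \<theta> (\<theta> (q r)))) has_real_derivative chart_vector (curve_vector c t) h) (at t)"
    by (simp add: has_field_derivative_def o_def linear_scale[OF linear_chart_vector] mult_commute_abs)
  have cq: "continuous_on UNIV q"
    using c unfolding q_def smooth_curve_iff
    by (intro C_k_map_continuous[of \<A> 0] C_k_map_mult C_k_map_const) auto
  have "open (q -` U)" using cq chart_open[OF chart_one] by (simp add: open_vimage)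
  moreover have "t \<in> q -` U" by (simp add: q_def one_in_chart)
  ultimately have "((\<lambda>r. h (q r)) has_real_derivative chart_vector (curve_vector c t) h) (at t)"
    by (rule has_field_derivative_transform_within_open[OF 1]) (simp add: chart_inv[OF chart_one])
  then show ?thesis by (simp add: h_def q_def left_push_def m_assoc[symmetric])
qed

lemma velocity_eq:
  assumes "smooth_curve \<A> c"
  shows "velocity \<A> c t = left_push G (c t) (chart_vector (curve_vector c t))"
proof
  fix f
  show "velocity \<A> c t f = left_push G (c t) (chart_vector (curve_vector c t)) f"
  proof (cases "smooth_fun \<A> f")
    case True
    then show ?thesis using DERIV_imp_deriv[OF smooth_along_curve[OF assms True]] by (simp add: velocity_def)
  next
    case False
    then show ?thesis by (simp add: velocity_def left_push_def chart_vector_def smooth_fun_left_mult_iff)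
  qed
qed

text \<open>A smooth curve must exist for all times, but a straight line in the chart would leave
  it. Replacing \<open>t\<close> by \<open>sin (K * t) / K\<close> keeps the curve in a small ball
  without changing its velocity at 0.\<close>

lemma curve_with_vector:
  obtains c where "smooth_curve \<A> c" "c 0 = p" "curve_vector c 0 = w"
proof -
  obtain \<epsilon> where \<epsilon>: "\<epsilon> > 0" "ball (\<theta> \<one>) \<epsilon> \<subseteq> \<theta> ` U"
    using chart_image_open[OF chart_one] theta_one_in open_contains_ball by blast
  \<comment> \<open>The added 1 keeps \<open>K\<close> positive for \<open>w = 0\<close> and makes
    \<open>norm w / K\<close> strictly smaller than \<epsilon>.\<close>
  define K where "K = (norm w + 1) / \<epsilon>"
  have K: "K > 0" "norm w / K < \<epsilon>" using \<epsilon> by (auto simp: K_def field_simps add_pos_nonneg intro!: divide_pos_pos)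
  define l where "l = (\<lambda>t::real. \<theta> \<one> + (sin (K * t) / K) *\<^sub>R w)"
  have lk: "C_k_on k UNIV l" for k
  proof -
    have "C_k_on k UNIV (\<lambda>t::real. sin (K * t + 0))"
      by (rule C_k_on_compose[OF C_k_on_sin]) (auto intro!: C_k_on_bounded_linear bounded_linear_mult_right)
    then have "C_k_on k UNIV (\<lambda>t::real. \<theta> \<one> + sin (K * t) *\<^sub>R ((1 / K) *\<^sub>R w))"
      by (intro C_k_on_add C_k_on_const C_k_on_bilinear[OF bounded_bilinear_scaleR]) auto
    then show ?thesis by (simp add: l_def)
  qed
  have l_in: "l t \<in> \<theta> ` U" for t
  proof -
    have "norm ((sin (K * t) / K) *\<^sub>R w) \<le> norm w / K"
      using K by (auto simp: divide_simps abs_mult intro!: mult_left_le_one_le)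
    then have "l t \<in> ball (\<theta> \<one>) \<epsilon>" using K by (simp add: l_def dist_norm)
    then show ?thesis using \<epsilon> by blast
  qed
  define c where "c = (\<lambda>t. p \<otimes> inv_into U \<theta> (l t))"
  have "C_k_map \<A> k UNIV (\<lambda>t. inv_into U \<theta> (l t))" for k
    by (rule C_k_map_compose[OF C_k_map_chart[OF chart_one] lk]) (use l_in in auto)
  then have c: "smooth_curve \<A> c"
    unfolding c_def by (intro smooth_curve_left_mult) (simp add: smooth_curve_iff)
  have l0: "l 0 = \<theta> \<one>" by (simp add: l_def)
  have c0: "c 0 = p" by (simp add: c_def l0)
  have "\<theta> (inv (c 0) \<otimes> c r) = l r" for r
  proof -
    have "inv (c 0) \<otimes> c r = inv_into U \<theta> (l r)"
      by (simp add: c_def l0 m_assoc[symmetric])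
    then show ?thesis using chart_inv_right[OF chart_one l_in] by simp
  qed
  moreover have "(l has_vector_derivative w) (at 0)"
    unfolding l_def has_vector_derivative_def using K(1)
    by (auto intro!: derivative_eq_intros)
  ultimately have "curve_vector c 0 = w"
    unfolding curve_vector_def by (simp add: vector_derivative_at)
  with c c0 show thesis by (rule that)
qed

lemma tangent_space_eq: "tangent_space \<A> p = range (\<lambda>w. left_push G p (chart_vector w))"
proof safe
  fix v assume "v \<in> tangent_space \<A> p"
  then show "v \<in> range (\<lambda>w. left_push G p (chart_vector w))"
    using velocity_eq by (fastforce simp: tangent_space_def)
next
  fix w
  obtain c where "smooth_curve \<A> c" "c 0 = p" "curve_vector c 0 = w" by (rule curve_with_vector)
  then show "left_push G p (chart_vector w) \<in> tangent_space \<A> p"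
    using velocity_eq[of c 0] unfolding tangent_space_def by (metis (mono_tags, lifting) mem_Collect_eq)
qed

lemma tangent_space_one: "tangent_space \<A> \<one> = range chart_vector"
  by (simp add: tangent_space_eq left_push_one)

text \<open>Left translates of a vector are a partial derivative, in the second factor, of
  \<open>f\<close> composed with multiplication, hence depend smoothly on the point. Membership in
  \<open>lie_algebra\<close> is what makes the spanning clause of \<open>lie_algebra_onb\<close>
  applicable to \<open>w\<close>.\<close>

lemma chart_vector_lie_algebra: "(\<lambda>p. left_push G p (chart_vector w)) \<in> lie_algebra G \<A>"
proof -
  have "smooth_fun \<A> (\<lambda>p. left_push G p (chart_vector w) f)" if f: "smooth_fun \<A> f" for f
    unfolding smooth_fun_iff
  proof
    fix k
    show "C_k_fun \<A> k (\<lambda>p. left_push G p (chart_vector w) f)"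
      unfolding C_k_fun_def
    proof safe
      fix V \<psi> assume V: "(V, \<psi>) \<in> \<A>"
      define F where "F = (\<lambda>x. f (inv_into V \<psi> (fst x) \<otimes> inv_into U \<theta> (snd x)))"
      have op: "open (\<psi> ` V \<times> \<theta> ` U)"
        using chart_image_open[OF V] chart_image_open[OF chart_one] by (rule open_Times)
      \<comment> \<open>One order more than the goal, because the partial derivative uses one
        up.\<close>
      have "C_k_on (Suc k) (\<psi> ` V \<times> \<theta> ` U) F"
        unfolding F_def
        by (rule C_k_fun_map[OF op C_k_map_mult[OF op C_k_map_compose[OF C_k_map_chart[OF V]]
                C_k_map_compose[OF C_k_map_chart[OF chart_one]]]])
          (use f in \<open>auto intro!: C_k_on_bounded_linear bounded_linear_fst bounded_linear_snd simp: smooth_fun_iff simp del: C_k_on.simps\<close>)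
      then obtain D where D: "\<And>x. x \<in> \<psi> ` V \<times> \<theta> ` U \<Longrightarrow> (F has_derivative D x) (at x)"
        "\<And>v. C_k_on k (\<psi> ` V \<times> \<theta> ` U) (\<lambda>x. D x v)" by (rule C_k_on_SucE) (rule that)
      have eq: "D (y, \<theta> \<one>) (0, w) = left_push G (inv_into V \<psi> y) (chart_vector w) f" if "y \<in> \<psi> ` V" for y
      proof -
        have "((\<lambda>z. (y, z)) has_derivative (\<lambda>v. (0, v))) (at (\<theta> \<one>))"
          by (auto intro!: derivative_eq_intros)
        from diff_chain_at[OF this D(1)] that theta_one_in
        have "((\<lambda>z. F (y, z)) has_derivative (\<lambda>v. D (y, \<theta> \<one>) (0, v))) (at (\<theta> \<one>))"
          by (auto simp: o_def)
        moreover have "((\<lambda>z. F (y, z)) has_derivative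
            (\<lambda>v. chart_vector v (\<lambda>g. f (inv_into V \<psi> y \<otimes> g)))) (at (\<theta> \<one>))"
          using chart_vector_has_derivative[OF smooth_fun_left_mult[OF f, of "inv_into V \<psi> y"]]
          by (simp add: F_def)
        ultimately have "(\<lambda>v. D (y, \<theta> \<one>) (0, v)) = (\<lambda>v. chart_vector v (\<lambda>g. f (inv_into V \<psi> y \<otimes> g)))"
          by (rule has_derivative_unique)
        from fun_cong[OF this, of w] show ?thesis by (simp add: left_push_def)
      qed
      have "C_k_on k (\<psi> ` V) (\<lambda>y. (y, \<theta> \<one>))"
        by (intro C_k_on_Pair C_k_on_const C_k_on_bounded_linear bounded_linear_ident)
      from C_k_on_compose[OF D(2)[of "(0, w)"] this] theta_one_in
      have "C_k_on k (\<psi> ` V) (\<lambda>y. D (y, \<theta> \<one>) (0, w))" by auto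
      then show "C_k_on k (\<psi> ` V) (\<lambda>y. left_push G (inv_into V \<psi> y) (chart_vector w) f)"
        by (rule C_k_on_cong[OF chart_image_open[OF V]]) (simp add: eq)
    qed
  qed
  then show ?thesis
    by (auto simp: lie_algebra_def smooth_vector_field_def tangent_space_eq left_push_mult)
qed

end

section \<open>The two forms of the Lipschitz constant\<close>

lemma ennreal_inverse_antimono:
  fixes a b :: ennreal
  assumes "a \<le> b"
  shows "inverse b \<le> inverse a"
proof (cases "a = 0 \<or> b = \<infinity>")
  case False
  then obtain r s where "a = ennreal r" "r > 0" "b = ennreal s" "s \<ge> 0"
    by (cases a; cases b) (use assms in \<open>auto simp: top_unique less_le\<close>)
  with assms show ?thesis by (simp add: inverse_ennreal le_imp_inverse_le)
qed auto

text \<open>The empty family is included: the infimum is then infinite and the quotient 0, which is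
  the case of points in different components.\<close>

lemma divide_INF_ennreal_le:
  assumes "\<And>c. c \<in> C \<Longrightarrow> x \<le> M * l c" "0 \<le> x" "0 \<le> M" "\<And>c. c \<in> C \<Longrightarrow> 0 \<le> l c"
  shows "ennreal x / (INF c\<in>C. ennreal (l c)) \<le> ennreal M"
proof (cases "x = 0")
  case False
  let ?r = "INF c\<in>C. ennreal (l c)"
  show ?thesis
  proof (cases "C = {}")
    case True
    then show ?thesis by (simp add: ennreal_divide_top)
  next
    case nonempty: False
    then obtain c0 where c0: "c0 \<in> C" by blast
    have M: "M > 0"
      using assms(1)[OF c0] assms(2,3) False by (cases "M = 0") auto
    have le: "ennreal (x / M) \<le> ?r"
      using assms M by (auto intro!: INF_greatest ennreal_leI simp: field_simps)
    have "?r \<noteq> \<infinity>" using INF_lower[OF c0, of "\<lambda>c. ennreal (l c)"] by (metis ennreal_less_top infinity_ennreal_def leD)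
    then obtain r where r: "?r = ennreal r" "r \<ge> 0" by (cases ?r) auto
    have "x / M \<le> r" using le r by simp
    moreover have "x / M > 0" using assms False M by simp
    ultimately have "r > 0" by linarith
    with \<open>x / M \<le> r\<close> have "x / r \<le> M" using M by (simp add: field_simps)
    then show ?thesis unfolding r(1) using assms \<open>r > 0\<close> by (simp add: divide_ennreal ennreal_leI)
  qed
qed (simp)

locale riemannian_lie_group = lie_group_chart G \<A> U \<theta>
  for G :: "('g::{t2_space, second_countable_topology}, 'm) monoid_scheme" (structure)
    and \<A> :: "('g, 'e::euclidean_space) atlas" and U \<theta> +
  fixes m :: "'g \<Rightarrow> 'g tangent \<Rightarrow> 'g tangent \<Rightarrow> real"
    and X :: "'d::finite \<Rightarrow> 'g \<Rightarrow> 'g tangent"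
    and E :: "'d \<Rightarrow> real \<Rightarrow> 'g"
  assumes compact_group: "compact (UNIV :: 'g set)"
    and metric: "left_invariant_metric G \<A> m"
    and onb: "lie_algebra_onb G \<A> m X"
    and exponential: "is_exponential G \<A> (X j) (E j)"
begin

lemma frame_eq: "X j p = left_push G p (X j \<one>)"
  using onb by (simp add: lie_algebra_onb_def lie_algebra_def)

lemma frame_tangent: "X j \<one> \<in> tangent_space \<A> \<one>"
  using onb by (simp add: lie_algebra_onb_def lie_algebra_def smooth_vector_field_def)

definition frame_vector :: "'d \<Rightarrow> 'e" where
  "frame_vector j = (SOME w. X j \<one> = chart_vector w)"

lemma frame_vector: "X j \<one> = chart_vector (frame_vector j)"
  unfolding frame_vector_def
  by (rule someI_ex) (use frame_tangent[of j] in \<open>auto simp: tangent_space_one\<close>)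

text \<open>Reading coordinates off with the metric makes them depend only on the tangent vector,
  not on the chart coordinates that represent it.\<close>

definition frame_coord :: "'d \<Rightarrow> 'e \<Rightarrow> real" where
  "frame_coord j w = m \<one> (chart_vector w) (X j \<one>)"

lemma chart_vector_tangent: "chart_vector w \<in> tangent_space \<A> \<one>"
  by (simp add: tangent_space_one)

lemmas metric_unfolded = metric[unfolded left_invariant_metric_def riemannian_metric_def]

lemma metric_linear:
  "m \<one> (chart_vector (a *\<^sub>R w + b *\<^sub>R w')) (chart_vector z)
    = a * m \<one> (chart_vector w) (chart_vector z) + b * m \<one> (chart_vector w') (chart_vector z)"
proof -
  have "chart_vector (a *\<^sub>R w + b *\<^sub>R w') = (\<lambda>f. a * chart_vector w f + b * chart_vector w' f)"
    by (rule ext) (simp add: linear_add[OF linear_chart_vector] linear_scale[OF linear_chart_vector])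
  then show ?thesis
    using metric_unfolded[THEN conjunct1, THEN conjunct2, THEN conjunct1, rule_format,
        OF chart_vector_tangent chart_vector_tangent chart_vector_tangent] by simp
qed

lemma metric_bilinear: "linear (\<lambda>w. m \<one> (chart_vector w) (chart_vector z))"
proof (rule linearI)
  show "m \<one> (chart_vector (w + w')) (chart_vector z) = m \<one> (chart_vector w) (chart_vector z) + m \<one> (chart_vector w') (chart_vector z)" for w w'
    using metric_linear[of 1 w 1 w' z] by simp
  show "m \<one> (chart_vector (r *\<^sub>R w)) (chart_vector z) = r *\<^sub>R m \<one> (chart_vector w) (chart_vector z)" for r w
    using metric_linear[of r w 0 w z] by simp
qed

lemma linear_frame_coord: "linear (frame_coord j)"
  using metric_bilinear[of "frame_vector j"] by (simp add: frame_coord_def[abs_def] frame_vector)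

lemma frame_coord_frame_vector: "frame_coord i (frame_vector j) = (if j = i then 1 else 0)"
  using onb by (simp add: lie_algebra_onb_def frame_coord_def frame_vector[symmetric])

lemma frame_coord_sum: "frame_coord i (\<Sum>j\<in>UNIV. a j *\<^sub>R frame_vector j) = a i"
proof -
  have "frame_coord i (\<Sum>j\<in>UNIV. a j *\<^sub>R frame_vector j) = (\<Sum>j\<in>UNIV. a j * (if j = i then 1 else 0))"
    by (simp add: linear_sum[OF linear_frame_coord] linear_scale[OF linear_frame_coord] frame_coord_frame_vector)
  also have "\<dots> = (\<Sum>j\<in>UNIV. if j = i then a j else 0)" by (intro sum.cong) auto
  finally show ?thesis by simp
qed

lemma chart_vector_sum:
  "chart_vector (\<Sum>j\<in>UNIV. a j *\<^sub>R frame_vector j) f = (\<Sum>j\<in>UNIV. a j * X j \<one> f)"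
  by (simp add: linear_sum[OF linear_chart_vector] linear_scale[OF linear_chart_vector] frame_vector)

text \<open>The left invariant field through \<open>chart_vector w\<close> has some coefficients in
  the frame by the spanning clause; orthonormality identifies them with
  \<open>frame_coord\<close>.\<close>

lemma chart_vector_expand:
  "chart_vector w = chart_vector (\<Sum>j\<in>UNIV. frame_coord j w *\<^sub>R frame_vector j)"
proof -
  obtain a where a: "\<And>p f. left_push G p (chart_vector w) f = (\<Sum>j\<in>UNIV. a j * X j p f)"
    using onb chart_vector_lie_algebra unfolding lie_algebra_onb_def by meson
  have eq: "chart_vector w = chart_vector (\<Sum>j\<in>UNIV. a j *\<^sub>R frame_vector j)"
    using a[of \<one>] by (auto simp: left_push_one chart_vector_sum)
  have "frame_coord i w = frame_coord i (\<Sum>j\<in>UNIV. a j *\<^sub>R frame_vector j)" for i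
    unfolding frame_coord_def using eq by simp
  then have "frame_coord i w = a i" for i by (simp add: frame_coord_sum)
  with eq show ?thesis by simp
qed

lemma metric_chart_vector: "m \<one> (chart_vector w) (chart_vector w) = (\<Sum>j\<in>UNIV. (frame_coord j w)^2)"
proof -
  have sym: "m \<one> (chart_vector w) (chart_vector z) = m \<one> (chart_vector z) (chart_vector w)" for w z
    by (rule metric_unfolded[THEN conjunct1, THEN conjunct1, rule_format,
        OF chart_vector_tangent chart_vector_tangent])
  have "m \<one> (chart_vector w) (chart_vector w)
      = m \<one> (chart_vector (\<Sum>j\<in>UNIV. frame_coord j w *\<^sub>R frame_vector j)) (chart_vector w)"
    using chart_vector_expand[of w] by simp
  also have "\<dots> = (\<Sum>j\<in>UNIV. frame_coord j w * m \<one> (chart_vector (frame_vector j)) (chart_vector w))"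
    by (simp add: linear_sum[OF metric_bilinear] linear_scale[OF metric_bilinear])
  also have "\<dots> = (\<Sum>j\<in>UNIV. (frame_coord j w)^2)"
  proof -
    have "m \<one> (chart_vector (frame_vector j)) (chart_vector w) = frame_coord j w" for j
      unfolding frame_coord_def frame_vector by (rule sym)
    then show ?thesis by (simp add: power2_eq_square)
  qed
  finally show ?thesis .
qed

text \<open>By left invariance this is the Riemannian length of the velocity. All moving base points
  have been removed, so continuity in \<open>t\<close> is visible.\<close>

definition speed :: "(real \<Rightarrow> 'g) \<Rightarrow> real \<Rightarrow> real" where
  "speed c t = sqrt (\<Sum>j\<in>UNIV. (frame_coord j (curve_vector c t))^2)"

lemma metric_velocity:
  assumes "smooth_curve \<A> c"
  shows "sqrt (m (c t) (velocity \<A> c t) (velocity \<A> c t)) = speed c t"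
proof -
  have "m (c t \<otimes> \<one>) (left_push G (c t) v) (left_push G (c t) v) = m \<one> v v"
    if "v \<in> tangent_space \<A> \<one>" for v
    by (rule metric_unfolded[THEN conjunct2, rule_format, OF that that])
  from this[OF chart_vector_tangent] show ?thesis
    unfolding velocity_eq[OF assms] speed_def by (simp add: metric_chart_vector)
qed

lemma curve_length_eq: "smooth_curve \<A> c \<Longrightarrow> curve_length \<A> m c = integral {0..1} (speed c)"
  unfolding curve_length_def by (simp add: metric_velocity)

lemma speed_continuous: "smooth_curve \<A> c \<Longrightarrow> continuous_on S (speed c)"
  unfolding speed_def
  by (intro continuous_on_real_sqrt continuous_on_sum continuous_on_power
      linear_continuous_on_compose[OF continuous_on_subset[OF curve_vector_continuous] linear_frame_coord]) auto

lemma speed_nonneg: "0 \<le> speed c t"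
  by (simp add: speed_def sum_nonneg)

lemma lie_deriv_smooth:
  fixes f :: "'g \<Rightarrow> real"
  assumes "smooth_fun \<A> f"
  shows "lie_deriv G (E j) f g = X j g f"
proof -
  have "((\<lambda>t. f (g \<otimes> E j t)) has_real_derivative X j \<one> (\<lambda>p. f (g \<otimes> p))) (at 0)"
    by (rule exponential[of j, unfolded is_exponential_def, THEN conjunct2, THEN conjunct2, rule_format,
        OF smooth_fun_left_mult[OF assms]])
  then show ?thesis
    unfolding lie_deriv_def frame_eq[of j g] left_push_def
    by (simp add: vector_derivative_at has_real_derivative_iff_has_vector_derivative)
qed

lemma grad_sq_smooth:
  fixes f :: "'g \<Rightarrow> real"
  assumes "smooth_fun \<A> f"
  shows "grad_sq G E f g = (\<Sum>j\<in>UNIV. (X j g f)^2)"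
  using lie_deriv_smooth[OF assms] by (simp add: grad_sq_def)

lemma grad_le_lip_grad:
  fixes f :: "'g \<Rightarrow> real"
  assumes "smooth_fun \<A> f"
  shows "sqrt (grad_sq G E f g) \<le> lip_grad G E f"
proof -
  have "continuous_on UNIV (\<lambda>p. X j p f)" for j
    using onb assms smooth_fun_continuous
    by (auto simp: lie_algebra_onb_def lie_algebra_def smooth_vector_field_def)
  then have "continuous_on UNIV (\<lambda>g. sqrt (grad_sq G E f g))"
    unfolding grad_sq_smooth[OF assms] by (intro continuous_intros)
  from compact_continuous_image[OF this compact_group]
  have "bdd_above (range (\<lambda>g. sqrt (grad_sq G E f g)))"
    by (intro bounded_imp_bdd_above compact_imp_bounded)
  then show ?thesis unfolding lip_grad_def by (intro cSUP_upper UNIV_I)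
qed

lemma derivative_along_curve:
  fixes f :: "'g \<Rightarrow> real"
  assumes "smooth_fun \<A> f" "smooth_curve \<A> c"
  shows "((\<lambda>r. f (c r)) has_real_derivative (\<Sum>j\<in>UNIV. frame_coord j (curve_vector c t) * X j (c t) f)) (at t)"
proof -
  have "left_push G (c t) (chart_vector (curve_vector c t)) f
      = (\<Sum>j\<in>UNIV. frame_coord j (curve_vector c t) * X j (c t) f)"
    unfolding left_push_def chart_vector_expand[of "curve_vector c t"] chart_vector_sum
    by (simp add: frame_eq[of _ "c t"] left_push_def)
  then show ?thesis using smooth_along_curve[OF assms(2,1), of t] by simp
qed

text \<open>The fundamental theorem of calculus along the curve, with Cauchy-Schwarz in frame
  coordinates bounding the derivative by gradient times speed.\<close>

lemma difference_le_curve_length: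
  fixes f :: "'g \<Rightarrow> real"
  assumes f: "smooth_fun \<A> f" and c: "smooth_curve \<A> c"
  shows "\<bar>f (c 0) - f (c 1)\<bar> \<le> lip_grad G E f * curve_length \<A> m c"
proof -
  define d where "d = (\<lambda>t. \<Sum>j\<in>UNIV. frame_coord j (curve_vector c t) * X j (c t) f)"
  have der: "((\<lambda>r. f (c r)) has_real_derivative d t) (at t)" for t
    unfolding d_def by (rule derivative_along_curve[OF f c])
  have int: "(d has_integral f (c 1) - f (c 0)) {0..1}"
    by (rule fundamental_theorem_of_calculus)
       (use der in \<open>auto simp: has_real_derivative_iff_has_vector_derivative[symmetric]
          intro: has_field_derivative_at_within\<close>)
  have bound: "norm (d t) \<le> lip_grad G E f * speed c t" for t
  proof -
    have "(d t)^2 \<le> (\<Sum>j\<in>UNIV. (frame_coord j (curve_vector c t))^2) * (\<Sum>j\<in>UNIV. (X j (c t) f)^2)"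
      unfolding d_def by (rule Cauchy_Schwarz_ineq_sum)
    then have "sqrt ((d t)^2) \<le> speed c t * sqrt (grad_sq G E f (c t))"
      unfolding speed_def grad_sq_smooth[OF f] real_sqrt_mult[symmetric] by (rule real_sqrt_le_mono)
    also have "\<dots> \<le> speed c t * lip_grad G E f"
      by (intro mult_left_mono grad_le_lip_grad f speed_nonneg)
    finally show ?thesis by (simp add: mult.commute)
  qed
  have sint: "(\<lambda>t. lip_grad G E f * speed c t) integrable_on {0..1}"
    by (intro integrable_continuous_real continuous_intros speed_continuous c)
  have "norm (integral {0..1} d) \<le> integral {0..1} (\<lambda>t. lip_grad G E f * speed c t)"
    by (rule integral_norm_bound_integral) (use int sint bound in \<open>auto simp: has_integral_integrable\<close>)
  also have "\<dots> = lip_grad G E f * curve_length \<A> m c"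
    by (simp add: curve_length_eq[OF c])
  finally show ?thesis using integral_unique[OF int] by simp
qed

lemma lip_grad_nonneg:
  fixes f :: "'g \<Rightarrow> real"
  assumes "smooth_fun \<A> f"
  shows "0 \<le> lip_grad G E f"
  using grad_le_lip_grad[OF assms, of \<one>] by (rule order_trans[rotated]) (simp add: grad_sq_def sum_nonneg)

lemma curve_length_nonneg: "smooth_curve \<A> c \<Longrightarrow> 0 \<le> curve_length \<A> m c"
  unfolding curve_length_eq
  by (intro integral_nonneg integrable_continuous_real speed_continuous speed_nonneg)

lemma lip_dist_le:
  fixes f :: "'g \<Rightarrow> real"
  assumes f: "smooth_fun \<A> f"
  shows "lip_dist \<A> m f \<le> ennreal (lip_grad G E f)"
  unfolding lip_dist_def riem_dist_def
  by (rule SUP_least)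
     (auto intro!: divide_INF_ennreal_le lip_grad_nonneg[OF f] curve_length_nonneg
       dest: difference_le_curve_length[OF f] simp del: ennreal_le_iff)

text \<open>The initial piece of the curve is rescaled to unit time, the parametrisation that
  \<open>riem_dist\<close> prescribes.\<close>

lemma curve_length_initial:
  assumes c: "smooth_curve \<A> c" and t: "t > 0" and b: "\<And>s. 0 \<le> s \<Longrightarrow> s \<le> t \<Longrightarrow> speed c s \<le> b"
  shows "riem_dist \<A> m (c 0) (c t) \<le> ennreal (t * b)"
proof -
  define c' where "c' = (\<lambda>r. c (t * r))"
  have c': "smooth_curve \<A> c'" unfolding c'_def
    by (rule smooth_curve_compose[OF c]) (rule C_k_on_bounded_linear, rule bounded_linear_mult_right)
  have cv: "curve_vector c' r = t *\<^sub>R curve_vector c (t * r)" for r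
  proof -
    have "((\<lambda>r. t * r) has_vector_derivative t) (at r)"
      by (auto intro!: derivative_eq_intros)
    from vector_diff_chain_at[OF this curve_vector[OF c, of "t * r"]]
    have "((\<lambda>s. \<theta> (inv (c' r) \<otimes> c' s)) has_vector_derivative t *\<^sub>R curve_vector c (t * r)) (at r)"
      by (simp add: c'_def o_def)
    from vector_derivative_at[OF this] show ?thesis by (simp add: curve_vector_def)
  qed
  have sp: "speed c' r = t * speed c (t * r)" for r
    using t by (simp add: speed_def cv linear_scale[OF linear_frame_coord] power_mult_distrib
        sum_distrib_left[symmetric] real_sqrt_mult)
  have "curve_length \<A> m c' \<le> integral {0..1} (\<lambda>r::real. t * b)"
    unfolding curve_length_eq[OF c']
  proof (rule integral_le)
    show "speed c' integrable_on {0..1}"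
      by (intro integrable_continuous_real speed_continuous c')
    fix r :: real assume r: "r \<in> {0..1}"
    then have "t * r \<le> t * 1" using t by (intro mult_left_mono) auto
    then have "speed c (t * r) \<le> b" using r t by (intro b) auto
    then show "speed c' r \<le> t * b" using t by (simp add: sp)
  qed auto
  then have "curve_length \<A> m c' \<le> t * b" by simp
  moreover have "riem_dist \<A> m (c 0) (c t) \<le> ennreal (curve_length \<A> m c')"
    unfolding riem_dist_def by (rule INF_lower) (use c' in \<open>auto simp: c'_def\<close>)
  ultimately show ?thesis using ennreal_leI order_trans by blast
qed

text \<open>Let a curve leave \<open>g\<close> with the gradient as initial velocity and let
  \<open>N\<close> be the norm of the gradient. Then \<open>f\<close> grows at rate
  \<open>N^2\<close> and the speed is \<open>N\<close>, so the quotients approach at least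
  \<open>N\<close>. For short times both rates hold up to an error \<delta>, which finally tends to
  0.\<close>

lemma grad_le_lip_dist:
  fixes f :: "'g \<Rightarrow> real"
  assumes f: "smooth_fun \<A> f"
  shows "ennreal (sqrt (grad_sq G E f g)) \<le> lip_dist \<A> m f"
proof (cases "grad_sq G E f g = 0")
  case False
  define N where "N = sqrt (grad_sq G E f g)"
  have gn: "grad_sq G E f g \<ge> 0" by (simp add: grad_sq_def sum_nonneg)
  then have N: "N > 0" "N^2 = (\<Sum>j\<in>UNIV. (X j g f)^2)"
    using False by (auto simp: N_def grad_sq_smooth[OF f])
  obtain c where c: "smooth_curve \<A> c" "c 0 = g"
    and cv: "curve_vector c 0 = (\<Sum>j\<in>UNIV. X j g f *\<^sub>R frame_vector j)"
    by (rule curve_with_vector)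
  have s0: "speed c 0 = N" using N(1) by (simp add: speed_def cv frame_coord_sum N(2)[symmetric])
  have "((\<lambda>r. f (c r)) has_real_derivative N^2) (at 0)"
    using derivative_along_curve[OF f c(1), of 0]
    by (simp add: cv frame_coord_sum c(2) N(2)[unfolded power2_eq_square] power2_eq_square)
  then have lim: "((\<lambda>t. (f (c t) - f g) / t) \<longlongrightarrow> N^2) (at 0)"
    by (simp add: DERIV_def c(2))
  have step: "ennreal ((N^2 - \<delta>) / (N + \<delta>)) \<le> lip_dist \<A> m f" if \<delta>: "0 < \<delta>" "\<delta> < N^2" for \<delta>
  proof -
    have "\<forall>\<^sub>F t in at 0. (f (c t) - f g) / t > N^2 - \<delta>"
      using lim \<delta> by (intro order_tendstoD) auto
    then obtain t1 where t1: "t1 > 0" "\<And>t. t \<noteq> 0 \<Longrightarrow> \<bar>t\<bar> < t1 \<Longrightarrow> (f (c t) - f g) / t > N^2 - \<delta>"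
      unfolding eventually_at by (auto simp: dist_real_def)
    have "isCont (speed c) 0"
      using speed_continuous[OF c(1), of UNIV] by (simp add: continuous_on_eq_continuous_at)
    then obtain t2 where t2: "t2 > 0" "\<And>t. \<bar>t\<bar> < t2 \<Longrightarrow> \<bar>speed c t - N\<bar> < \<delta>"
      unfolding continuous_at_eps_delta using \<delta>(1) s0 by (metis diff_zero dist_real_def)
    define t where "t = min t1 t2 / 2"
    have t: "t > 0" "t < t1" "t < t2" using t1(1) t2(1) by (auto simp: t_def)
    have d1: "f (c t) - f g > t * (N^2 - \<delta>)"
      using t1(2)[of t] t by (simp add: field_simps)
    then have pos: "f (c t) - f g > 0" using t \<delta> by (smt (verit) mult_pos_pos)
    then have ne: "c t \<noteq> g" by auto
    have "speed c s \<le> N + \<delta>" if "0 \<le> s" "s \<le> t" for s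
      using t2(2)[of s] that t by (auto simp: abs_if split: if_splits)
    from curve_length_initial[OF c(1) t(1) this]
    have rd: "riem_dist \<A> m g (c t) \<le> ennreal (t * (N + \<delta>))" by (simp add: c(2))
    have "ennreal ((N^2 - \<delta>) / (N + \<delta>)) = ennreal (t * (N^2 - \<delta>)) / ennreal (t * (N + \<delta>))"
      using t \<delta> N by (subst divide_ennreal) auto
    also have "\<dots> \<le> ennreal (norm (f g - f (c t))) / riem_dist \<A> m g (c t)"
      unfolding divide_ennreal_def
      by (intro mult_mono ennreal_leI ennreal_inverse_antimono rd) (use d1 pos in auto)
    also have "\<dots> \<le> lip_dist \<A> m f"
      unfolding lip_dist_def by (rule SUP_upper2[of "(g, c t)"]) (use ne in auto)
    finally show ?thesis .
  qed
  have "((\<lambda>\<delta>. ennreal ((N^2 - \<delta>) / (N + \<delta>))) \<longlongrightarrow> ennreal ((N^2 - 0) / (N + 0))) (at_right 0)"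
    using N by (intro tendsto_ennrealI tendsto_intros) auto
  moreover have "\<forall>\<^sub>F \<delta> in at_right 0. ennreal ((N^2 - \<delta>) / (N + \<delta>)) \<le> lip_dist \<A> m f"
    unfolding eventually_at_right_field using step N by (metis zero_less_power)
  ultimately have "ennreal ((N^2 - 0) / (N + 0)) \<le> lip_dist \<A> m f"
    by (rule tendsto_upperbound) simp
  then show ?thesis using N(1) by (simp add: N_def[symmetric] power2_eq_square)
qed simp

lemma lip_dist_eq_lip_grad:
  fixes f :: "'g \<Rightarrow> real"
  assumes f: "smooth_fun \<A> f"
  shows "lip_dist \<A> m f = ennreal (lip_grad G E f)"
proof (rule antisym[OF lip_dist_le[OF f]])
  show "ennreal (lip_grad G E f) \<le> lip_dist \<A> m f"
  proof (cases "lip_dist \<A> m f")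
    case (real r)
    then have "sqrt (grad_sq G E f g) \<le> r" for g
      using grad_le_lip_dist[OF f, of g] by simp
    then show ?thesis unfolding lip_grad_def real by (intro ennreal_leI cSUP_least) auto
  qed simp
qed

end

section \<open>Smoothness of continuous representations\<close>

context lie_group begin

section \<open>Haar measure on a compact group\<close>

lemma continuous_left_mult: "continuous_on UNIV (\<lambda>g. h \<otimes> g)"
  using continuous_on_compose2[OF mult_continuous continuous_on_Pair[OF continuous_on_const continuous_on_id], of h UNIV]
  by simp

lemma haar_space: "normalized_haar G \<mu> \<Longrightarrow> space \<mu> = UNIV"
  unfolding normalized_haar_def using sets_eq_imp_space_eq[of \<mu> borel] by simp

lemma haar_prob_space: "normalized_haar G \<mu> \<Longrightarrow> emeasure \<mu> (space \<mu>) = 1"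
  using haar_space by (simp add: normalized_haar_def)

lemma haar_left_mult_measurable: "normalized_haar G \<mu> \<Longrightarrow> (\<lambda>g. h \<otimes> g) \<in> measurable \<mu> borel"
  using borel_measurable_continuous_onI[OF continuous_left_mult[of h]] measurable_cong_sets[of \<mu> borel borel borel]
  unfolding normalized_haar_def by blast

lemma haar_integral_left_mult:
  fixes f :: "'g \<Rightarrow> 'b::{banach, second_countable_topology}"
  assumes "normalized_haar G \<mu>" "f \<in> borel_measurable borel"
  shows "(LINT g|\<mu>. f (h \<otimes> g)) = (LINT g|\<mu>. f g)"
  using integral_distr[OF haar_left_mult_measurable[OF assms(1)] assms(2), of h] assms(1)
  by (simp add: normalized_haar_def)

text \<open>The preimages are left translates of \<open>N\<close>, and every group element lies in
  one of them. The finite cover is used for the positivity of Haar measure on open sets and again in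
  the case \<open>\<kappa> > 1\<close>.\<close>

lemma finite_left_translates_cover:
  assumes comp: "compact (UNIV :: 'g set)" and N: "open N" "x \<in> N"
  shows "\<exists>H. finite H \<and> (\<Union>h\<in>H. (\<lambda>g. h \<otimes> g) -` N) = UNIV"
proof -
  have op: "open ((\<lambda>g. h \<otimes> g) -` N)" for h
    using N(1) continuous_left_mult by (simp add: open_vimage)
  have "UNIV \<subseteq> (\<Union>h. (\<lambda>g. h \<otimes> g) -` N)"
  proof
    fix g :: 'g
    have "(x \<otimes> inv g) \<otimes> g \<in> N" using N(2) by (simp add: m_assoc)
    then show "g \<in> (\<Union>h. (\<lambda>g. h \<otimes> g) -` N)" by blast
  qed
  then obtain H where "finite H" "UNIV \<subseteq> (\<Union>h\<in>H. (\<lambda>g. h \<otimes> g) -` N)"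
    using compactE_image[OF comp, of UNIV "\<lambda>h. (\<lambda>g. h \<otimes> g) -` N"] op by metis
  then show ?thesis by blast
qed

text \<open>If \<open>N\<close> were a null set, finitely many of its translates, all null by
  invariance, would cover a space of measure 1.\<close>

lemma haar_open_positive:
  assumes haar: "normalized_haar G \<mu>" and comp: "compact (UNIV :: 'g set)" and N: "open N" "x \<in> N"
  shows "emeasure \<mu> N \<noteq> 0"
proof
  assume zero: "emeasure \<mu> N = 0"
  have op: "open ((\<lambda>g. h \<otimes> g) -` N)" for h
    using N(1) continuous_left_mult by (simp add: open_vimage)
  obtain H where H: "finite H" "(\<Union>h\<in>H. (\<lambda>g. h \<otimes> g) -` N) = UNIV"
    using finite_left_translates_cover[OF comp N] by blast
  have sets: "sets \<mu> = sets borel" using haar by (simp add: normalized_haar_def)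
  have "emeasure \<mu> ((\<lambda>g. h \<otimes> g) -` N) = emeasure \<mu> N" for h
    using emeasure_distr[OF haar_left_mult_measurable[OF haar], of N h] haar N haar_space[OF haar]
    by (simp add: normalized_haar_def)
  then have "emeasure \<mu> (\<Union>h\<in>H. (\<lambda>g. h \<otimes> g) -` N) \<le> (\<Sum>h\<in>H. 0)"
    using emeasure_subadditive_finite[OF H(1), of "\<lambda>h. (\<lambda>g. h \<otimes> g) -` N" \<mu>] borel_open[OF op] zero sets
    by (auto simp: image_subset_iff)
  then show False using haar by (simp add: H(2) normalized_haar_def)
qed

lemma haar_integrable_continuous:
  fixes f :: "'g \<Rightarrow> 'b::{banach, second_countable_topology}"
  assumes haar: "normalized_haar G \<mu>" and comp: "compact (UNIV :: 'g set)" and f: "continuous_on UNIV f"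
  shows "integrable \<mu> f"
proof -
  interpret finite_measure \<mu> using haar_prob_space[OF haar] by (intro finite_measureI) simp
  obtain C where C: "\<And>g. norm (f g) \<le> C"
    using compact_imp_bounded[OF compact_continuous_image[OF f comp]] unfolding bounded_iff by auto
  have "f \<in> borel_measurable \<mu>"
    using haar borel_measurable_continuous_onI[OF f] measurable_cong_sets[of \<mu> borel borel borel]
    unfolding normalized_haar_def by blast
  then show ?thesis by (rule integrable_const_bound[of _ C, OF AE_I2[OF C]])
qed

lemma haar_integral_norm_le:
  fixes f :: "'g \<Rightarrow> 'b::{banach, second_countable_topology}"
  assumes haar: "normalized_haar G \<mu>" and comp: "compact (UNIV :: 'g set)" and f: "continuous_on UNIV f"
    and C: "\<And>g. norm (f g) \<le> C"
  shows "norm (LINT g|\<mu>. f g) \<le> C"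
proof -
  interpret finite_measure \<mu> using haar_prob_space[OF haar] by (intro finite_measureI) simp
  have "norm (LINT g|\<mu>. f g) \<le> (LINT g|\<mu>. norm (f g))" by (rule integral_norm_bound)
  also have "\<dots> \<le> C"
  proof -
    have "(LINT g|\<mu>. norm (f g)) \<le> (LINT g|\<mu>. C)"
      using haar_integrable_continuous[OF haar comp f] C by (intro integral_mono) auto
    then show ?thesis using haar_prob_space[OF haar] by (simp add: measure_def)
  qed
  finally show ?thesis .
qed

section \<open>Differentiation under the Haar integral\<close>

lemma joint_continuous_of_charts:
  assumes S: "open S"
    and \<Phi>: "\<And>W \<eta>. (W, \<eta>) \<in> \<A> \<Longrightarrow> C_k_on k (S \<times> \<eta> ` W) (\<lambda>p. \<Phi> (fst p) (inv_into W \<eta> (snd p)))"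
  shows "continuous_on (S \<times> UNIV) (\<lambda>p. \<Phi> (fst p) (snd p))"
proof (rule continuous_at_imp_continuous_on, rule ballI)
  fix p assume p: "p \<in> S \<times> (UNIV :: 'g set)"
  obtain W \<eta> where W: "(W, \<eta>) \<in> \<A>" "snd p \<in> W" by (rule chart_at)
  have "continuous_on (S \<times> W) (\<lambda>p. \<eta> (snd p))"
    by (rule continuous_on_compose2[OF chart_continuous[OF W(1)] continuous_on_snd[OF continuous_on_id]]) auto
  then have "continuous_on (S \<times> W) (\<lambda>p. (fst p, \<eta> (snd p)))"
    by (intro continuous_on_Pair continuous_on_fst continuous_on_id)
  moreover have "(\<lambda>p. (fst p, \<eta> (snd p))) ` (S \<times> W) \<subseteq> S \<times> \<eta> ` W" by auto
  ultimately have "continuous_on (S \<times> W) (\<lambda>p. \<Phi> (fst p) (inv_into W \<eta> (\<eta> (snd p))))"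
    using continuous_on_compose2[OF C_k_on_imp_continuous[OF \<Phi>[OF W(1)]], of "S \<times> W" "\<lambda>p. (fst p, \<eta> (snd p))"]
    by simp
  then have "continuous_on (S \<times> W) (\<lambda>p. \<Phi> (fst p) (snd p))"
    by (rule continuous_on_eq) (auto simp: chart_inv[OF W(1)])
  moreover have "open (S \<times> W)" by (intro open_Times S chart_open[OF W(1)])
  ultimately show "isCont (\<lambda>p. \<Phi> (fst p) (snd p)) p"
    using p W(2) continuous_on_eq_continuous_at by (metis mem_Times_iff)
qed

text \<open>Joint continuity on a compact group makes the partial derivative in \<open>y\<close>
  continuous uniformly in \<open>h\<close>, so it may be taken inside the integral. Regularity is
  assumed jointly in \<open>y\<close> and the chart coordinate of \<open>h\<close>, a form that the
  partial derivative inherits at the next lower order; this drives the induction.\<close>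

lemma C_k_on_param_integral:
  fixes S :: "'a::euclidean_space set" and \<Phi> :: "'a \<Rightarrow> 'g \<Rightarrow> real" and q :: "'g \<Rightarrow> 'b::euclidean_space"
  assumes haar: "normalized_haar G \<mu>" and comp: "compact (UNIV :: 'g set)"
    and S: "open S" and q: "continuous_on UNIV q"
    and \<Phi>: "\<And>W \<eta>. (W, \<eta>) \<in> \<A> \<Longrightarrow> C_k_on k (S \<times> \<eta> ` W) (\<lambda>p. \<Phi> (fst p) (inv_into W \<eta> (snd p)))"
  shows "C_k_on k S (\<lambda>y. LINT h|\<mu>. \<Phi> y h *\<^sub>R q h)"
proof -
  obtain C where C: "\<And>h. norm (q h) \<le> C" "C > 0"
    using compact_imp_bounded[OF compact_continuous_image[OF q comp]] unfolding bounded_pos by auto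
  have bound: "norm (LINT h|\<mu>. \<Psi> h *\<^sub>R q h) \<le> \<epsilon> * C"
    if "continuous_on UNIV \<Psi>" "\<And>h. \<bar>\<Psi> h\<bar> \<le> \<epsilon>" for \<Psi> \<epsilon>
  proof (rule haar_integral_norm_le[OF haar comp])
    show "continuous_on UNIV (\<lambda>h. \<Psi> h *\<^sub>R q h)" by (intro continuous_intros that q)
    show "norm (\<Psi> h *\<^sub>R q h) \<le> \<epsilon> * C" for h
      using that(2)[of h] C(1)[of h] by (simp add: mult_mono')
  qed
  have int: "integrable \<mu> (\<lambda>h. \<Psi> h *\<^sub>R q h)" if "continuous_on UNIV \<Psi>" for \<Psi>
    by (intro haar_integrable_continuous[OF haar comp] continuous_intros that q)
  have slice: "continuous_on UNIV (\<lambda>h. \<Psi> y h)"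
    if "continuous_on (S \<times> UNIV) (\<lambda>p. \<Psi> (fst p) (snd p))" "y \<in> S" for \<Psi> :: "'a \<Rightarrow> 'g \<Rightarrow> real" and y
    using continuous_on_compose2[OF that(1) continuous_on_Pair[OF continuous_on_const continuous_on_id], of y UNIV] that(2)
    by auto
  show ?thesis
    using \<Phi>
  proof (induction k arbitrary: \<Phi>)
    case 0
    have joint: "continuous_on (S \<times> UNIV) (\<lambda>p. \<Phi> (fst p) (snd p))"
      by (rule joint_continuous_of_charts[OF S 0])
    have "isCont (\<lambda>y. LINT h|\<mu>. \<Phi> y h *\<^sub>R q h) y0" if y0: "y0 \<in> S" for y0
      unfolding continuous_at_eps_delta
    proof (intro allI impI)
      fix e :: real assume e: "e > 0"
      obtain X0 where X0: "y0 \<in> X0" "open X0"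
        "\<forall>y\<in>X0 \<inter> S. \<forall>h\<in>UNIV. dist (\<Phi> (fst (y, h)) (snd (y, h))) (\<Phi> (fst (y0, h)) (snd (y0, h))) \<le> e / (2 * C)"
        using continuous_on_prod_compactE[OF joint comp y0, of "e / (2 * C)"] e C by auto
      obtain d where d: "d > 0" "ball y0 d \<subseteq> X0 \<inter> S"
        using open_contains_ball[of "X0 \<inter> S"] X0 S y0 by blast
      have "dist (LINT h|\<mu>. \<Phi> y h *\<^sub>R q h) (LINT h|\<mu>. \<Phi> y0 h *\<^sub>R q h) < e" if "dist y y0 < d" for y
      proof -
        have y: "y \<in> X0" "y \<in> S" using d that by (auto simp: dist_commute subset_iff)
        note c = slice[OF joint y(2)] slice[OF joint y0]
        have "norm (LINT h|\<mu>. (\<Phi> y h - \<Phi> y0 h) *\<^sub>R q h) \<le> e / (2 * C) * C"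
          using X0(3) y by (intro bound continuous_intros c) (auto simp: dist_real_def)
        also have "(LINT h|\<mu>. (\<Phi> y h - \<Phi> y0 h) *\<^sub>R q h)
            = (LINT h|\<mu>. \<Phi> y h *\<^sub>R q h) - (LINT h|\<mu>. \<Phi> y0 h *\<^sub>R q h)"
          using int[OF c(1)] int[OF c(2)] by (simp add: scaleR_diff_left)
        finally show ?thesis using e C by (simp add: dist_norm)
      qed
      then show "\<exists>d>0. \<forall>y. dist y y0 < d \<longrightarrow>
          dist (LINT h|\<mu>. \<Phi> y h *\<^sub>R q h) (LINT h|\<mu>. \<Phi> y0 h *\<^sub>R q h) < e"
        using d(1) by blast
    qed
    then show ?case by (simp add: continuous_at_imp_continuous_on)
  next
    case (Suc k)
    \<comment> \<open>The partial derivative in \<open>y\<close> for fixed \<open>h\<close>. Being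
      canonical it is the same function in every chart around \<open>h\<close>.\<close>
    define d\<Phi> where "d\<Phi> = (\<lambda>y h v. frechet_derivative (\<lambda>y. \<Phi> y h) (at y) v)"
    have local: "(\<forall>y\<in>S. \<forall>z\<in>\<eta> ` W. ((\<lambda>y. \<Phi> y (inv_into W \<eta> z)) has_derivative d\<Phi> y (inv_into W \<eta> z)) (at y)) \<and>
        (\<forall>v. C_k_on k (S \<times> \<eta> ` W) (\<lambda>p. d\<Phi> (fst p) (inv_into W \<eta> (snd p)) v))"
      if W: "(W, \<eta>) \<in> \<A>" for W \<eta>
    proof -
      obtain D where D: "\<And>p. p \<in> S \<times> \<eta> ` W \<Longrightarrow> ((\<lambda>p. \<Phi> (fst p) (inv_into W \<eta> (snd p))) has_derivative D p) (at p)"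
        "\<And>v. C_k_on k (S \<times> \<eta> ` W) (\<lambda>p. D p v)"
        by (rule C_k_on_SucE[OF Suc.prems[OF W]]) (rule that)
      have der: "((\<lambda>y. \<Phi> y (inv_into W \<eta> z)) has_derivative (\<lambda>v. D (y, z) (v, 0))) (at y)"
        if "y \<in> S" "z \<in> \<eta> ` W" for y z
      proof -
        have 1: "((\<lambda>y. (y, z)) has_derivative (\<lambda>v. (v, 0))) (at y)"
          by (auto intro!: derivative_eq_intros)
        have "(y, z) \<in> S \<times> \<eta> ` W" using that by simp
        from has_derivative_compose[OF 1 D(1)[OF this]] show ?thesis by simp
      qed
      then have eq: "d\<Phi> y (inv_into W \<eta> z) = (\<lambda>v. D (y, z) (v, 0))" if "y \<in> S" "z \<in> \<eta> ` W" for y z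
        using frechet_derivative_at[OF der[OF that]] by (simp add: d\<Phi>_def)
      have "open (S \<times> \<eta> ` W)" by (intro open_Times S chart_image_open[OF W])
      then have "C_k_on k (S \<times> \<eta> ` W) (\<lambda>p. d\<Phi> (fst p) (inv_into W \<eta> (snd p)) v)" for v
        by (rule C_k_on_cong[OF _ D(2)[of "(v, 0)"]]) (auto simp: eq)
      then show ?thesis using der eq by simp
    qed
    have der: "((\<lambda>y. \<Phi> y h) has_derivative d\<Phi> y h) (at y)" if y: "y \<in> S" for y h
    proof -
      obtain W \<eta> where W: "(W, \<eta>) \<in> \<A>" "h \<in> W" by (rule chart_at)
      have "\<eta> h \<in> \<eta> ` W" using W(2) by simp
      from local[OF W(1), THEN conjunct1, rule_format, OF y this]
      show ?thesis by (simp add: chart_inv[OF W])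
    qed
    have joint: "continuous_on (S \<times> UNIV) (\<lambda>p. d\<Phi> (fst p) (snd p) v)" for v
      by (rule joint_continuous_of_charts[OF S, where \<Phi> = "\<lambda>y h. d\<Phi> y h v"]) (use local in blast)
    have joint0: "continuous_on (S \<times> UNIV) (\<lambda>p. \<Phi> (fst p) (snd p))"
      by (rule joint_continuous_of_charts[OF S Suc.prems])
    note dlin = has_derivative_linear[OF der]
    have IH: "C_k_on k S (\<lambda>y. LINT h|\<mu>. d\<Phi> y h v *\<^sub>R q h)" for v
      by (rule Suc.IH) (use local in blast)
    have main: "((\<lambda>y. LINT h|\<mu>. \<Phi> y h *\<^sub>R q h) has_derivative (\<lambda>v. LINT h|\<mu>. d\<Phi> y0 h v *\<^sub>R q h)) (at y0)"
      if y0: "y0 \<in> S" for y0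
      unfolding has_derivative_at_alt
    proof (intro conjI allI impI)
      note cs = slice[OF joint y0]
      show "bounded_linear (\<lambda>v. LINT h|\<mu>. d\<Phi> y0 h v *\<^sub>R q h)"
        unfolding linear_conv_bounded_linear[symmetric]
        by (rule linearI)
           (simp_all add: linear_add[OF dlin[OF y0]] linear_scale[OF dlin[OF y0]] scaleR_add_left
              int[OF cs] flip: scaleR_scaleR)
      fix e :: real assume e: "e > 0"
      \<comment> \<open>The factor \<open>DIM('a)\<close> pays for a sum over basis directions and
        \<open>C\<close> for the bound on \<open>q\<close>.\<close>
      define \<epsilon> where "\<epsilon> = e / (C * DIM('a))"
      have \<epsilon>: "\<epsilon> > 0" using e C by (simp add: \<epsilon>_def)
      \<comment> \<open>Compactness of the group makes the neighbourhood independent of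
        \<open>h\<close>. It may depend on the direction \<open>b\<close>, but only the finitely
        many in \<open>Basis\<close> are intersected.\<close>
      have "\<exists>X0. y0 \<in> X0 \<and> open X0 \<and> (\<forall>y\<in>X0 \<inter> S. \<forall>h. \<bar>d\<Phi> y h b - d\<Phi> y0 h b\<bar> \<le> \<epsilon>)" for b
      proof -
        obtain X0 where "y0 \<in> X0" "open X0"
          "\<forall>y\<in>X0 \<inter> S. \<forall>h\<in>UNIV. dist (d\<Phi> (fst (y, h)) (snd (y, h)) b) (d\<Phi> (fst (y0, h)) (snd (y0, h)) b) \<le> \<epsilon>"
          by (rule continuous_on_prod_compactE[OF joint[of b] comp y0 \<epsilon>]) (rule that)
        then show ?thesis by (intro exI[of _ X0]) (simp add: dist_real_def)
      qed
      then obtain X0 where X0':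
        "\<forall>b. y0 \<in> X0 b \<and> open (X0 b) \<and> (\<forall>y\<in>X0 b \<inter> S. \<forall>h. \<bar>d\<Phi> y h b - d\<Phi> y0 h b\<bar> \<le> \<epsilon>)"
        by (rule exE[OF choice[OF allI]]) (rule that)
      then have X0: "\<And>b. y0 \<in> X0 b" "\<And>b. open (X0 b)"
        "\<And>b y h. y \<in> X0 b \<Longrightarrow> y \<in> S \<Longrightarrow> \<bar>d\<Phi> y h b - d\<Phi> y0 h b\<bar> \<le> \<epsilon>" by auto
      have "open ((\<Inter>b\<in>Basis. X0 b) \<inter> S)" using X0 S by (intro open_Int open_INT) auto
      moreover have "y0 \<in> (\<Inter>b\<in>Basis. X0 b) \<inter> S" using X0(1) y0 by simp
      ultimately obtain d where d: "d > 0" "ball y0 d \<subseteq> (\<Inter>b\<in>Basis. X0 b) \<inter> S"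
        using open_contains_ball by blast
      have lin: "\<bar>\<Phi> y h - \<Phi> y0 h - d\<Phi> y0 h (y - y0)\<bar> \<le> norm (y - y0) * (DIM('a) * \<epsilon>)"
        if y: "y \<in> ball y0 d" for y h
      proof -
        have "norm (\<Phi> y h - \<Phi> y0 h - d\<Phi> y0 h (y - y0)) \<le> norm (y - y0) * (DIM('a) * \<epsilon>)"
        proof (rule differentiable_bound_linearization[where S = "ball y0 d"])
          show "y0 + t *\<^sub>R (y - y0) \<in> ball y0 d" if "t \<in> {0..1}" for t
          proof -
            have "t * norm (y - y0) \<le> norm (y - y0)" using that by (intro mult_left_le_one_le) auto
            then show ?thesis using y that by (simp add: dist_norm norm_minus_commute)
          qed
          show "((\<lambda>y. \<Phi> y h) has_derivative d\<Phi> x h) (at x within ball y0 d)" if "x \<in> ball y0 d" for x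
          proof -
            have "x \<in> S" using that d by blast
            then show ?thesis by (rule has_derivative_at_withinI[OF der])
          qed
          show "onorm ((d\<Phi> x h) - (d\<Phi> y0 h)) \<le> DIM('a) * \<epsilon>" if x: "x \<in> ball y0 d" for x
          proof (rule onorm_bound)
            have xS: "x \<in> S" using d x by blast
            show "norm ((d\<Phi> x h - d\<Phi> y0 h) v) \<le> DIM('a) * \<epsilon> * norm v" for v
            proof -
              have "(d\<Phi> x h - d\<Phi> y0 h) v = (d\<Phi> x h - d\<Phi> y0 h) (\<Sum>b\<in>Basis. (v \<bullet> b) *\<^sub>R b)"
                by (simp add: euclidean_representation)
              also have "\<dots> = (\<Sum>b\<in>Basis. (v \<bullet> b) * (d\<Phi> x h b - d\<Phi> y0 h b))"
                by (simp add: linear_sum[OF dlin[OF xS]] linear_sum[OF dlin[OF y0]] linear_scale[OF dlin[OF xS]]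
                    linear_scale[OF dlin[OF y0]] sum_subtractf[symmetric] right_diff_distrib)
              also have "\<bar>\<dots>\<bar> \<le> (\<Sum>b\<in>(Basis :: 'a set). norm v * \<epsilon>)"
                using x d X0(3) xS
                by (intro order_trans[OF sum_abs] sum_mono) (auto simp: abs_mult Basis_le_norm intro!: mult_mono)
              finally show ?thesis by (simp add: mult_ac)
            qed
          qed (use \<epsilon> in simp)
        qed (use d in simp)
        then show ?thesis by simp
      qed
      show "\<exists>d>0. \<forall>y. norm (y - y0) < d \<longrightarrow> norm ((LINT h|\<mu>. \<Phi> y h *\<^sub>R q h) - (LINT h|\<mu>. \<Phi> y0 h *\<^sub>R q h)
          - (LINT h|\<mu>. d\<Phi> y0 h (y - y0) *\<^sub>R q h)) \<le> e * norm (y - y0)"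
      proof (intro exI[of _ d] conjI allI impI d(1))
        fix y assume "norm (y - y0) < d"
        then have y: "y \<in> ball y0 d" by (simp add: dist_norm norm_minus_commute)
        then have yS: "y \<in> S" using d by blast
        note c = slice[OF joint0 yS] slice[OF joint0 y0] cs
        have "norm (LINT h|\<mu>. (\<Phi> y h - \<Phi> y0 h - d\<Phi> y0 h (y - y0)) *\<^sub>R q h)
            \<le> norm (y - y0) * (DIM('a) * \<epsilon>) * C"
          by (intro bound continuous_intros c lin y)
        also have "\<dots> = e * norm (y - y0)" using C by (simp add: \<epsilon>_def)
        also have "(LINT h|\<mu>. (\<Phi> y h - \<Phi> y0 h - d\<Phi> y0 h (y - y0)) *\<^sub>R q h)
          = (LINT h|\<mu>. \<Phi> y h *\<^sub>R q h) - (LINT h|\<mu>. \<Phi> y0 h *\<^sub>R q h) - (LINT h|\<mu>. d\<Phi> y0 h (y - y0) *\<^sub>R q h)"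
          using int[OF c(1)] int[OF c(2)] int[OF c(3)] by (simp add: scaleR_diff_left)
        finally show "norm ((LINT h|\<mu>. \<Phi> y h *\<^sub>R q h) - (LINT h|\<mu>. \<Phi> y0 h *\<^sub>R q h)
          - (LINT h|\<mu>. d\<Phi> y0 h (y - y0) *\<^sub>R q h)) \<le> e * norm (y - y0)" .
      qed
    qed
    show ?case
      using main IH by (auto intro!: exI[of _ "\<lambda>y v. LINT h|\<mu>. d\<Phi> y h v *\<^sub>R q h"])
  qed
qed

text \<open>A truncated power of \<open>r^2\<close> minus the squared distance in a chart, extended
  by zero. The ball of radius \<open>r\<close> is chosen so small that its image lies in
  \<open>N\<close>.\<close>

lemma bump_function:
  assumes N: "open N" "\<one> \<in> N"
  obtains \<phi> :: "'g \<Rightarrow> real" where "C_k_fun \<A> k \<phi>" "\<And>g. 0 \<le> \<phi> g" "0 < \<phi> \<one>" "\<And>g. \<phi> g \<noteq> 0 \<Longrightarrow> g \<in> N"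
proof -
  obtain U \<theta> where U: "(U, \<theta>) \<in> \<A>" "\<one> \<in> U" by (rule chart_at)
  have UN: "open (\<theta> ` (U \<inter> N))"
  proof -
    have "\<theta> ` (U \<inter> N) = \<theta> ` U \<inter> inv_into U \<theta> -` N"
      by (auto simp: chart_inv[OF U(1)])
    moreover have "open (\<theta> ` U \<inter> inv_into U \<theta> -` N)"
      by (rule continuous_open_preimage[OF chart_inv_continuous[OF U(1)] chart_image_open[OF U(1)] N(1)])
    ultimately show ?thesis by simp
  qed
  moreover have "\<theta> \<one> \<in> \<theta> ` (U \<inter> N)" using U N by simp
  ultimately obtain r where r: "r > 0" "cball (\<theta> \<one>) r \<subseteq> \<theta> ` (U \<inter> N)"
    using open_contains_cball by blast
  define \<beta> where "\<beta> = (\<lambda>z. (max 0 (r^2 - (z - \<theta> \<one>) \<bullet> (z - \<theta> \<one>))) ^ Suc k)"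
  define \<phi> where "\<phi> = (\<lambda>g. if g \<in> U then \<beta> (\<theta> g) else 0)"
  \<comment> \<open>The image of the closed ball is compact, hence closed in the Hausdorff group. So
    \<phi> vanishes on an open set containing all points outside \<open>U\<close>, and the extension
    by zero loses no regularity.\<close>
  define K where "K = inv_into U \<theta> ` cball (\<theta> \<one>) r"
  have "compact K" unfolding K_def
    using r by (intro compact_continuous_image continuous_on_subset[OF chart_inv_continuous[OF U(1)]]) auto
  then have "closed K" by (rule compact_imp_closed)
  have inK: "g \<in> K" if "g \<in> U" "dist (\<theta> \<one>) (\<theta> g) \<le> r" for g
    using that chart_inv[OF U(1), of g] by (force simp: K_def)
  have zero: "\<beta> z = 0" if "dist (\<theta> \<one>) z \<ge> r" for z
  proof -
    have "r^2 \<le> (norm (z - \<theta> \<one>))^2" using that r(1) by (intro power_mono) (auto simp: dist_norm norm_minus_commute)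
    then show ?thesis by (simp add: \<beta>_def power2_norm_eq_inner)
  qed
  have KU: "K \<subseteq> U" using r chart_inv_in[OF U(1)] by (fastforce simp: K_def)
  have zeroK: "\<phi> g = 0" if "g \<notin> K" for g
  proof (cases "g \<in> U")
    case True
    then have "r \<le> dist (\<theta> \<one>) (\<theta> g)" using that inK[of g] by linarith
    with True show ?thesis using zero by (simp add: \<phi>_def)
  qed (simp add: \<phi>_def)
  have \<beta>k: "C_k_on k UNIV \<beta>"
  proof -
    have 1: "C_k_on k UNIV (\<lambda>z. z - \<theta> \<one>)"
      using C_k_on_add[OF C_k_on_bounded_linear[OF bounded_linear_ident] C_k_on_const[of k UNIV "- \<theta> \<one>"]] by simp
    have "C_k_on k UNIV (\<lambda>z. r^2 + (-1) * ((z - \<theta> \<one>) \<bullet> (z - \<theta> \<one>)))"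
      by (intro C_k_on_add C_k_on_const C_k_on_bilinear[OF bounded_bilinear_mult]
          C_k_on_bilinear[OF bounded_bilinear_inner] 1)
    from C_k_on_compose[OF C_k_on_power_max this] show ?thesis by (simp add: \<beta>_def)
  qed
  have "C_k_fun \<A> k \<phi>"
    unfolding C_k_fun_def
  proof safe
    fix V \<psi> assume V: "(V, \<psi>) \<in> \<A>"
    note contV = chart_inv_continuous[OF V] and opV = chart_image_open[OF V]
    show "C_k_on k (\<psi> ` V) (\<lambda>x. \<phi> (inv_into V \<psi> x))"
    proof (rule C_k_on_local)
      fix x assume x: "x \<in> \<psi> ` V"
      show "\<exists>T. open T \<and> x \<in> T \<and> C_k_on k T (\<lambda>x. \<phi> (inv_into V \<psi> x))"
      proof (cases "inv_into V \<psi> x \<in> U")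
        case True
        define T where "T = \<psi> ` V \<inter> inv_into V \<psi> -` U"
        have T: "open T" unfolding T_def by (rule continuous_open_preimage[OF contV opV chart_open[OF U(1)]])
        have "C_k_on k T (\<lambda>x. \<theta> (inv_into V \<psi> x))"
          unfolding T_def by (rule C_k_map_chartD[OF C_k_map_chart[OF V] U(1)])
        from C_k_on_compose[OF \<beta>k this] have "C_k_on k T (\<lambda>x. \<beta> (\<theta> (inv_into V \<psi> x)))" by simp
        then have "C_k_on k T (\<lambda>x. \<phi> (inv_into V \<psi> x))"
          by (rule C_k_on_cong[OF T]) (auto simp: T_def \<phi>_def)
        with T True x show ?thesis by (auto simp: T_def)
      next
        case False
        define T where "T = \<psi> ` V \<inter> inv_into V \<psi> -` (- K)"
        have T: "open T" unfolding T_def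
          by (rule continuous_open_preimage[OF contV opV]) (use \<open>closed K\<close> in auto)
        have "C_k_on k T (\<lambda>x. \<phi> (inv_into V \<psi> x))"
          by (rule C_k_on_cong[OF T C_k_on_const[of k T 0]]) (auto simp: T_def zeroK)
        with T False x KU show ?thesis by (auto simp: T_def)
      qed
    qed
  qed
  moreover have "0 \<le> \<phi> g" for g by (simp add: \<phi>_def \<beta>_def)
  moreover have "0 < \<phi> \<one>" using U r by (simp add: \<phi>_def \<beta>_def)
  moreover have "g \<in> N" if "\<phi> g \<noteq> 0" for g
  proof -
    have "g \<in> K" using that zeroK by blast
    then obtain z where z: "z \<in> cball (\<theta> \<one>) r" "g = inv_into U \<theta> z" by (auto simp: K_def)
    then obtain g' where "g' \<in> U \<inter> N" "z = \<theta> g'" using r(2) by blast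
    then show ?thesis using z by (simp add: chart_inv[OF U(1)])
  qed
  ultimately show thesis by (rule that)
qed

text \<open>A continuous finite-dimensional representation is smooth: the vectors \<open>\<integral> \<phi>(h) \<pi>(h) x d\<mu>(h)\<close>
  with \<open>\<phi>\<close> a bump function have smooth orbit maps and are dense, hence they are all vectors.\<close>

lemma continuous_representation_smooth:
  fixes \<pi> :: "'g \<Rightarrow> 'b::euclidean_space \<Rightarrow> 'b"
  assumes haar: "normalized_haar G \<mu>" and comp: "compact (UNIV :: 'g set)"
    and lin: "\<And>g. linear (\<pi> g)" and hom: "\<And>g h x. \<pi> (g \<otimes> h) x = \<pi> g (\<pi> h x)"
    and one: "\<And>x. \<pi> \<one> x = x" and cont: "\<And>x. continuous_on UNIV (\<lambda>g. \<pi> g x)"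
  shows "smooth_fun \<A> (\<lambda>g. \<pi> g x)"
  unfolding smooth_fun_iff
proof
  fix k
  \<comment> \<open>Orbits are taken at \<open>inv g\<close> because left invariance turns
    \<open>\<pi> (inv g) y\<close> into an average where \<open>g\<close> occurs only inside \<phi>.
    Smoothness of inversion undoes this at the end.\<close>
  define V where "V = {x. C_k_fun \<A> k (\<lambda>g. \<pi> (inv g) x)}"
  have blin: "bounded_linear (\<pi> g)" for g using lin by (simp add: linear_conv_bounded_linear)
  have "subspace V"
    unfolding subspace_def V_def C_k_fun_def
    by (auto simp: linear_0[OF lin] linear_add[OF lin] linear_scale[OF lin] C_k_on_const
        intro!: C_k_on_add C_k_on_bounded_linear_comp[OF bounded_linear_scaleR_right])
  then have "closed V" by (rule closed_subspace)
  have "x \<in> closure V" for x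
    unfolding closure_approachable
  proof (intro allI impI)
    fix e :: real assume e: "e > 0"
    define N where "N = {h. norm (\<pi> h x - x) < e / 2}"
    have "open N" unfolding N_def
      by (intro open_Collect_less continuous_intros cont)
    moreover have "\<one> \<in> N" using e by (simp add: N_def one)
    ultimately obtain \<phi> :: "'g \<Rightarrow> real" where \<phi>: "C_k_fun \<A> k \<phi>" "\<And>g. 0 \<le> \<phi> g" "0 < \<phi> \<one>" "\<And>g. \<phi> g \<noteq> 0 \<Longrightarrow> g \<in> N"
      by (rule bump_function[where k = k]) (rule that)
    have c\<phi>: "continuous_on UNIV \<phi>" by (rule C_k_fun_continuous[OF \<phi>(1)])
    define c where "c = (LINT h|\<mu>. \<phi> h)"
    define y where "y = (LINT h|\<mu>. \<phi> h *\<^sub>R \<pi> h x)"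
    have int\<phi>: "integrable \<mu> \<phi>" by (rule haar_integrable_continuous[OF haar comp c\<phi>])
    have int\<phi>\<pi>: "integrable \<mu> (\<lambda>h. \<phi> h *\<^sub>R \<pi> h x)"
      by (intro haar_integrable_continuous[OF haar comp] continuous_intros c\<phi> cont)
    have c: "c > 0"
    proof -
      have "c \<noteq> 0"
      proof
        assume "c = 0"
        then have "AE h in \<mu>. \<phi> h = 0"
          using integral_nonneg_eq_0_iff_AE[OF int\<phi>] \<phi>(2) by (simp add: c_def)
        moreover have "{h. \<phi> h \<noteq> 0} \<in> sets \<mu>"
          using haar open_Collect_neq[OF c\<phi> continuous_on_const[of UNIV 0]] by (simp add: normalized_haar_def)
        ultimately have "emeasure \<mu> {h. \<phi> h \<noteq> 0} = 0"
          by (subst (asm) AE_iff_measurable[OF _ refl]) (auto simp: haar_space[OF haar])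
        then show False
          using haar_open_positive[OF haar comp open_Collect_neq[OF c\<phi> continuous_on_const[of UNIV 0]], of \<one>] \<phi>(3)
          by simp
      qed
      moreover have "c \<ge> 0" unfolding c_def using \<phi>(2) by (simp add: integral_nonneg)
      ultimately show ?thesis by simp
    qed
    have "y \<in> V"
      unfolding V_def mem_Collect_eq C_k_fun_def
    proof safe
      fix W \<psi> assume W: "(W, \<psi>) \<in> \<A>"
      have eq: "\<pi> (inv g) y = (LINT h|\<mu>. \<phi> (g \<otimes> h) *\<^sub>R \<pi> h x)" for g
      proof -
        have "\<pi> (inv g) y = (LINT h|\<mu>. \<pi> (inv g) (\<phi> h *\<^sub>R \<pi> h x))"
          unfolding y_def by (rule integral_bounded_linear[OF blin int\<phi>\<pi>, symmetric])
        also have "\<dots> = (LINT h|\<mu>. \<phi> (g \<otimes> (inv g \<otimes> h)) *\<^sub>R \<pi> (inv g \<otimes> h) x)"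
          by (simp add: linear_scale[OF lin] hom m_assoc[symmetric])
        also have "\<dots> = (LINT h|\<mu>. \<phi> (g \<otimes> h) *\<^sub>R \<pi> h x)"
        proof (rule haar_integral_left_mult[OF haar])
          have "continuous_on UNIV (\<lambda>h. \<phi> (g \<otimes> h))"
            using continuous_on_compose2[OF c\<phi> continuous_left_mult] by simp
          then show "(\<lambda>h. \<phi> (g \<otimes> h) *\<^sub>R \<pi> h x) \<in> borel_measurable borel"
            by (intro borel_measurable_continuous_onI continuous_intros cont)
        qed
        finally show ?thesis .
      qed
      show "C_k_on k (\<psi> ` W) (\<lambda>z. \<pi> (inv (inv_into W \<psi> z)) y)"
        unfolding eq
      proof (rule C_k_on_param_integral[OF haar comp chart_image_open[OF W] cont])
        fix W' \<eta> assume W': "(W', \<eta>) \<in> \<A>"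
        have op: "open (\<psi> ` W \<times> \<eta> ` W')" by (intro open_Times chart_image_open W W')
        show "C_k_on k (\<psi> ` W \<times> \<eta> ` W') (\<lambda>p. \<phi> (inv_into W \<psi> (fst p) \<otimes> inv_into W' \<eta> (snd p)))"
          by (rule C_k_fun_map[OF op C_k_map_mult[OF op C_k_map_compose[OF C_k_map_chart[OF W]]
                C_k_map_compose[OF C_k_map_chart[OF W']]] \<phi>(1)])
             (auto intro!: C_k_on_bounded_linear bounded_linear_fst bounded_linear_snd simp del: C_k_on.simps)
      qed
    qed
    then have "(1 / c) *\<^sub>R y \<in> V" using \<open>subspace V\<close> by (simp add: subspace_scale)
    moreover have "dist ((1 / c) *\<^sub>R y) x < e"
    proof -
      have "norm (y - c *\<^sub>R x) \<le> c * (e / 2)"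
      proof -
        have "y - c *\<^sub>R x = (LINT h|\<mu>. \<phi> h *\<^sub>R (\<pi> h x - x))"
          using int\<phi> int\<phi>\<pi> by (simp add: y_def c_def scaleR_diff_right)
        also have "norm \<dots> \<le> (LINT h|\<mu>. norm (\<phi> h *\<^sub>R (\<pi> h x - x)))" by (rule integral_norm_bound)
        also have "\<dots> \<le> (LINT h|\<mu>. \<phi> h * (e / 2))"
        proof (rule integral_mono)
          show "integrable \<mu> (\<lambda>h. norm (\<phi> h *\<^sub>R (\<pi> h x - x)))"
            by (intro haar_integrable_continuous[OF haar comp] continuous_intros c\<phi> cont)
          show "norm (\<phi> h *\<^sub>R (\<pi> h x - x)) \<le> \<phi> h * (e / 2)" for h
          proof (cases "\<phi> h = 0")
            case False
            then have "norm (\<pi> h x - x) \<le> e / 2" using \<phi>(4)[of h] by (simp add: N_def)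
            then have "\<phi> h * norm (\<pi> h x - x) \<le> \<phi> h * (e / 2)" by (rule mult_left_mono[OF _ \<phi>(2)])
            then show ?thesis using \<phi>(2) by simp
          qed simp
        qed (use int\<phi> in simp)
        also have "\<dots> = c * (e / 2)" by (simp add: c_def)
        finally show ?thesis .
      qed
      moreover have "(1 / c) *\<^sub>R y - x = (1 / c) *\<^sub>R (y - c *\<^sub>R x)" using c by (simp add: scaleR_diff_right)
      ultimately have "norm ((1 / c) *\<^sub>R y - x) \<le> e / 2" using c by (simp only: norm_scaleR) (simp add: field_simps)
      then show ?thesis using e by (simp add: dist_norm)
    qed
    ultimately show "\<exists>y\<in>V. dist y x < e" by blast
  qed
  then have all: "x \<in> V" for x using \<open>closed V\<close> by (simp add: closure_closed)
  show "C_k_fun \<A> k (\<lambda>g. \<pi> g x)"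
    unfolding C_k_fun_def
  proof safe
    fix W \<psi> assume W: "(W, \<psi>) \<in> \<A>"
    have "C_k_fun \<A> k (\<lambda>g. \<pi> (inv g) x)" using all by (simp add: V_def)
    from C_k_fun_map[OF chart_image_open[OF W] C_k_map_inv[OF chart_image_open[OF W] C_k_map_chart[OF W]] this]
    show "C_k_on k (\<psi> ` W) (\<lambda>z. \<pi> (inv_into W \<psi> z) x)" by simp
  qed
qed

end

section \<open>The spectral theorem\<close>

lemma adj_nth [simp]: "adj A $ i $ j = cnj (A $ j $ i)"
  by (simp add: adj_def)

lemma adj_adj [simp]: "adj (adj A) = A"
  by (simp add: vec_eq_iff)

lemma adj_mult: "adj (A ** B) = adj B ** adj A"
  by (simp add: vec_eq_iff matrix_matrix_mult_def mult.commute)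

lemma adj_mat [simp]: "adj (mat c) = mat (cnj c)"
  by (simp add: vec_eq_iff mat_def)

lemma adj_add: "adj (A + B) = adj A + adj B"
  by (simp add: vec_eq_iff)

lemma adj_scaleR: "adj (r *\<^sub>R A) = r *\<^sub>R adj A"
  by (simp add: vec_eq_iff)

lemma adj_diag_mat [simp]: "adj (diag_mat l) = diag_mat l"
  by (simp add: vec_eq_iff diag_mat_def)

lemma mat_mult_nth [simp]: "(mat c ** A) $ i $ j = c * A $ i $ j"
  by (simp add: matrix_matrix_mult_def mat_def if_distrib[of "\<lambda>x. x * _"] cong: if_cong)

lemma mult_mat_nth [simp]: "(A ** mat c) $ i $ j = A $ i $ j * c"
  by (simp add: matrix_matrix_mult_def mat_def if_distrib[of "\<lambda>x. _ * x"] cong: if_cong)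

lemma mat_mult_commute: "A ** mat c = mat c ** (A :: complex ^ 'n::finite ^ 'n)"
  by (simp add: vec_eq_iff mult.commute)

lemma mat_mult_mat: "mat c ** mat d = (mat (c * d) :: complex ^ 'n::finite ^ 'n)"
  by (simp add: vec_eq_iff) (simp add: mat_def)

lemma diag_mult_nth: "(diag_mat l ** A) $ i $ j = complex_of_real (l i) * A $ i $ j"
  by (simp add: matrix_matrix_mult_def diag_mat_def if_distrib[of "\<lambda>x. x * _"] cong: if_cong)

lemma mult_diag_nth: "(A ** diag_mat l) $ i $ j = A $ i $ j * complex_of_real (l j)"
  by (simp add: matrix_matrix_mult_def diag_mat_def if_distrib[of "\<lambda>x. _ * x"] cong: if_cong)

lemma bounded_bilinear_matrix_mult:
  "bounded_bilinear ((**) :: complex ^ 'n::finite ^ 'n \<Rightarrow> _)"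
  unfolding bilinear_conv_bounded_bilinear[symmetric] bilinear_def
  by (auto intro!: linearI simp: vec_eq_iff matrix_matrix_mult_def sum.distrib algebra_simps scaleR_sum_right)

interpretation matrix_mult: bounded_bilinear "(**) :: complex ^ 'n::finite ^ 'n \<Rightarrow> _"
  by (rule bounded_bilinear_matrix_mult)

lemma bounded_linear_trace: "bounded_linear (trace :: complex ^ 'n::finite ^ 'n \<Rightarrow> complex)"
  unfolding linear_conv_bounded_linear[symmetric]
  by (auto intro!: linearI simp: trace_def sum.distrib scaleR_sum_right)

lemma bounded_linear_adj: "bounded_linear (adj :: complex ^ 'n::finite ^ 'n \<Rightarrow> _)"
  unfolding linear_conv_bounded_linear[symmetric]
  by (auto intro!: linearI simp: adj_add adj_scaleR)

text \<open>The complex inner product, conjugate linear in the first argument;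
  \<open>\<bullet>\<close> on these vectors is only its real part.\<close>

definition cinner :: "complex ^ 'n::finite \<Rightarrow> complex ^ 'n \<Rightarrow> complex" where
  "cinner v w = (\<Sum>i\<in>UNIV. cnj (v $ i) * w $ i)"

lemma Re_cinner: "Re (cinner v w) = v \<bullet> w"
  by (simp add: cinner_def inner_vec_def inner_complex_def Re_sum)

lemma cinner_adj: "cinner v (A *v w) = cinner (adj A *v v) w"
  unfolding cinner_def matrix_vector_mult_def
  by (simp add: sum_distrib_left sum_distrib_right algebra_simps)
     (rule sum.swap)

lemma cinner_add_right: "cinner v (w + w') = cinner v w + cinner v w'"
  by (simp add: cinner_def sum.distrib algebra_simps)

lemma cinner_scaleR_right: "cinner v (r *\<^sub>R w) = r *\<^sub>R cinner v w"
  by (simp add: cinner_def scaleR_sum_right)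

lemma cinner_scaleR_left: "cinner (r *\<^sub>R v) w = r *\<^sub>R cinner v w"
  by (simp add: cinner_def scaleR_sum_right)

lemma cinner_commute: "cinner v w = cnj (cinner w v)"
  by (simp add: cinner_def mult.commute)

lemma cinner_self: "cinner v v = complex_of_real (v \<bullet> v)"
  by (simp add: complex_eq_iff Re_cinner) (simp add: cinner_def mult.commute)

lemma inner_self_adjoint:
  assumes "self_adjoint A"
  shows "v \<bullet> (A *v w) = (A *v v) \<bullet> w"
  using cinner_adj[of v A w] assms by (simp add: Re_cinner[symmetric] self_adjoint_def)

lemma linear_matrix_vector: "linear (\<lambda>v. (A :: complex ^ 'n::finite ^ 'n) *v v)"
  by (auto intro!: linearI simp: vec_eq_iff matrix_vector_mult_def sum.distrib algebra_simps scaleR_sum_right)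

text \<open>Maximise the quadratic form of \<open>A\<close> on the unit sphere of the subspace
  \<open>W\<close> orthogonal to the given eigenvectors. \<open>W\<close> is invariant under
  \<open>A\<close>, so the residual \<open>r\<close> of the maximiser is an admissible perturbation
  and must vanish.\<close>

lemma eigenvector_orthogonal:
  fixes A :: "complex ^ 'n::finite ^ 'n"
  assumes A: "self_adjoint A" and S: "finite S" "card S < CARD('n)"
    and e: "\<And>i. i \<in> S \<Longrightarrow> A *v e i = l i *\<^sub>R e i"
  obtains v c where "norm v = 1" "A *v v = c *\<^sub>R v" "\<And>i. i \<in> S \<Longrightarrow> cinner (e i) v = 0"
proof -
  define W where "W = {v. \<forall>i\<in>S. cinner (e i) v = 0}"
  \<comment> \<open>Complex orthogonality to \<open>e i\<close> is real orthogonality to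
    \<open>e i\<close> and to its multiple by \<i>. These are at most \<open>2 * card S\<close>
    vectors, fewer than the real dimension.\<close>
  let ?i = "\<lambda>v. (mat \<i> :: complex ^ 'n ^ 'n) *v v"
  let ?T = "e ` S \<union> (\<lambda>i. ?i (e i)) ` S"
  have "card ?T \<le> card S + card S"
    by (rule order_trans[OF card_Un_le]) (intro add_mono card_image_le S)
  then have "dim ?T < DIM(complex ^ 'n)"
    using dim_le_card'[of ?T] S by simp
  from orthogonal_to_subspace_exists[OF this] obtain v0 where
    v0: "v0 \<noteq> 0" "\<And>y. y \<in> span ?T \<Longrightarrow> orthogonal v0 y" by blast
  have "v0 \<in> W" unfolding W_def
  proof safe
    fix i assume i: "i \<in> S"
    have "Re (cinner (e i) v0) = 0"
      using v0(2)[of "e i"] i by (auto simp: Re_cinner orthogonal_def inner_commute intro: span_base)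
    moreover have "Re (cinner (?i (e i)) v0) = 0"
      using v0(2)[of "?i (e i)"] i by (auto simp: Re_cinner orthogonal_def inner_commute intro: span_base)
    moreover have "cinner (?i (e i)) v0 = - \<i> * cinner (e i) v0"
      unfolding cinner_def by (simp add: matrix_vector_mult_def mat_def if_distrib[of "\<lambda>x. x * _"] sum_distrib_left mult.assoc cong: if_cong)
    ultimately show "cinner (e i) v0 = 0" by (simp add: complex_eq_iff)
  qed
  have Wsc: "r *\<^sub>R v \<in> W" if "v \<in> W" for r v using that by (simp add: W_def cinner_scaleR_right)
  have Wadd: "v + w \<in> W" if "v \<in> W" "w \<in> W" for v w using that by (simp add: W_def cinner_add_right)
  have WA: "A *v v \<in> W" if "v \<in> W" for v
    unfolding W_def
  proof safe
    fix i assume i: "i \<in> S"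
    have "cinner (e i) (A *v v) = cinner (l i *\<^sub>R e i) v"
      using A e[OF i] by (simp add: cinner_adj self_adjoint_def)
    then show "cinner (e i) (A *v v) = 0" using that i by (simp add: W_def cinner_scaleR_left)
  qed
  have contA: "continuous_on T (\<lambda>v. A *v v)" for T
    by (rule linear_continuous_on) (simp add: linear_conv_bounded_linear[symmetric] linear_matrix_vector)
  have "closed W"
  proof -
    have "W = (\<Inter>i\<in>S. {v. cinner (e i) v = 0})" by (auto simp: W_def)
    moreover have "closed {v. cinner (e i) v = 0}" for i
      unfolding cinner_def by (intro closed_Collect_eq continuous_intros)
    ultimately show ?thesis by auto
  qed
  then have "compact (W \<inter> sphere 0 1)" by (intro closed_Int_compact) auto
  moreover have "(1 / norm v0) *\<^sub>R v0 \<in> W \<inter> sphere 0 1"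
    using Wsc \<open>v0 \<in> W\<close> v0(1) by auto
  ultimately obtain v where v: "v \<in> W" "norm v = 1"
    and vmax: "\<And>w. w \<in> W \<Longrightarrow> norm w = 1 \<Longrightarrow> w \<bullet> (A *v w) \<le> v \<bullet> (A *v v)"
    using continuous_attains_sup[of "W \<inter> sphere 0 1" "\<lambda>v. v \<bullet> (A *v v)"] contA
    by (fastforce intro!: continuous_intros)
  define c where "c = v \<bullet> (A *v v)"
  have le: "w \<bullet> (A *v w) \<le> c * (w \<bullet> w)" if "w \<in> W" for w
  proof (cases "w = 0")
    case False
    then have "((1 / norm w) *\<^sub>R w) \<bullet> (A *v ((1 / norm w) *\<^sub>R w)) \<le> c"
      unfolding c_def using that by (intro vmax Wsc) auto
    then have "(w \<bullet> (A *v w)) / (norm w)^2 \<le> c"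
      by (simp add: linear_scale[OF linear_matrix_vector] power2_eq_square)
    then show ?thesis using False by (simp add: divide_le_eq power2_norm_eq_inner)
  qed (simp add: linear_0[OF linear_matrix_vector])
  define r where "r = A *v v - c *\<^sub>R v"
  have rW: "r \<in> W" unfolding r_def using Wadd[OF WA[OF v(1)] Wsc[OF v(1), of "-c"]] by simp
  \<comment> \<open>Comparison of the maximiser \<open>v\<close> with
    \<open>v + t *\<^sub>R r\<close>. The term linear in \<open>t\<close> is positive for small
    \<open>t > 0\<close> unless \<open>r = 0\<close>.\<close>
  have quad: "2 * t * (norm r)^2 + t^2 * (r \<bullet> (A *v r) - c * (r \<bullet> r)) \<le> 0" for t
  proof -
    have f1: "(v + t *\<^sub>R r) \<bullet> (A *v (v + t *\<^sub>R r)) \<le> c * ((v + t *\<^sub>R r) \<bullet> (v + t *\<^sub>R r))"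
      by (intro le Wadd Wsc v rW)
    have f2: "(v + t *\<^sub>R r) \<bullet> (A *v (v + t *\<^sub>R r))
        = c + 2 * t * (r \<bullet> (A *v v)) + t^2 * (r \<bullet> (A *v r))"
      using inner_self_adjoint[OF A, of v r]
      by (simp add: linear_add[OF linear_matrix_vector] linear_scale[OF linear_matrix_vector]
          inner_add_left inner_add_right c_def power2_eq_square inner_commute algebra_simps)
    have f3: "(v + t *\<^sub>R r) \<bullet> (v + t *\<^sub>R r) = 1 + 2 * t * (r \<bullet> v) + t^2 * (r \<bullet> r)"
      using v(2) by (simp add: inner_add_left inner_add_right power2_eq_square inner_commute
          algebra_simps norm_eq_1)
    have f4: "r \<bullet> (A *v v) = (norm r)^2 + c * (r \<bullet> v)"
      by (simp add: power2_norm_eq_inner) (simp add: r_def inner_diff_right inner_diff_left algebra_simps)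
    from f1 show ?thesis unfolding f2 f3 f4 by (simp add: algebra_simps)
  qed
  have "(norm r)^2 = 0"
  proof (rule ccontr)
    define a where "a = (norm r)^2"
    define b where "b = r \<bullet> (A *v r) - c * (r \<bullet> r)"
    assume "(norm r)^2 \<noteq> 0"
    then have a: "a > 0" by (simp add: a_def)
    \<comment> \<open>Small enough that the quadratic term absorbs at most half of the linear one;
      the added 1 avoids dividing by zero.\<close>
    define t where "t = a / (\<bar>b\<bar> + 1)"
    have t: "t > 0" using a by (simp add: t_def add_nonneg_pos)
    have "t * \<bar>b\<bar> \<le> a" using a by (simp add: t_def field_simps)
    then have "t * (t * \<bar>b\<bar>) \<le> t * a" using t by simp
    moreover have "- (t * (t * \<bar>b\<bar>)) \<le> t^2 * b"
      using t by (simp add: power2_eq_square abs_if mult.assoc)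
    ultimately have "2 * t * a + t^2 * b \<ge> t * a" by (simp add: algebra_simps)
    moreover have "t * a > 0" using a t by simp
    ultimately show False using quad[of t] by (simp add: a_def b_def)
  qed
  then have "A *v v = c *\<^sub>R v" by (simp add: r_def)
  then show thesis using that v by (auto simp: W_def)
qed

text \<open>Induction over subsets of the index type itself, so that for \<open>UNIV\<close> the
  eigenvectors are already indexed as the columns of a square matrix.\<close>

lemma orthonormal_eigenvectors:
  fixes A :: "complex ^ 'n::finite ^ 'n"
  assumes A: "self_adjoint A"
  shows "finite S \<Longrightarrow> \<exists>e l. (\<forall>i\<in>S. A *v e i = l i *\<^sub>R e i) \<and>
    (\<forall>i\<in>S. \<forall>j\<in>(S :: 'n set). cinner (e i) (e j) = (if i = j then 1 else 0))"
proof (induction S rule: finite_induct)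
  case (insert k S)
  then obtain e l where el: "\<And>i. i \<in> S \<Longrightarrow> A *v e i = l i *\<^sub>R e i"
    "\<And>i j. i \<in> S \<Longrightarrow> j \<in> S \<Longrightarrow> cinner (e i) (e j) = (if i = j then 1 else 0)" by blast
  have "card S < CARD('n)" using insert by (intro psubset_card_mono) auto
  then obtain v c where v: "norm v = 1" "A *v v = c *\<^sub>R v" "\<And>i. i \<in> S \<Longrightarrow> cinner (e i) v = 0"
    by (rule eigenvector_orthogonal[OF A insert(1) _ el(1)]) (auto intro: that)
  have "cinner v v = 1" using v(1) by (simp add: cinner_self norm_eq_1)
  moreover have "cinner v (e i) = 0" if "i \<in> S" for i
    using v(3)[OF that] cinner_commute[of v "e i"] by simp
  ultimately show ?case using el v insert(2)
    by (intro exI[of _ "e(k := v)"] exI[of _ "l(k := c)"]) auto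
qed simp

theorem spectral_decomposition:
  fixes A :: "complex ^ 'n::finite ^ 'n"
  assumes A: "self_adjoint A"
  obtains U l where "unitary U" "A = U ** diag_mat l ** adj U"
proof -
  obtain e l where e: "\<And>i. A *v e i = l i *\<^sub>R e i"
    "\<And>i j::'n. cinner (e i) (e j) = (if i = j then 1 else 0)"
    using orthonormal_eigenvectors[OF A, of UNIV] by auto
  define U where "U = (\<chi> i j. e j $ i)"
  have 1: "adj U ** U = mat 1"
    using e(2) by (simp add: vec_eq_iff matrix_matrix_mult_def U_def mat_def cinner_def)
  then have U: "unitary U" by (simp add: unitary_def matrix_left_right_inverse)
  have "A ** U = U ** diag_mat l"
  proof -
    have "(A ** U) $ i $ j = (A *v e j) $ i" for i j
      by (simp add: matrix_matrix_mult_def matrix_vector_mult_def U_def)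
    then show ?thesis
      by (simp add: vec_eq_iff mult_diag_nth e(1)) (simp add: U_def scaleR_conv_of_real mult.commute)
  qed
  then have "A ** U ** adj U = U ** diag_mat l ** adj U" by simp
  then have "A = U ** diag_mat l ** adj U"
    using U by (simp add: matrix_mul_assoc[symmetric] unitary_def)
  with U that show thesis by blast
qed

section \<open>Functional calculus and Schatten norms\<close>

lemma unitary_simps:
  assumes "unitary U"
  shows "adj U ** U = mat 1" "U ** adj U = mat 1" "adj U ** (U ** M) = M" "U ** (adj U ** M) = M"
  using assms by (auto simp: unitary_def matrix_mul_assoc)

lemma unitary_adj: "unitary U \<Longrightarrow> unitary (adj U)"
  by (simp add: unitary_def)

lemma unitary_mult:
  assumes "unitary U" "unitary V"
  shows "unitary (U ** V)"
  unfolding unitary_def adj_mult matrix_mul_assoc[symmetric]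
  by (simp add: unitary_simps[OF assms(1)] unitary_simps[OF assms(2)])

text \<open>The unitary \<open>W = adj V ** U\<close> intertwines the two diagonal matrices, so an
  entry of \<open>W\<close> can be nonzero only where the eigenvalues agree. It then intertwines
  their images under \<phi> too. This justifies the choice in \<open>fun_calc\<close>.\<close>

lemma fun_calc_unique:
  assumes U: "unitary U" and V: "unitary V"
    and eq: "U ** diag_mat l ** adj U = V ** diag_mat r ** adj V"
  shows "U ** diag_mat (\<lambda>i. \<phi> (l i)) ** adj U = V ** diag_mat (\<lambda>i. \<phi> (r i)) ** adj V"
proof -
  define W where "W = adj V ** U"
  have "W ** diag_mat l = adj V ** (U ** diag_mat l ** adj U) ** U"
    by (simp add: W_def matrix_mul_assoc[symmetric] unitary_simps[OF U])
  also have "\<dots> = adj V ** (V ** diag_mat r ** adj V) ** U" by (simp only: eq)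
  also have "\<dots> = diag_mat r ** W"
    by (simp add: W_def matrix_mul_assoc[symmetric] unitary_simps[OF V])
  finally have "W $ i $ j * complex_of_real (l j) = complex_of_real (r i) * W $ i $ j" for i j
    by (metis diag_mult_nth mult_diag_nth)
  then have "W $ i $ j = 0 \<or> l j = r i" for i j
    by (metis mult.commute mult_cancel_left of_real_eq_iff)
  then have "W $ i $ j * complex_of_real (\<phi> (l j)) = complex_of_real (\<phi> (r i)) * W $ i $ j" for i j
    by (metis mult.commute mult_zero_left)
  then have "W ** diag_mat (\<lambda>i. \<phi> (l i)) = diag_mat (\<lambda>i. \<phi> (r i)) ** W"
    by (simp add: vec_eq_iff diag_mult_nth mult_diag_nth)
  then have "V ** (W ** diag_mat (\<lambda>i. \<phi> (l i))) ** adj U = V ** (diag_mat (\<lambda>i. \<phi> (r i)) ** W) ** adj U"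
    by simp
  then show ?thesis
    by (simp add: W_def matrix_mul_assoc[symmetric] unitary_simps[OF U] unitary_simps[OF V])
qed

lemma fun_calc_diag:
  assumes "unitary U"
  shows "fun_calc \<phi> (U ** diag_mat l ** adj U) = U ** diag_mat (\<lambda>i. \<phi> (l i)) ** adj U"
  unfolding fun_calc_def
  by (rule some_equality) (use assms in \<open>auto intro: fun_calc_unique\<close>)

lemma fun_calc_conj:
  assumes "self_adjoint A" "unitary W"
  shows "fun_calc \<phi> (adj W ** A ** W) = adj W ** fun_calc \<phi> A ** W"
proof -
  obtain U l where U: "unitary U" "A = U ** diag_mat l ** adj U"
    using spectral_decomposition[OF assms(1)] .
  have "adj W ** A ** W = (adj W ** U) ** diag_mat l ** adj (adj W ** U)"
    by (simp add: U(2) adj_mult matrix_mul_assoc)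
  moreover have "unitary (adj W ** U)" using U(1) assms(2) by (intro unitary_mult unitary_adj)
  ultimately have "fun_calc \<phi> (adj W ** A ** W) = (adj W ** U) ** diag_mat (\<lambda>i. \<phi> (l i)) ** adj (adj W ** U)"
    by (simp add: fun_calc_diag)
  then show ?thesis by (simp add: U(2) fun_calc_diag[OF U(1)] adj_mult matrix_mul_assoc)
qed

lemma self_adjoint_fun_calc:
  assumes "self_adjoint A"
  shows "self_adjoint (fun_calc \<phi> A)"
proof -
  obtain U l where U: "unitary U" "A = U ** diag_mat l ** adj U"
    using spectral_decomposition[OF assms] .
  then show ?thesis by (simp add: fun_calc_diag self_adjoint_def adj_mult matrix_mul_assoc)
qed

lemma self_adjoint_conj: "self_adjoint A \<Longrightarrow> self_adjoint (adj W ** A ** W)"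
  by (simp add: self_adjoint_def adj_mult matrix_mul_assoc)

lemma positive_op_iff: "positive_op A \<longleftrightarrow> self_adjoint A \<and> (\<forall>v. 0 \<le> Re (cinner v (A *v v)))"
  by (simp add: positive_op_def cinner_def)

lemma positive_op_gram: "positive_op (adj A ** A)"
  by (simp add: positive_op_iff self_adjoint_def adj_mult matrix_vector_mul_assoc[symmetric]
      cinner_adj[where A = "adj A"] Re_cinner)

lemma positive_op_conj: "positive_op A \<Longrightarrow> positive_op (adj W ** A ** W)"
  by (auto simp: positive_op_iff self_adjoint_conj matrix_vector_mul_assoc[symmetric]
      cinner_adj[where A = "adj W"])

lemma matrix_vector_mult_axis_nth: "((A :: complex ^ 'n::finite ^ 'n) *v axis j 1) $ i = A $ i $ j"
  by (simp add: matrix_vector_mult_def axis_def if_distrib[of "\<lambda>x. _ * x"] cong: if_cong)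

lemma positive_op_eigenvalue:
  assumes "unitary U" "positive_op (U ** diag_mat l ** adj U)"
  shows "0 \<le> l i"
proof -
  define v where "v = U *v axis i 1"
  have D: "diag_mat l *v axis i 1 = l i *\<^sub>R axis i 1"
    by (simp add: vec_eq_iff matrix_vector_mult_axis_nth) (auto simp: diag_mat_def axis_def complex_eq_iff)
  have "(U ** diag_mat l ** adj U) *v v = U *v (diag_mat l *v axis i 1)"
    by (simp add: v_def matrix_vector_mul_assoc matrix_mul_assoc[symmetric] unitary_simps[OF assms(1)])
  also have "\<dots> = l i *\<^sub>R v"
    by (simp add: D v_def linear_scale[OF linear_matrix_vector])
  finally have "cinner v ((U ** diag_mat l ** adj U) *v v) = l i *\<^sub>R cinner v v"
    by (simp add: cinner_scaleR_right)
  moreover have "cinner v v = 1"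
  proof -
    have "cinner v v = cinner (adj U *v v) (axis i 1)"
      using cinner_adj[of v U "axis i 1"] by (simp add: v_def)
    also have "adj U *v v = axis i 1"
      by (simp add: v_def matrix_vector_mul_assoc unitary_simps[OF assms(1)])
    finally show ?thesis by (simp add: cinner_self inner_axis_axis)
  qed
  ultimately show ?thesis using assms(2) unfolding positive_op_iff by (metis Re_complex_of_real scaleR_conv_of_real mult.right_neutral)
qed

lemma positive_decomposition:
  assumes "positive_op A"
  obtains U l where "unitary U" "A = U ** diag_mat l ** adj U" "\<And>i. 0 \<le> l i"
proof -
  obtain U l where U: "unitary U" "A = U ** diag_mat l ** adj U"
    using spectral_decomposition assms positive_op_def by metis
  then show thesis using that positive_op_eigenvalue assms by blast
qed

lemma trace_diag_conj:
  assumes "unitary U"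
  shows "trace (U ** diag_mat l ** adj U) = complex_of_real (\<Sum>i\<in>UNIV. l i)"
proof -
  have "trace (U ** diag_mat l ** adj U) = trace (adj U ** (U ** diag_mat l))"
    by (rule trace_mul_sym)
  also have "\<dots> = trace (diag_mat l :: complex ^ 'a ^ 'a)"
    by (simp add: unitary_simps[OF assms])
  finally show ?thesis by (simp add: trace_def diag_mat_def)
qed

text \<open>In eigenbases the weighted form is a sum of squared entries with scalar weights. All
  operator inequalities below are reduced to scalar ones through this formula, which also shows that
  the form is real.\<close>

lemma trace_weighted:
  "trace (adj y ** (U ** diag_mat a ** adj U) ** y ** (V ** diag_mat b ** adj V))
    = complex_of_real (\<Sum>i\<in>UNIV. \<Sum>j\<in>UNIV. a i * b j * (cmod ((adj U ** y ** V) $ i $ j))^2)"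
proof -
  define z where "z = adj U ** y ** V"
  have "trace (adj y ** (U ** diag_mat a ** adj U) ** y ** (V ** diag_mat b ** adj V))
      = trace ((adj y ** (U ** diag_mat a ** adj U) ** y ** (V ** diag_mat b)) ** adj V)"
    by (simp add: matrix_mul_assoc)
  also have "\<dots> = trace (adj V ** (adj y ** (U ** diag_mat a ** adj U) ** y ** (V ** diag_mat b)))"
    by (rule trace_mul_sym)
  also have "\<dots> = trace (adj z ** ((diag_mat a ** z) ** diag_mat b))"
    by (simp add: z_def adj_mult matrix_mul_assoc)
  also have "\<dots> = (\<Sum>j\<in>UNIV. \<Sum>i\<in>UNIV. cnj (z $ i $ j) * (a i * z $ i $ j * b j))"
    unfolding trace_def matrix_matrix_mult_def[of "adj z"] by (simp add: mult_diag_nth diag_mult_nth)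
  also have "\<dots> = (\<Sum>i\<in>UNIV. \<Sum>j\<in>UNIV. cnj (z $ i $ j) * (a i * z $ i $ j * b j))"
    by (rule sum.swap)
  also have "\<dots> = (\<Sum>i\<in>UNIV. \<Sum>j\<in>UNIV. complex_of_real (a i * b j * (cmod (z $ i $ j))^2))"
  proof (intro sum.cong refl)
    fix i j
    have "complex_of_real ((cmod (z $ i $ j))^2) = z $ i $ j * cnj (z $ i $ j)"
      by (rule complex_norm_square)
    then show "cnj (z $ i $ j) * (a i * z $ i $ j * b j) = complex_of_real (a i * b j * (cmod (z $ i $ j))^2)"
      by (simp only: of_real_mult) (simp add: algebra_simps)
  qed
  finally show ?thesis by (simp add: z_def)
qed

lemma diag_mat_one: "diag_mat (\<lambda>_. 1) = mat 1"
  by (simp add: vec_eq_iff diag_mat_def mat_def)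

section \<open>Schatten norms: unitary invariance and boundedness of the unit ball\<close>

lemma onorm_unitary_conj_le:
  fixes A :: "complex ^ 'n::finite ^ 'n"
  assumes "unitary W"
  shows "onorm (\<lambda>v. (adj W ** A ** W) *v v) \<le> onorm (\<lambda>v. A *v v)"
proof (rule onorm_bound)
  have iso: "norm (V *v v) = norm v" if "unitary V" for V :: "complex ^ 'n ^ 'n" and v
  proof -
    have "cinner (V *v v) (V *v v) = cinner v v"
      using cinner_adj[of "V *v v" V v] by (simp add: matrix_vector_mul_assoc unitary_simps[OF that])
    then show ?thesis by (simp add: cinner_self norm_eq_sqrt_inner)
  qed
  have bl: "bounded_linear (\<lambda>v. A *v v)"
    by (simp add: linear_conv_bounded_linear[symmetric] linear_matrix_vector)
  show "0 \<le> onorm (\<lambda>v. A *v v)" by (rule onorm_pos_le[OF bl])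
  fix v
  have "norm ((adj W ** A ** W) *v v) = norm (A *v (W *v v))"
    using iso[OF unitary_adj[OF assms]] by (simp add: matrix_vector_mul_assoc[symmetric])
  also have "\<dots> \<le> onorm (\<lambda>v. A *v v) * norm (W *v v)" by (rule onorm[OF bl])
  finally show "norm ((adj W ** A ** W) *v v) \<le> onorm (\<lambda>v. A *v v) * norm v" by (simp add: iso[OF assms])
qed

text \<open>For the operator norm the one-sided bound is applied to \<open>W\<close> and to
  \<open>adj W\<close>; for finite exponents unitary conjugation commutes with the functional
  calculus and preserves the trace.\<close>

lemma schatten_norm_conj:
  assumes "unitary W"
  shows "schatten_norm p (adj W ** A ** W) = schatten_norm p A"
proof (cases "p = \<infinity>")
  case True
  have "onorm (\<lambda>v. A *v v) \<le> onorm (\<lambda>v. (adj W ** A ** W) *v v)"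
    using onorm_unitary_conj_le[OF unitary_adj[OF assms], of "adj W ** A ** W"]
    by (simp add: matrix_mul_assoc[symmetric] unitary_simps[OF assms])
  with onorm_unitary_conj_le[OF assms, of A] True show ?thesis by (simp add: schatten_norm_def)
next
  case False
  have "adj (adj W ** A ** W) ** (adj W ** A ** W) = adj W ** (adj A ** A) ** W"
    by (simp add: adj_mult matrix_mul_assoc[symmetric] unitary_simps[OF assms])
  moreover have sa: "self_adjoint (adj A ** A)" by (simp add: self_adjoint_def adj_mult)
  ultimately have "op_abs (adj W ** A ** W) = adj W ** op_abs A ** W"
    by (simp add: op_abs_def fun_calc_conj assms)
  moreover have "self_adjoint (op_abs A)" unfolding op_abs_def by (rule self_adjoint_fun_calc[OF sa])
  ultimately have "op_powr (op_abs (adj W ** A ** W)) q = adj W ** op_powr (op_abs A) q ** W" for q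
    by (simp add: op_powr_def fun_calc_conj assms)
  moreover have "trace (adj W ** M ** W) = trace M" for M
    using trace_mul_sym[of "adj W ** M" W] by (simp add: matrix_mul_assoc unitary_simps[OF assms])
  ultimately show ?thesis using False by (simp add: schatten_norm_def)
qed

text \<open>A crude bound whose purpose is that the suprema in \<open>norm_2p\<close> are taken over
  bounded sets. For finite exponents all singular values are at most 1, so the sum of all squared
  entries is at most the dimension.\<close>

lemma schatten_norm_le_one_bound:
  fixes A :: "complex ^ 'n::finite ^ 'n"
  assumes "0 < p" "schatten_norm p A \<le> 1"
  shows "cmod (A $ i $ j) \<le> sqrt CARD('n)"
proof (cases "p = \<infinity>")
  case True
  have bl: "bounded_linear (\<lambda>v. A *v v)"
    by (simp add: linear_conv_bounded_linear[symmetric] linear_matrix_vector)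
  have "A $ i $ j = (A *v axis j 1) $ i"
    by (simp add: matrix_vector_mult_axis_nth)
  then have "cmod (A $ i $ j) \<le> norm (A *v axis j 1)" by (simp only: Finite_Cartesian_Product.norm_nth_le)
  also have "\<dots> \<le> onorm (\<lambda>v. A *v v) * norm (axis j 1 :: complex ^ 'n)" by (rule onorm[OF bl])
  also have "\<dots> \<le> 1" using assms True by (simp add: schatten_norm_def norm_axis_1)
  also have "1 \<le> sqrt (real CARD('n))" by (simp add: Suc_leI)
  finally show ?thesis .
next
  case False
  define q where "q = enn2real p"
  have q: "q > 0" using assms(1) False by (simp add: q_def enn2real_positive_iff less_top)
  obtain U l where U: "unitary U" "adj A ** A = U ** diag_mat l ** adj U" "\<And>i. 0 \<le> l i"
    by (rule positive_decomposition[OF positive_op_gram[of A]]) (rule that)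
  have "op_powr (op_abs A) q = U ** diag_mat (\<lambda>i. sqrt (l i) powr q) ** adj U"
    using q by (simp add: op_powr_def op_abs_def U(2) fun_calc_diag[OF U(1)])
  then have "Re (trace (op_powr (op_abs A) q)) = (\<Sum>i\<in>UNIV. sqrt (l i) powr q)"
    by (simp add: trace_diag_conj[OF U(1)] del: of_real_sum)
  then have "(\<Sum>i\<in>UNIV. sqrt (l i) powr q) powr (1 / q) \<le> 1"
    using assms(2) False by (simp add: schatten_norm_def q_def)
  then have "(\<Sum>i\<in>UNIV. sqrt (l i) powr q) \<le> 1"
    using q by (smt (verit) gr_one_powr zero_less_divide_1_iff)
  moreover have "sqrt (l i) powr q \<le> (\<Sum>i\<in>UNIV. sqrt (l i) powr q)" for i
    by (intro member_le_sum) auto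
  ultimately have "sqrt (l i) powr q \<le> 1" for i using order_trans by blast
  then have "sqrt (l i) \<le> 1" for i using q by (smt (verit) gr_one_powr)
  then have l1: "l i \<le> 1" for i by simp
  have "complex_of_real (\<Sum>j\<in>UNIV. \<Sum>i\<in>UNIV. (cmod (A $ i $ j))^2) = trace (adj A ** A)"
    by (simp add: trace_def matrix_matrix_mult_def complex_norm_square mult.commute del: of_real_power)
  also have "\<dots> = complex_of_real (\<Sum>i\<in>UNIV. l i)" by (simp only: U(2) trace_diag_conj[OF U(1)])
  finally have "(\<Sum>j\<in>UNIV. \<Sum>i\<in>UNIV. (cmod (A $ i $ j))^2) = (\<Sum>i\<in>UNIV. l i)" by (simp only: of_real_eq_iff)
  also have "\<dots> \<le> (\<Sum>i\<in>(UNIV::'n set). 1)" by (intro sum_mono l1)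
  finally have "(\<Sum>j\<in>UNIV. \<Sum>i\<in>UNIV. (cmod (A $ i $ j))^2) \<le> CARD('n)" by simp
  moreover have "(cmod (A $ i $ j))^2 \<le> (\<Sum>i\<in>UNIV. (cmod (A $ i $ j))^2)"
    by (intro member_le_sum) auto
  moreover have "(\<Sum>i\<in>UNIV. (cmod (A $ i $ j))^2) \<le> (\<Sum>j\<in>UNIV. \<Sum>i\<in>UNIV. (cmod (A $ i $ j))^2)"
    by (rule member_le_sum[where f = "\<lambda>j. \<Sum>i\<in>UNIV. (cmod (A $ i $ j))^2"]) (auto intro: sum_nonneg)
  ultimately show ?thesis by (intro real_le_rsqrt) linarith
qed

lemma schatten_norm_zero:
  assumes "0 < p"
  shows "schatten_norm p (0 :: complex ^ 'n::finite ^ 'n) = 0"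
proof (cases "p = \<infinity>")
  case True
  have "(\<lambda>v. (0 :: complex ^ 'n ^ 'n) *v v) = (\<lambda>_. 0)"
    by (simp add: vec_eq_iff matrix_vector_mult_def fun_eq_iff)
  with True show ?thesis by (simp only: schatten_norm_def onorm_zero simp_thms if_True)
next
  case False
  define q where "q = enn2real p"
  have q: "q > 0" using assms(1) False by (simp add: q_def enn2real_positive_iff less_top)
  have u: "unitary (mat 1 :: complex ^ 'n ^ 'n)" by (simp add: unitary_def)
  have d: "diag_mat (\<lambda>_. 0) = (0 :: complex ^ 'n ^ 'n)" by (simp add: vec_eq_iff diag_mat_def)
  have f: "fun_calc \<phi> (0 :: complex ^ 'n ^ 'n) = 0" if "\<phi> 0 = 0" for \<phi>
    using fun_calc_diag[OF u, of \<phi> "\<lambda>_. 0"] that by (simp add: d)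
  have "adj 0 ** 0 = (0 :: complex ^ 'n ^ 'n)" by simp
  then show ?thesis
    using False q by (simp add: schatten_norm_def q_def[symmetric] op_abs_def op_powr_def f
        linear_0[OF bounded_linear.linear[OF bounded_linear_trace]])
qed

text \<open>Truncated subtraction from 1 stays finite, and only an infinite element has inverse
  0.\<close>

lemma conj_exponent_pos: "0 < conj_exponent p"
  unfolding conj_exponent_def by (simp add: zero_less_iff_neq_zero ennreal_minus_eq_top)

section \<open>Weighted geometric means as integrals of parallel sums\<close>

text \<open>The parallel sum of \<open>a\<close> and \<open>t * b\<close>, divided by
  \<open>t\<close>. Division by zero gives the right value 0 at \<open>a = b = 0\<close>.\<close>

definition parallel :: "real \<Rightarrow> real \<Rightarrow> real \<Rightarrow> real" where
  "parallel t a b = a * b / (a + t * b)"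

text \<open>The integral of the overview without its constant. Values in \<open>ennreal\<close> give
  monotonicity and additivity without integrability conditions.\<close>

definition parallel_integral :: "real \<Rightarrow> real \<Rightarrow> real \<Rightarrow> ennreal" where
  "parallel_integral s a b = (\<integral>\<^sup>+t. ennreal (t powr (s - 1) * parallel t a b) * indicator {0<..} t \<partial>lborel)"

lemma parallel_nonneg: "0 \<le> a \<Longrightarrow> 0 \<le> b \<Longrightarrow> 0 < t \<Longrightarrow> 0 \<le> parallel t a b"
  by (simp add: parallel_def)

lemma parallel_measurable [measurable]: "(\<lambda>t. parallel t a b) \<in> borel_measurable borel"
  unfolding parallel_def by measurable

text \<open>For positive \<open>a\<close> and \<open>b\<close> the substitution
  \<open>t = (a / b) * x\<close> pulls out all dependence on them. If one of them is 0, both sides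
  vanish because \<open>s\<close> and \<open>1 - s\<close> are positive.\<close>

lemma parallel_integral_scale:
  assumes "0 \<le> a" "0 \<le> b" "0 < s" "s < 1"
  shows "parallel_integral s a b = ennreal (a powr s * b powr (1 - s)) * parallel_integral s 1 1"
proof (cases "a = 0 \<or> b = 0")
  case True
  then have "parallel t a b = 0" for t by (auto simp: parallel_def)
  with True show ?thesis by (auto simp: parallel_integral_def)
next
  case False
  then have ab: "a > 0" "b > 0" using assms by auto
  define f where "f = (\<lambda>t. ennreal (t powr (s - 1) * parallel t a b) * indicator {0<..} t)"
  have "f \<in> borel_measurable borel" unfolding f_def by measurable
  from nn_integral_real_affine[OF this, of "a / b" 0] ab
  have "parallel_integral s a b = ennreal (a / b) * (\<integral>\<^sup>+x. f (a / b * x) \<partial>lborel)"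
    by (simp add: parallel_integral_def f_def[symmetric])
  also have "\<dots> = (\<integral>\<^sup>+x. ennreal (a / b) * f (a / b * x) \<partial>lborel)"
    by (rule nn_integral_cmult[symmetric]) (simp add: f_def)
  also have "\<dots> = (\<integral>\<^sup>+x. ennreal (a powr s * b powr (1 - s)) *
      (ennreal (x powr (s - 1) * parallel x 1 1) * indicator {0<..} x) \<partial>lborel)"
  proof (rule nn_integral_cong)
    fix x :: real
    show "ennreal (a / b) * f (a / b * x) = ennreal (a powr s * b powr (1 - s)) *
      (ennreal (x powr (s - 1) * parallel x 1 1) * indicator {0<..} x)"
    proof (cases "x > 0")
      case True
      have 1: "(a / b * x) powr (s - 1) = a powr s / a * (b / b powr s) * x powr (s - 1)"
        using ab True by (simp add: powr_mult powr_divide powr_diff) (simp add: field_simps)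
      have 2: "parallel (a / b * x) a b = b * parallel x 1 1"
      proof -
        have "a + a / b * x * b = a * (1 + x)" using ab by (simp add: field_simps)
        then show ?thesis using ab by (simp add: parallel_def)
      qed
      have 3: "b powr (1 - s) = b / b powr s" using ab by (simp add: powr_diff)
      have "a / b * ((a / b * x) powr (s - 1) * parallel (a / b * x) a b)
          = a powr s * b powr (1 - s) * (x powr (s - 1) * parallel x 1 1)"
        unfolding 1 2 3 using ab by (simp add: field_simps)
      moreover have "0 < a / b * x" using ab True by simp
      ultimately show ?thesis
        using ab True by (simp add: f_def ennreal_mult'[symmetric] parallel_nonneg)
    next
      case False
      then have "\<not> 0 < a / b * x" using ab by (simp add: zero_less_mult_iff divide_simps)
      with False show ?thesis by (simp add: f_def)
    qed
  qed
  also have "\<dots> = ennreal (a powr s * b powr (1 - s)) * parallel_integral s 1 1"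
    unfolding parallel_integral_def by (rule nn_integral_cmult) measurable
  finally show ?thesis .
qed

text \<open>The constant is pi / sin(pi s), but all that is used later is that it can be cancelled
  in \<open>ennreal\<close>. The integrand is dominated by \<open>t powr (s - 1)\<close> near 0 and
  by \<open>t powr (s - 2)\<close> near infinity.\<close>

lemma parallel_integral_one:
  assumes s: "0 < s" "s < 1"
  shows "parallel_integral s 1 1 \<noteq> \<infinity>" "parallel_integral s 1 1 \<noteq> 0"
proof -
  have le: "t powr (s - 1) * parallel t 1 1 \<le> t powr (s - 1)"
    "t powr (s - 1) * parallel t 1 1 \<le> t powr (s - 2)" if "t > 0" for t
  proof -
    show "t powr (s - 1) * parallel t 1 1 \<le> t powr (s - 1)"
      using that by (intro mult_left_le) (auto simp: parallel_def)
    have "t powr (s - 2) = t powr (s - 1) * (1 / t)"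
      using that powr_diff[of t "s - 1" 1] by simp
    moreover have "parallel t 1 1 \<le> 1 / t" using that by (simp add: parallel_def frac_le)
    ultimately show "t powr (s - 1) * parallel t 1 1 \<le> t powr (s - 2)"
      by (metis mult_left_mono powr_ge_zero)
  qed
  have "(\<lambda>t. t powr (s - 1)) integrable_on {0..1}"
    using s by (intro integrable_on_powr_from_0) auto
  then obtain J where J: "((\<lambda>t. t powr (s - 1)) has_integral J) {0..1}" by blast
  have 1: "(\<integral>\<^sup>+t. ennreal (t powr (s - 1)) * indicator {0..1} t \<partial>lborel) = ennreal J"
    using nn_integral_has_integral_lebesgue'[OF _ J] by simp
  have 2: "(\<integral>\<^sup>+t. ennreal (t powr (s - 2)) * indicator {1..} t \<partial>lborel)
      = ennreal (0 - 1 powr (s - 1) / (s - 1))"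
  proof (rule nn_integral_FTC_atLeast[where F = "\<lambda>t. t powr (s - 1) / (s - 1)"])
    fix x :: real assume "1 \<le> x"
    then show "((\<lambda>t. t powr (s - 1) / (s - 1)) has_real_derivative x powr (s - 2)) (at x)"
      using s has_real_derivative_powr[of x "s - 1", THEN DERIV_cdivide, of "s - 1"] by simp
  next
    have "((\<lambda>t. t powr (s - 1) / (s - 1)) \<longlongrightarrow> 0 / (s - 1)) at_top"
      using s by (intro tendsto_divide tendsto_neg_powr filterlim_ident tendsto_const) auto
    then show "((\<lambda>t. t powr (s - 1) / (s - 1)) \<longlongrightarrow> 0) at_top" by simp
  qed auto
  have "parallel_integral s 1 1 \<le> (\<integral>\<^sup>+t. ennreal (t powr (s - 1)) * indicator {0..1} t
      + ennreal (t powr (s - 2)) * indicator {1..} t \<partial>lborel)"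
    unfolding parallel_integral_def
  proof (rule nn_integral_mono)
    fix t :: real
    show "ennreal (t powr (s - 1) * parallel t 1 1) * indicator {0<..} t
      \<le> ennreal (t powr (s - 1)) * indicator {0..1} t + ennreal (t powr (s - 2)) * indicator {1..} t"
    proof (cases "0 < t")
      case True
      then have "ennreal (t powr (s - 1) * parallel t 1 1) * indicator {0<..} t
            \<le> ennreal (t powr (s - 1)) * indicator {0..1} t \<or>
          ennreal (t powr (s - 1) * parallel t 1 1) * indicator {0<..} t
            \<le> ennreal (t powr (s - 2)) * indicator {1..} t"
        using ennreal_leI[OF le(1)[of t]] ennreal_leI[OF le(2)[of t]] by (simp add: indicator_def)
      then show ?thesis by (metis add_increasing add_increasing2 zero_le)
    qed simp
  qed
  also have "\<dots> = ennreal J + ennreal (0 - 1 powr (s - 1) / (s - 1))"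
    by (subst nn_integral_add) (simp_all only: 1 2, measurable)
  also have "\<dots> < \<infinity>" by (simp add: less_top)
  finally show "parallel_integral s 1 1 \<noteq> \<infinity>" by simp
  \<comment> \<open>On the interval from 1 to 2 the power is at least \<open>2 powr (s - 1)\<close>,
    as \<open>s < 1\<close>, and \<open>1 / (1 + t)\<close> is at least 1/3.\<close>
  have "parallel_integral s 1 1 \<ge> (\<integral>\<^sup>+t. ennreal (2 powr (s - 1) / 3) * indicator {1..2::real} t \<partial>lborel)"
    unfolding parallel_integral_def
  proof (rule nn_integral_mono)
    fix t :: real
    have "2 powr (s - 1) / 3 \<le> t powr (s - 1) * parallel t 1 1" if "1 \<le> t" "t \<le> 2"
    proof -
      have "2 powr (s - 1) * (1 / 3) \<le> t powr (s - 1) * parallel t 1 1"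
        using that s by (intro mult_mono powr_mono2') (auto simp: parallel_def frac_le)
      then show ?thesis by simp
    qed
    then show "ennreal (2 powr (s - 1) / 3) * indicator {1..2} t
        \<le> ennreal (t powr (s - 1) * parallel t 1 1) * indicator {0<..} t"
      by (auto simp: indicator_def intro!: ennreal_leI)
  qed
  then have "ennreal (2 powr (s - 1) / 3) \<le> parallel_integral s 1 1"
    by (simp add: nn_integral_cmult_indicator)
  moreover have "0 < ennreal (2 powr (s - 1) / 3)" by simp
  ultimately show "parallel_integral s 1 1 \<noteq> 0" by auto
qed

lemma parallel_integral_sum:
  assumes fin: "finite I" and s: "0 < s" "s < 1"
    and I: "\<And>i. i \<in> I \<Longrightarrow> 0 \<le> M i \<and> 0 \<le> a i \<and> 0 \<le> b i"
  shows "ennreal (\<Sum>i\<in>I. M i * (a i powr s * b i powr (1 - s))) * parallel_integral s 1 1 =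
      (\<integral>\<^sup>+t. ennreal (t powr (s - 1) * (\<Sum>i\<in>I. M i * parallel t (a i) (b i))) * indicator {0<..} t \<partial>lborel)"
proof -
  let ?C = "parallel_integral s 1 1"
  have "ennreal (\<Sum>i\<in>I. M i * (a i powr s * b i powr (1 - s))) * ?C
      = (\<Sum>i\<in>I. ennreal (M i) * (ennreal (a i powr s * b i powr (1 - s)) * ?C))"
  proof -
    have "ennreal (\<Sum>i\<in>I. M i * (a i powr s * b i powr (1 - s)))
        = (\<Sum>i\<in>I. ennreal (M i * (a i powr s * b i powr (1 - s))))"
      using I by (intro sum_ennreal[symmetric]) simp
    also have "\<dots> = (\<Sum>i\<in>I. ennreal (M i) * ennreal (a i powr s * b i powr (1 - s)))"
      using I by (intro sum.cong refl ennreal_mult) auto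
    finally show ?thesis by (simp only: sum_distrib_right mult.assoc)
  qed
  also have "\<dots> = (\<Sum>i\<in>I. ennreal (M i) * parallel_integral s (a i) (b i))"
    using I s by (intro sum.cong refl arg_cong2[of _ _ _ _ "(*)"] parallel_integral_scale[symmetric]) auto
  also have "\<dots> = (\<Sum>i\<in>I. \<integral>\<^sup>+t. ennreal (M i) * (ennreal (t powr (s - 1) * parallel t (a i) (b i)) * indicator {0<..} t) \<partial>lborel)"
    unfolding parallel_integral_def by (intro sum.cong refl nn_integral_cmult[symmetric]) measurable
  also have "\<dots> = (\<integral>\<^sup>+t. (\<Sum>i\<in>I. ennreal (M i) * (ennreal (t powr (s - 1) * parallel t (a i) (b i)) * indicator {0<..} t)) \<partial>lborel)"
    by (rule nn_integral_sum[symmetric]) measurable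
  also have "\<dots> = (\<integral>\<^sup>+t. ennreal (t powr (s - 1) * (\<Sum>i\<in>I. M i * parallel t (a i) (b i))) * indicator {0<..} t \<partial>lborel)"
  proof (rule nn_integral_cong)
    fix t :: real
    show "(\<Sum>i\<in>I. ennreal (M i) * (ennreal (t powr (s - 1) * parallel t (a i) (b i)) * indicator {0<..} t))
      = ennreal (t powr (s - 1) * (\<Sum>i\<in>I. M i * parallel t (a i) (b i))) * indicator {0<..} t"
    proof (cases "t > 0")
      case True
      have "(\<Sum>i\<in>I. ennreal (M i) * (ennreal (t powr (s - 1) * parallel t (a i) (b i))))
          = (\<Sum>i\<in>I. ennreal (M i * (t powr (s - 1) * parallel t (a i) (b i))))"
        using I True by (intro sum.cong refl ennreal_mult[symmetric]) (auto simp: parallel_nonneg)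
      also have "\<dots> = ennreal (\<Sum>i\<in>I. M i * (t powr (s - 1) * parallel t (a i) (b i)))"
        using I True by (intro sum_ennreal) (simp add: parallel_nonneg)
      finally show ?thesis using True by (simp add: sum_distrib_left mult.left_commute)
    qed simp
  qed
  finally show ?thesis .
qed

text \<open>Integrate the hypothesis against \<open>t powr (s - 1)\<close> and cancel the common
  constant. This carries an inequality for parallel sums over to geometric means.\<close>

lemma sum_powr_le_of_parallel:
  assumes fin: "finite I" "finite J" and s: "0 < s" "s < 1"
    and I: "\<And>i. i \<in> I \<Longrightarrow> 0 \<le> M i \<and> 0 \<le> a i \<and> 0 \<le> b i"
    and J: "\<And>i. i \<in> J \<Longrightarrow> 0 \<le> M' i \<and> 0 \<le> a' i \<and> 0 \<le> b' i"
    and le: "\<And>t. 0 < t \<Longrightarrow> (\<Sum>i\<in>I. M i * parallel t (a i) (b i)) \<le> (\<Sum>i\<in>J. M' i * parallel t (a' i) (b' i))"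
  shows "(\<Sum>i\<in>I. M i * (a i powr s * b i powr (1 - s))) \<le> (\<Sum>i\<in>J. M' i * (a' i powr s * b' i powr (1 - s)))"
proof -
  let ?C = "parallel_integral s 1 1"
  have "ennreal (\<Sum>i\<in>I. M i * (a i powr s * b i powr (1 - s))) * ?C
      \<le> ennreal (\<Sum>i\<in>J. M' i * (a' i powr s * b' i powr (1 - s))) * ?C"
    by (subst (1 2) parallel_integral_sum)
      (use fin s I J le in \<open>auto simp: indicator_def intro!: nn_integral_mono ennreal_leI mult_left_mono\<close>)
  then have "ennreal (\<Sum>i\<in>I. M i * (a i powr s * b i powr (1 - s)))
      \<le> ennreal (\<Sum>i\<in>J. M' i * (a' i powr s * b' i powr (1 - s)))"
    using parallel_integral_one[OF s] by (simp add: ennreal_mult_le_mult_iff mult.commute[of _ ?C])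
  then show ?thesis using J by (subst (asm) ennreal_le_iff) (auto intro!: sum_nonneg)
qed

text \<open>The reverse triangle inequality reduces the claim to the moduli \<open>p\<close> and
  \<open>r\<close>. There, after multiplication by \<open>d = a + t * b\<close>, the two sides
  differ by the perfect square of \<open>d * r - t * b * p\<close>.\<close>

lemma parallel_variational:
  assumes "0 \<le> a" "0 \<le> b" "0 < t"
  shows "t * parallel t a b * (cmod y)^2 \<le> a * (cmod z)^2 + t * (b * (cmod (y - z))^2)"
proof (cases "a + t * b = 0")
  case True
  then show ?thesis using assms by (simp add: parallel_def)
next
  case False
  define d where "d = a + t * b"
  have d: "d > 0" using False assms by (simp add: d_def less_le)
  define p r where "p = cmod y" and "r = cmod z"
  have "\<bar>p - r\<bar> \<le> cmod (y - z)" unfolding p_def r_def by (rule norm_triangle_ineq3)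
  then have "(p - r)^2 \<le> (cmod (y - z))^2" by (metis abs_le_square_iff abs_norm_cancel)
  then have 1: "a * r^2 + t * (b * (p - r)^2) \<le> a * r^2 + t * (b * (cmod (y - z))^2)"
    using assms by (intro add_left_mono mult_left_mono) auto
  have "d * (a * r^2 + t * (b * (p - r)^2)) = t * (a * b) * p^2 + (d * r - t * b * p)^2"
    by (simp add: d_def power2_eq_square algebra_simps)
  then have "t * (a * b) * p^2 \<le> d * (a * r^2 + t * (b * (p - r)^2))" by simp
  then have "t * parallel t a b * p^2 \<le> a * r^2 + t * (b * (p - r)^2)"
    using d by (simp add: parallel_def d_def[symmetric] pos_divide_le_eq mult.commute[of _ d])
  with 1 show ?thesis by (simp add: p_def r_def)
qed

text \<open>This \<open>z\<close> has the phase of \<open>y\<close> and makes the completed square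
  vanish. If \<open>a + t * b = 0\<close>, then \<open>z = 0\<close> by division by zero and both
  sides are 0.\<close>

lemma parallel_variational_eq:
  fixes y :: complex
  assumes "0 \<le> a" "0 \<le> b" "0 < t"
  defines "z \<equiv> complex_of_real (t * b / (a + t * b)) * y"
  shows "t * parallel t a b * (cmod y)^2 = a * (cmod z)^2 + t * (b * (cmod (y - z))^2)"
proof (cases "a + t * b = 0")
  case True
  then have "a = 0" "t * b = 0" using assms by (auto simp: add_nonneg_eq_0_iff)
  then show ?thesis using assms by (simp add: parallel_def)
next
  case False
  define d where "d = a + t * b"
  have d: "d > 0" using False assms by (simp add: d_def less_le)
  have "y - z = complex_of_real (1 - t * b / d) * y" by (simp add: z_def d_def algebra_simps)
  also have "1 - t * b / d = a / d" using d by (simp add: field_simps d_def)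
  finally have C1: "cmod (y - z) = a / d * cmod y" using assms d by (simp add: norm_mult norm_divide)
  have C2: "cmod z = t * b / d * cmod y"
    unfolding z_def d_def[symmetric] norm_mult norm_of_real using assms d by simp
  have "t * (a * b / d) = a * (t * b / d)^2 + t * (b * (a / d)^2)"
    using d by (simp add: field_simps power2_eq_square) (simp add: d_def algebra_simps)
  then have "t * (a * b / d) * (cmod y)^2 = (a * (t * b / d)^2 + t * (b * (a / d)^2)) * (cmod y)^2"
    by (simp only:)
  then show ?thesis
    unfolding C1 C2 parallel_def d_def[symmetric] power_mult_distrib distrib_right mult.assoc .
qed

section \<open>Lieb's concavity theorem for averages over conjugations\<close>

text \<open>For fixed \<open>z\<close> this is linear in the pair \<open>(A, B)\<close>; for
  positive \<open>A\<close>, \<open>B\<close> and \<open>t > 0\<close> its minimum over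
  \<open>z\<close> is the quadratic form in \<open>y\<close> of the parallel sum of left
  multiplication by \<open>A\<close> and right multiplication by \<open>t B\<close>.\<close>

definition parallel_form ::
  "real \<Rightarrow> complex ^ 'n::finite ^ 'n \<Rightarrow> complex ^ 'n ^ 'n \<Rightarrow> complex ^ 'n ^ 'n \<Rightarrow> complex ^ 'n ^ 'n \<Rightarrow> real" where
  "parallel_form t y z A B = Re (trace (adj z ** A ** z)) + t * Re (trace (adj (y - z) ** (y - z) ** B))"

text \<open>Inserting \<open>V ** adj V\<close> as a second weight lets a one-sided form be read in
  the same matrix entries as the two-sided one, for any unitary \<open>V\<close>.\<close>

lemma trace_left_diag:
  assumes "unitary V"
  shows "Re (trace (adj z ** (U ** diag_mat a ** adj U) ** z))
    = (\<Sum>i\<in>UNIV. \<Sum>j\<in>UNIV. a i * (cmod ((adj U ** z ** V) $ i $ j))^2)"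
proof -
  have "Re (trace (adj z ** (U ** diag_mat a ** adj U) ** z ** (V ** diag_mat (\<lambda>_. 1) ** adj V)))
      = (\<Sum>i\<in>UNIV. \<Sum>j\<in>UNIV. a i * 1 * (cmod ((adj U ** z ** V) $ i $ j))^2)"
    by (simp only: trace_weighted Re_complex_of_real)
  then show ?thesis by (simp add: diag_mat_one unitary_simps[OF assms])
qed

lemma trace_right_diag:
  assumes "unitary U"
  shows "Re (trace (adj z ** z ** (V ** diag_mat b ** adj V)))
    = (\<Sum>i\<in>UNIV. \<Sum>j\<in>UNIV. b j * (cmod ((adj U ** z ** V) $ i $ j))^2)"
proof -
  have "Re (trace (adj z ** (U ** diag_mat (\<lambda>_. 1) ** adj U) ** z ** (V ** diag_mat b ** adj V)))
      = (\<Sum>i\<in>UNIV. \<Sum>j\<in>UNIV. 1 * b j * (cmod ((adj U ** z ** V) $ i $ j))^2)"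
    by (simp only: trace_weighted Re_complex_of_real)
  then show ?thesis by (simp add: diag_mat_one unitary_simps[OF assms])
qed

lemma parallel_form_diag:
  assumes U: "unitary U" and V: "unitary V"
  shows "parallel_form t y z (U ** diag_mat a ** adj U) (V ** diag_mat b ** adj V)
    = (\<Sum>i\<in>UNIV. \<Sum>j\<in>UNIV. a i * (cmod ((adj U ** z ** V) $ i $ j))^2
        + t * (b j * (cmod ((adj U ** y ** V) $ i $ j - (adj U ** z ** V) $ i $ j))^2))"
proof -
  have "adj U ** (y - z) ** V = adj U ** y ** V - adj U ** z ** V"
    by (simp add: matrix_mult.diff_left matrix_mult.diff_right)
  then show ?thesis
    by (simp add: parallel_form_def trace_left_diag[OF V] trace_right_diag[OF U] sum.distrib sum_distrib_left)
qed

lemma parallel_le_form: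
  assumes "unitary U" "unitary V" "\<And>i. 0 \<le> a i" "\<And>j. 0 \<le> b j" "0 < t"
  shows "t * (\<Sum>i\<in>UNIV. \<Sum>j\<in>UNIV. (cmod ((adj U ** y ** V) $ i $ j))^2 * parallel t (a i) (b j))
    \<le> parallel_form t y z (U ** diag_mat a ** adj U) (V ** diag_mat b ** adj V)"
proof -
  have "t * (\<Sum>i\<in>UNIV. \<Sum>j\<in>UNIV. (cmod ((adj U ** y ** V) $ i $ j))^2 * parallel t (a i) (b j))
      = (\<Sum>i\<in>UNIV. \<Sum>j\<in>UNIV. t * parallel t (a i) (b j) * (cmod ((adj U ** y ** V) $ i $ j))^2)"
    by (simp add: sum_distrib_left mult_ac)
  also have "\<dots> \<le> parallel_form t y z (U ** diag_mat a ** adj U) (V ** diag_mat b ** adj V)"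
    unfolding parallel_form_diag[OF assms(1,2)]
    by (intro sum_mono parallel_variational assms)
  finally show ?thesis .
qed

lemma parallel_form_attained:
  assumes U: "unitary U" and V: "unitary V" and "\<And>i. 0 \<le> a i" "\<And>j. 0 \<le> b j" "0 < t"
  obtains z where "parallel_form t y z (U ** diag_mat a ** adj U) (V ** diag_mat b ** adj V)
    = t * (\<Sum>i\<in>UNIV. \<Sum>j\<in>UNIV. (cmod ((adj U ** y ** V) $ i $ j))^2 * parallel t (a i) (b j))"
proof -
  \<comment> \<open>The scalar minimisers, chosen independently for each entry in the
    eigenbases.\<close>
  define Z where "Z = (\<chi> i j. complex_of_real (t * b j / (a i + t * b j)) * (adj U ** y ** V) $ i $ j)"
  define z where "z = U ** Z ** adj V"
  have "adj U ** z ** V = Z"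
    by (simp add: z_def matrix_mul_assoc[symmetric] unitary_simps[OF U] unitary_simps[OF V])
  then have "parallel_form t y z (U ** diag_mat a ** adj U) (V ** diag_mat b ** adj V)
      = (\<Sum>i\<in>UNIV. \<Sum>j\<in>UNIV. t * parallel t (a i) (b j) * (cmod ((adj U ** y ** V) $ i $ j))^2)"
    unfolding parallel_form_diag[OF U V]
    by (intro sum.cong refl) (simp only: Z_def vec_lambda_beta parallel_variational_eq[OF assms(3-5)])
  also have "\<dots> = t * (\<Sum>i\<in>UNIV. \<Sum>j\<in>UNIV. (cmod ((adj U ** y ** V) $ i $ j))^2 * parallel t (a i) (b j))"
    by (simp add: sum_distrib_left mult_ac)
  finally show thesis by (rule that)
qed

lemma bounded_linear_Re_trace:
  fixes P Q :: "complex ^ 'n::finite ^ 'n"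
  shows "bounded_linear (\<lambda>A. Re (trace (P ** A ** Q)))"
  unfolding linear_conv_bounded_linear[symmetric]
  by (rule linearI) (simp_all add: matrix_mult.add_left matrix_mult.add_right matrix_mult.scaleR_left
      matrix_mult.scaleR_right linear_add[OF bounded_linear.linear[OF bounded_linear_trace]]
      linear_scale[OF bounded_linear.linear[OF bounded_linear_trace]])

text \<open>Jensen's inequality concerns averages over unitary conjugations only. Continuity is
  stated for the conjugations because a projective representation is continuous just up to
  phases.\<close>

locale conjugation_kernel =
  fixes \<mu> :: "'g::second_countable_topology measure" and k :: "'g \<Rightarrow> real"
    and u :: "'g \<Rightarrow> complex ^ 'n::finite ^ 'n"
  assumes compact_space: "compact (UNIV :: 'g set)"
    and sets_eq: "sets \<mu> = sets borel"
    and markov: "markov_kernel \<mu> k"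
    and unitary_u: "unitary (u g)"
    and continuous_conj: "continuous_on UNIV (\<lambda>g. u g ** x ** adj (u g))"
    and continuous_conj_adj: "continuous_on UNIV (\<lambda>g. adj (u g) ** x ** u g)"
begin

lemma kernel_nonneg: "0 \<le> k g"
  using markov by (simp add: markov_kernel_def)

lemma continuous_measurable:
  fixes f :: "'g \<Rightarrow> 'b::topological_space"
  shows "continuous_on UNIV f \<Longrightarrow> f \<in> borel_measurable \<mu>"
  using borel_measurable_continuous_onI[of f] measurable_cong_sets[OF sets_eq refl] by blast

lemma continuous_bounded:
  fixes f :: "'g \<Rightarrow> 'b::real_normed_vector"
  assumes "continuous_on UNIV f"
  obtains C where "\<And>g. norm (f g) \<le> C"
  using compact_imp_bounded[OF compact_continuous_image[OF assms compact_space]]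
  unfolding bounded_iff by auto

text \<open>The kernel is integrable but possibly unbounded, so the bound must come from
  \<open>f\<close>, by compactness.\<close>

lemma kernel_integrable:
  fixes f :: "'g \<Rightarrow> 'b::{banach, second_countable_topology}"
  assumes "continuous_on UNIV f"
  shows "integrable \<mu> (\<lambda>g. k g *\<^sub>R f g)"
proof -
  obtain C where C: "\<And>g. norm (f g) \<le> C" using continuous_bounded[OF assms] by blast
  have k: "integrable \<mu> k" using markov by (simp add: markov_kernel_def)
  show ?thesis
  proof (rule Bochner_Integration.integrable_bound[of _ "\<lambda>g. C * k g"])
    show "(\<lambda>g. k g *\<^sub>R f g) \<in> borel_measurable \<mu>"
      using k continuous_measurable[OF assms] by (intro borel_measurable_scaleR) auto
    have "norm (k g *\<^sub>R f g) \<le> norm (C * k g)" for g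
    proof -
      have "k g * norm (f g) \<le> k g * C" by (intro mult_left_mono C kernel_nonneg)
      also have "\<dots> \<le> \<bar>C * k g\<bar>" by (simp add: mult.commute)
      finally show ?thesis by (simp add: kernel_nonneg)
    qed
    then show "AE g in \<mu>. norm (k g *\<^sub>R f g) \<le> norm (C * k g)" by simp
  qed (use k in simp)
qed

lemma kernel_integral_mono:
  assumes "continuous_on UNIV f" "continuous_on UNIV h" "\<And>g. f g \<le> h g"
  shows "(LINT g|\<mu>. k g * f g) \<le> (LINT g|\<mu>. k g * h g)"
  using kernel_integrable[OF assms(1)] kernel_integrable[OF assms(2)] assms(3)
  by (intro integral_mono mult_left_mono kernel_nonneg) auto

lemma channel_linear:
  fixes l :: "complex ^ 'n ^ 'n \<Rightarrow> 'b::{banach, second_countable_topology}"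
  assumes "bounded_linear l"
  shows "l (channel \<mu> k u x) = (LINT g|\<mu>. k g *\<^sub>R l (u g ** x ** adj (u g)))"
  unfolding channel_def
  by (subst integral_bounded_linear[OF assms kernel_integrable[OF continuous_conj], symmetric])
     (simp add: linear_scale[OF bounded_linear.linear[OF assms]])

lemma channel_adj_linear:
  fixes l :: "complex ^ 'n ^ 'n \<Rightarrow> 'b::{banach, second_countable_topology}"
  assumes "bounded_linear l"
  shows "l (channel_adj \<mu> k u x) = (LINT g|\<mu>. k g *\<^sub>R l (adj (u g) ** x ** u g))"
  unfolding channel_adj_def
  by (subst integral_bounded_linear[OF assms kernel_integrable[OF continuous_conj_adj], symmetric])
     (simp add: linear_scale[OF bounded_linear.linear[OF assms]])

lemma positive_channel_adj:
  assumes "positive_op A"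
  shows "positive_op (channel_adj \<mu> k u A)"
  unfolding positive_op_iff
proof
  have sa: "adj (adj (u g) ** A ** u g) = adj (u g) ** A ** u g" for g
    using self_adjoint_conj[of A] assms by (simp add: positive_op_iff self_adjoint_def)
  show "self_adjoint (channel_adj \<mu> k u A)"
    unfolding self_adjoint_def channel_adj_linear[OF bounded_linear_adj] sa
    by (simp add: channel_adj_def)
  have "bounded_linear (\<lambda>M. Re (cinner v (M *v v)))" for v
    unfolding linear_conv_bounded_linear[symmetric]
    by (rule linearI) (auto simp: cinner_def matrix_vector_mult_def sum.distrib algebra_simps
        scaleR_sum_right sum_distrib_left)
  then have "Re (cinner v (channel_adj \<mu> k u A *v v))
      = (LINT g|\<mu>. k g *\<^sub>R Re (cinner v ((adj (u g) ** A ** u g) *v v)))" for v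
    by (rule channel_adj_linear)
  moreover have "0 \<le> Re (cinner v ((adj (u g) ** A ** u g) *v v))" for v g
    using positive_op_conj[OF assms, of "u g"] by (simp add: positive_op_iff)
  ultimately show "\<forall>v. 0 \<le> Re (cinner v (channel_adj \<mu> k u A *v v))"
    by (simp add: kernel_nonneg integral_nonneg)
qed

text \<open>Conjugating the weights by \<open>u g\<close> leaves their eigenvalues fixed and only
  rotates their eigenbases. Averaging over \<open>g\<close> therefore acts on squared entries
  alone.\<close>

definition mean_entry ::
  "complex ^ 'n ^ 'n \<Rightarrow> complex ^ 'n ^ 'n \<Rightarrow> complex ^ 'n ^ 'n \<Rightarrow> 'n \<Rightarrow> 'n \<Rightarrow> real" where
  "mean_entry y U V i j = (LINT g|\<mu>. k g * (cmod ((adj U ** (u g ** y ** adj (u g)) ** V) $ i $ j))^2)"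

lemma continuous_entry:
  "continuous_on UNIV (\<lambda>g. (cmod ((adj U ** (u g ** y ** adj (u g)) ** V) $ i $ j))^2)"
  by (intro continuous_intros matrix_mult.continuous_on continuous_conj)

lemma mean_entry_nonneg: "0 \<le> mean_entry y U V i j"
  unfolding mean_entry_def by (simp add: kernel_nonneg integral_nonneg)

lemma mean_entry_sum:
  "(LINT g|\<mu>. k g * (\<Sum>i\<in>UNIV. \<Sum>j\<in>UNIV. (cmod ((adj U ** (u g ** y ** adj (u g)) ** V) $ i $ j))^2 * c i j))
    = (\<Sum>i\<in>UNIV. \<Sum>j\<in>UNIV. mean_entry y U V i j * c i j)"
proof -
  have int: "integrable \<mu> (\<lambda>g. k g * (cmod ((adj U ** (u g ** y ** adj (u g)) ** V) $ i $ j))^2 * c i j)" for i j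
    by (rule integrable_mult_left) (use kernel_integrable[OF continuous_entry, of U y V i j] in simp)
  have "(LINT g|\<mu>. k g * (\<Sum>i\<in>UNIV. \<Sum>j\<in>UNIV. (cmod ((adj U ** (u g ** y ** adj (u g)) ** V) $ i $ j))^2 * c i j))
      = (LINT g|\<mu>. (\<Sum>i\<in>UNIV. \<Sum>j\<in>UNIV. k g * (cmod ((adj U ** (u g ** y ** adj (u g)) ** V) $ i $ j))^2 * c i j))"
    by (simp add: sum_distrib_left mult.assoc)
  also have "\<dots> = (\<Sum>i\<in>UNIV. \<Sum>j\<in>UNIV. mean_entry y U V i j * c i j)"
    using int by (simp add: Bochner_Integration.integral_sum Bochner_Integration.integrable_sum mean_entry_def)
  finally show ?thesis .
qed

lemma conj_frame: "adj (adj (u g) ** U) ** y ** (adj (u g) ** V) = adj U ** (u g ** y ** adj (u g)) ** V"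
  by (simp add: adj_mult matrix_mul_assoc)

lemma conj_diag: "adj (u g) ** (U ** diag_mat a ** adj U) ** u g
    = (adj (u g) ** U) ** diag_mat a ** adj (adj (u g) ** U)"
  by (simp add: adj_mult matrix_mul_assoc)

context
  fixes U V U' V' :: "complex ^ 'n ^ 'n" and a b a' b' :: "'n \<Rightarrow> real" and A B :: "complex ^ 'n ^ 'n"
  assumes unit: "unitary U" "unitary V" "unitary U'" "unitary V'"
    and nonneg: "\<And>i. 0 \<le> a i" "\<And>i. 0 \<le> b i" "\<And>i. 0 \<le> a' i" "\<And>i. 0 \<le> b' i"
    and A: "A = U ** diag_mat a ** adj U" and B: "B = V ** diag_mat b ** adj V"
    and A': "channel_adj \<mu> k u A = U' ** diag_mat a' ** adj U'"
    and B': "channel_adj \<mu> k u B = V' ** diag_mat b' ** adj V'"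
begin

text \<open>The parallel sum of \<open>A\<close> and \<open>t B\<close> is an infimum over \<open>z\<close> of functions that are linear in \<open>(A, B)\<close>.
  Inserting the \<open>z\<close> which is optimal for the averaged pair gives Jensen's inequality.\<close>

lemma parallel_jensen:
  assumes t: "0 < t"
  shows "(\<Sum>i\<in>UNIV. \<Sum>j\<in>UNIV. mean_entry y U V i j * parallel t (a i) (b j))
    \<le> (\<Sum>i\<in>UNIV. \<Sum>j\<in>UNIV. (cmod ((adj U' ** y ** V') $ i $ j))^2 * parallel t (a' i) (b' j))"
proof -
  let ?S = "\<lambda>g. \<Sum>i\<in>UNIV. \<Sum>j\<in>UNIV. (cmod ((adj U ** (u g ** y ** adj (u g)) ** V) $ i $ j))^2 * parallel t (a i) (b j)"
  let ?M = "\<Sum>i\<in>UNIV. \<Sum>j\<in>UNIV. mean_entry y U V i j * parallel t (a i) (b j)"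
  let ?R = "\<Sum>i\<in>UNIV. \<Sum>j\<in>UNIV. (cmod ((adj U' ** y ** V') $ i $ j))^2 * parallel t (a' i) (b' j)"
  obtain z where z: "parallel_form t y z (channel_adj \<mu> k u A) (channel_adj \<mu> k u B)
    = t * ?R"
    unfolding A' B' by (rule parallel_form_attained[OF unit(3,4) nonneg(3,4) t])
  define Q where "Q = (\<lambda>g. parallel_form t y z (adj (u g) ** A ** u g) (adj (u g) ** B ** u g))"
  have lin1: "bounded_linear (\<lambda>M. Re (trace (adj z ** M ** z)))"
    by (rule bounded_linear_Re_trace)
  have lin2: "bounded_linear (\<lambda>M. Re (trace (adj (y - z) ** (y - z) ** M)))"
    using bounded_linear_Re_trace[of "adj (y - z) ** (y - z)" "mat 1"] by simp
  note c1 = bounded_linear.continuous_on[OF lin1 continuous_conj_adj]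
  note c2 = bounded_linear.continuous_on[OF lin2 continuous_conj_adj]
  have contQ: "continuous_on UNIV Q"
    unfolding Q_def parallel_form_def by (intro continuous_intros c1 c2)
  have "parallel_form t y z (channel_adj \<mu> k u A) (channel_adj \<mu> k u B) = (LINT g|\<mu>. k g * Q g)"
    using kernel_integrable[OF c1, of A] kernel_integrable[OF c2, of B]
    by (simp add: Q_def parallel_form_def channel_adj_linear[OF lin1] channel_adj_linear[OF lin2]
        distrib_left mult.left_commute[of _ t])
  \<comment> \<open>For an individual \<open>g\<close> the matrix \<open>z\<close> is merely
    admissible, not optimal, which gives an upper bound for the parallel sum at
    \<open>g\<close>.\<close>
  moreover have "(LINT g|\<mu>. k g * (t * ?S g))
      \<le> (LINT g|\<mu>. k g * Q g)"
  proof (rule kernel_integral_mono[OF _ contQ])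
    show "continuous_on UNIV (\<lambda>g. t * ?S g)"
      by (intro continuous_intros continuous_entry)
    fix g
    have "unitary (adj (u g) ** U)" "unitary (adj (u g) ** V)"
      by (intro unitary_mult unitary_adj unitary_u unit)+
    from parallel_le_form[where y = y and z = z, OF this nonneg(1,2) t]
    show "t * ?S g \<le> Q g"
      unfolding conj_frame Q_def A B conj_diag .
  qed
  moreover have "(LINT g|\<mu>. k g * (t * ?S g))
      = t * ?M"
    unfolding mult.left_commute[of _ t] by (simp only: integral_mult_right_zero mean_entry_sum)
  ultimately have "t * ?M
      \<le> t * ?R"
    using z by linarith
  then show ?thesis by (rule mult_left_le_imp_le[OF _ t])
qed

lemma weighted_jensen:
  assumes s: "0 \<le> s" "s \<le> 1"
  shows "(\<Sum>i\<in>UNIV. \<Sum>j\<in>UNIV. (if s = 0 then 1 else a i powr s) * (if 1 - s = 0 then 1 else b j powr (1 - s)) * mean_entry y U V i j)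
    \<le> Re (trace (adj y ** op_powr (channel_adj \<mu> k u A) s ** y ** op_powr (channel_adj \<mu> k u B) (1 - s)))"
proof -
  have rhs: "Re (trace (adj y ** op_powr (channel_adj \<mu> k u A) s ** y ** op_powr (channel_adj \<mu> k u B) (1 - s)))
      = (\<Sum>i\<in>UNIV. \<Sum>j\<in>UNIV. (if s = 0 then 1 else a' i powr s) * (if 1 - s = 0 then 1 else b' j powr (1 - s))
          * (cmod ((adj U' ** y ** V') $ i $ j))^2)"
    unfolding op_powr_def A' B' fun_calc_diag[OF unit(3)] fun_calc_diag[OF unit(4)] trace_weighted
    by (rule Re_complex_of_real)
  have lin: "Re (trace (adj y ** channel_adj \<mu> k u M ** y)) = (LINT g|\<mu>. k g * Re (trace (adj y ** (adj (u g) ** M ** u g) ** y)))"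
    "Re (trace (adj y ** y ** channel_adj \<mu> k u M)) = (LINT g|\<mu>. k g * Re (trace (adj y ** y ** (adj (u g) ** M ** u g))))" for M
    using channel_adj_linear[OF bounded_linear_Re_trace[of "adj y" y]]
      channel_adj_linear[OF bounded_linear_Re_trace[of "adj y ** y" "mat 1"]] by simp_all
  have uu: "unitary (adj (u g) ** U)" "unitary (adj (u g) ** V)" for g
    by (intro unitary_mult unitary_adj unitary_u unit)+
  \<comment> \<open>At the endpoints the integral representation breaks down and
    \<open>op_powr\<close> follows the convention for exponent 0. One weight is then trivial and the
    form is linear in the other, so averaging even gives equality.\<close>
  consider "s = 0" | "s = 1" | "0 < s" "s < 1" using s by linarith
  then show ?thesis
  proof cases
    case 1
    have "(\<Sum>i\<in>UNIV. \<Sum>j\<in>UNIV. b j * mean_entry y U V i j)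
        = (LINT g|\<mu>. k g * Re (trace (adj y ** y ** (adj (u g) ** B ** u g))))"
    proof -
      have "Re (trace (adj y ** y ** (adj (u g) ** B ** u g)))
          = (\<Sum>i\<in>UNIV. \<Sum>j\<in>UNIV. (cmod ((adj U ** (u g ** y ** adj (u g)) ** V) $ i $ j))^2 * b j)" for g
        unfolding B conj_diag trace_right_diag[OF uu(1)[of g]] conj_frame by (simp add: mult.commute)
      then show ?thesis using mean_entry_sum[of U y V "\<lambda>i j. b j"] by (simp add: mult.commute)
    qed
    also have "\<dots> = Re (trace (adj y ** y ** channel_adj \<mu> k u B))" by (rule lin(2)[symmetric])
    also have "\<dots> = (\<Sum>i\<in>UNIV. \<Sum>j\<in>UNIV. b' j * (cmod ((adj U' ** y ** V') $ i $ j))^2)"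
      unfolding B' by (rule trace_right_diag[OF unit(3)])
    finally show ?thesis unfolding rhs using 1 nonneg by simp
  next
    case 2
    have "(\<Sum>i\<in>UNIV. \<Sum>j\<in>UNIV. a i * mean_entry y U V i j)
        = (LINT g|\<mu>. k g * Re (trace (adj y ** (adj (u g) ** A ** u g) ** y)))"
    proof -
      have "Re (trace (adj y ** (adj (u g) ** A ** u g) ** y))
          = (\<Sum>i\<in>UNIV. \<Sum>j\<in>UNIV. (cmod ((adj U ** (u g ** y ** adj (u g)) ** V) $ i $ j))^2 * a i)" for g
        unfolding A conj_diag trace_left_diag[OF uu(2)[of g]] conj_frame by (simp add: mult.commute)
      then show ?thesis using mean_entry_sum[of U y V "\<lambda>i j. a i"] by (simp add: mult.commute)
    qed
    also have "\<dots> = Re (trace (adj y ** channel_adj \<mu> k u A ** y))" by (rule lin(1)[symmetric])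
    also have "\<dots> = (\<Sum>i\<in>UNIV. \<Sum>j\<in>UNIV. a' i * (cmod ((adj U' ** y ** V') $ i $ j))^2)"
      unfolding A' by (rule trace_left_diag[OF unit(4)])
    finally show ?thesis unfolding rhs using 2 nonneg by simp
  next
    case 3
    have "(\<Sum>p\<in>UNIV \<times> UNIV. mean_entry y U V (fst p) (snd p) * (a (fst p) powr s * b (snd p) powr (1 - s)))
        \<le> (\<Sum>p\<in>UNIV \<times> UNIV. (cmod ((adj U' ** y ** V') $ fst p $ snd p))^2 * (a' (fst p) powr s * b' (snd p) powr (1 - s)))"
      using 3 nonneg mean_entry_nonneg parallel_jensen
      by (intro sum_powr_le_of_parallel) (auto simp: sum.cartesian_product case_prod_beta)
    then show ?thesis unfolding rhs using 3
      by (simp add: sum.cartesian_product case_prod_beta mult.commute)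
  qed
qed

end

end

section \<open>One-parameter groups of unitaries\<close>

text \<open>For times of modulus at most 1, the terms of the series of degree at least 2 are bounded
  together by \<open>t^2 * C\<close>. This yields the value at 0 as well as the derivative
  there.\<close>

lemma mat_exp_has_vector_derivative:
  fixes M :: "complex ^ 'n::finite ^ 'n"
  shows "((\<lambda>t. mat_exp (t *\<^sub>R M)) has_vector_derivative M) (at 0)" and mat_exp_zero: "mat_exp (0 *\<^sub>R M) = mat 1"
proof -
  define P where "P = (\<lambda>m. ((**) M ^^ m) (mat 1))"
  define a where "a = (\<lambda>m. (1 / fact m) *\<^sub>R P m)"
  have "\<exists>K>0. \<forall>(A :: complex ^ 'n ^ 'n) B :: complex ^ 'n ^ 'n. norm (A ** B) \<le> norm A * norm B * K"
    by (rule matrix_mult.pos_bounded)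
  then obtain K where K: "K > 0" "\<And>(A :: complex ^ 'n ^ 'n) B :: complex ^ 'n ^ 'n. norm (A ** B) \<le> norm A * norm B * K"
    by blast
  have P: "norm (P m) \<le> norm (mat 1 :: complex ^ 'n ^ 'n) * (norm M * K) ^ m" for m
  proof (induction m)
    case (Suc m)
    have "norm (P (Suc m)) \<le> norm M * norm (P m) * K" using K(2)[of M "P m"] by (simp add: P_def)
    also have "\<dots> \<le> norm M * (norm (mat 1 :: complex ^ 'n ^ 'n) * (norm M * K) ^ m) * K"
      using Suc K(1) by (intro mult_right_mono mult_left_mono) auto
    finally show ?case by (simp add: mult_ac)
  qed (simp add: P_def)
  have sa: "summable (\<lambda>m. norm (a m))"
  proof (rule summable_comparison_test')
    show "summable (\<lambda>m. norm (mat 1 :: complex ^ 'n ^ 'n) * (inverse (fact m) * (norm M * K) ^ m))"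
      by (intro summable_mult summable_exp)
    show "norm (norm (a m)) \<le> norm (mat 1 :: complex ^ 'n ^ 'n) * (inverse (fact m) * (norm M * K) ^ m)" for m
      using mult_left_mono[OF P[of m], of "inverse (fact m)"] by (simp add: a_def field_simps)
  qed
  have pow: "((**) (t *\<^sub>R M) ^^ m) (mat 1) = t ^ m *\<^sub>R P m" for t m
    by (induction m) (simp_all add: P_def matrix_mult.scaleR_left matrix_mult.scaleR_right)
  have exp: "mat_exp (t *\<^sub>R M) = (\<Sum>m. t ^ m *\<^sub>R a m)" for t
    by (simp add: mat_exp_def pow a_def mult.commute)
  have st: "summable (\<lambda>m. t ^ m *\<^sub>R a m)" if "\<bar>t\<bar> \<le> 1" for t
  proof (rule summable_comparison_test'[OF sa])
    show "norm (t ^ m *\<^sub>R a m) \<le> norm (a m)" for m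
      using that by (simp add: power_abs mult_left_le_one_le power_le_one)
  qed
  have a01: "a 0 = mat 1" "a 1 = M" by (simp_all add: a_def P_def)
  have tail: "summable (\<lambda>m. norm (a (m + 2)))" using sa by (rule summable_ignore_initial_segment)
  define C where "C = (\<Sum>m. norm (a (m + 2)))"
  have C: "C \<ge> 0" unfolding C_def by (intro suminf_nonneg tail) simp
  have est: "norm (mat_exp (t *\<^sub>R M) - mat 1 - t *\<^sub>R M) \<le> t^2 * C" if t: "\<bar>t\<bar> \<le> 1" for t
  proof -
    have "mat_exp (t *\<^sub>R M) = (\<Sum>m. t ^ (m + 2) *\<^sub>R a (m + 2)) + (\<Sum>m<2. t ^ m *\<^sub>R a m)"
      unfolding exp by (rule suminf_split_initial_segment[OF st[OF t]])
    then have "mat_exp (t *\<^sub>R M) - mat 1 - t *\<^sub>R M = (\<Sum>m. t ^ (m + 2) *\<^sub>R a (m + 2))"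
      using a01 by (simp add: numeral_2_eq_2)
    also have "norm \<dots> \<le> (\<Sum>m. t^2 * norm (a (m + 2)))"
    proof (rule norm_suminf_le)
      show "norm (t ^ (m + 2) *\<^sub>R a (m + 2)) \<le> t^2 * norm (a (m + 2))" for m
      proof -
        have "\<bar>t ^ (m + 2)\<bar> = t^2 * \<bar>t\<bar> ^ m" by (simp only: power_add abs_mult power_abs power2_abs mult.commute)
        also have "\<dots> \<le> t^2" using t by (intro mult_left_le power_le_one) auto
        finally show ?thesis unfolding norm_scaleR real_norm_def by (rule mult_right_mono) simp
      qed
    qed (intro summable_mult tail)
    also have "\<dots> = t^2 * C" unfolding C_def by (rule suminf_mult[OF tail])
    finally show ?thesis .
  qed
  show zero: "mat_exp (0 *\<^sub>R M) = mat 1" using est[of 0] by simp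
  show "((\<lambda>t. mat_exp (t *\<^sub>R M)) has_vector_derivative M) (at 0)"
    unfolding has_vector_derivative_def has_derivative_at_alt
  proof (intro conjI allI impI bounded_linear_scaleR_left)
    fix e :: real assume e: "e > 0"
    define d where "d = min 1 (e / (C + 1))"
    have "d > 0" using e C by (simp add: d_def)
    moreover have "norm (mat_exp (y *\<^sub>R M) - mat_exp (0 *\<^sub>R M) - (y - 0) *\<^sub>R M) \<le> e * norm (y - 0)"
      if "norm (y - 0) < d" for y
    proof -
      have y: "\<bar>y\<bar> \<le> 1" "\<bar>y\<bar> * (C + 1) \<le> e" using that C by (auto simp: d_def field_simps)
      have "norm (mat_exp (y *\<^sub>R M) - mat 1 - y *\<^sub>R M) \<le> y^2 * C" by (rule est[OF y(1)])
      also have "\<dots> = \<bar>y\<bar> * (\<bar>y\<bar> * C)" by (simp add: power2_eq_square mult.assoc[symmetric])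
      also have "\<dots> \<le> \<bar>y\<bar> * e" using y C by (intro mult_left_mono) (auto simp: distrib_left)
      finally show ?thesis using zero by (simp add: mult.commute)
    qed
    ultimately show "\<exists>d>0. \<forall>y. norm (y - 0) < d \<longrightarrow>
        norm (mat_exp (y *\<^sub>R M) - mat_exp (0 *\<^sub>R M) - (y - 0) *\<^sub>R M) \<le> e * norm (y - 0)" by blast
  qed
qed

lemma mat_mult_both: "mat c ** (A ** mat d) = mat (c * d) ** (A :: complex ^ 'n::finite ^ 'n)"
  by (simp add: vec_eq_iff)

lemma phase_conj:
  assumes "cmod c = 1"
  shows "(mat c ** W) ** x ** adj (mat c ** W) = W ** x ** adj (W :: complex ^ 'n::finite ^ 'n)"
    and "adj (mat c ** W) ** x ** (mat c ** W) = adj W ** x ** W"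
proof -
  have c: "c * cnj c = 1" using assms by (simp add: complex_norm_square[symmetric])
  have "(mat c ** W) ** x ** adj (mat c ** W) = mat c ** ((W ** x ** adj W) ** mat (cnj c))"
    by (simp add: adj_mult matrix_mul_assoc)
  also have "\<dots> = mat (c * cnj c) ** (W ** x ** adj W)"
    by (rule mat_mult_both)
  finally show "(mat c ** W) ** x ** adj (mat c ** W) = W ** x ** adj W" by (simp add: c)
  have "adj (mat c ** W) ** x ** (mat c ** W) = adj W ** mat (cnj c) ** x ** mat c ** W"
    by (simp add: adj_mult matrix_mul_assoc)
  also have "\<dots> = adj W ** (mat (cnj c) ** (x ** mat c)) ** W" by (simp only: matrix_mul_assoc)
  also have "mat (cnj c) ** (x ** mat c) = mat (c * cnj c) ** x"
    by (simp only: mat_mult_both mult.commute)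
  finally show "adj (mat c ** W) ** x ** (mat c ** W) = adj W ** x ** W" by (simp add: c matrix_mul_assoc)
qed

text \<open>The phases relating \<open>u (\<gamma> t)\<close> to the exponential may depend on
  \<open>t\<close> in any way. They cancel in the conjugation, which can thus be differentiated
  through the exponential.\<close>

lemma conj_generator_has_derivative:
  assumes "rep_generator u \<gamma> L"
  shows "((\<lambda>t. u (\<gamma> t) ** x ** adj (u (\<gamma> t))) has_vector_derivative mat \<i> ** commutator L x) (at 0)"
proof -
  define M where "M = mat \<i> ** L"
  define e where "e = (\<lambda>t. mat_exp (t *\<^sub>R M))"
  have L: "adj L = L" using assms by (simp add: rep_generator_def self_adjoint_def)
  have sc: "mat (\<i> * complex_of_real t) ** L = t *\<^sub>R M" for t
    by (simp add: vec_eq_iff M_def complex_eq_iff algebra_simps)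
  have conj: "u (\<gamma> t) ** x ** adj (u (\<gamma> t)) = e t ** x ** adj (e t)" for t
  proof -
    obtain c where c: "cmod c = 1" "mat_exp (mat (\<i> * complex_of_real t) ** L) = mat c ** u (\<gamma> t)"
      using assms by (auto simp: rep_generator_def)
    show ?thesis using c(2) phase_conj(1)[OF c(1), of "u (\<gamma> t)" x] by (simp add: sc e_def)
  qed
  have e: "(e has_vector_derivative M) (at 0)" unfolding e_def by (rule mat_exp_has_vector_derivative)
  have e0: "e 0 = mat 1" unfolding e_def by (rule mat_exp_zero)
  have ea: "((\<lambda>t. adj (e t)) has_vector_derivative adj M) (at 0)"
    by (rule bounded_linear.has_vector_derivative[OF bounded_linear_adj e])
  have ex: "((\<lambda>t. e t ** x) has_vector_derivative M ** x) (at 0)"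
    by (rule bounded_linear.has_vector_derivative[OF matrix_mult.bounded_linear_left e])
  from bounded_bilinear.has_vector_derivative[OF bounded_bilinear_matrix_mult ex ea]
  have "((\<lambda>t. e t ** x ** adj (e t)) has_vector_derivative x ** adj M + M ** x) (at 0)"
    by (simp add: e0)
  moreover have "x ** adj M + M ** x = mat \<i> ** commutator L x"
  proof -
    have "x ** adj M = (x ** L) ** mat (- \<i>)"
      by (simp add: M_def adj_mult L matrix_mul_assoc)
    also have "\<dots> = - (mat \<i> ** (x ** L))" by (simp add: vec_eq_iff)
    finally have "x ** adj M = - (mat \<i> ** (x ** L))" .
    moreover have "M ** x = mat \<i> ** (L ** x)" by (simp add: M_def matrix_mul_assoc)
    ultimately show ?thesis by (simp add: commutator_def matrix_mult.diff_right)
  qed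
  ultimately show ?thesis unfolding conj by simp
qed

text \<open>\<open>bounded_linear\<close> is only real linearity. Complex homogeneity is what pulls
  the factor \<i> out of the Lie derivative, where the modulus then removes it.\<close>

definition complex_linear :: "(complex ^ 'n::finite ^ 'n \<Rightarrow> complex) \<Rightarrow> bool" where
  "complex_linear l \<longleftrightarrow> bounded_linear l \<and> (\<forall>c M. l (mat c ** M) = c * l M)"

lemma complex_linear_trace: "complex_linear (\<lambda>M. trace (A ** M))"
proof -
  have "trace (A ** (mat c ** M)) = c * trace (A ** M)" for c M
  proof -
    have "A ** (mat c ** M) = mat c ** (A ** M)" by (metis mat_mult_commute matrix_mul_assoc)
    then show ?thesis by (simp add: trace_def sum_distrib_left)
  qed
  then show ?thesis
    using bounded_linear_compose[OF bounded_linear_trace matrix_mult.bounded_linear_right[of A]]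
    by (simp add: complex_linear_def)
qed

lemma complex_linear_entry:
  "complex_linear (\<lambda>M. (adj U ** M ** V) $ i $ j)"
proof -
  have "adj U ** (mat c ** M) ** V = mat c ** (adj U ** M ** V)" for c M
    by (metis mat_mult_commute matrix_mul_assoc)
  moreover have "bounded_linear (\<lambda>M. (adj U ** M ** V) $ i $ j)"
    unfolding linear_conv_bounded_linear[symmetric]
    by (rule linearI) (simp_all add: matrix_mult.add_left matrix_mult.add_right matrix_mult.scaleR_left
        matrix_mult.scaleR_right)
  ultimately show ?thesis by (simp add: complex_linear_def)
qed

text \<open>The universal property of the quotient by phases: preimages of open sets under a
  continuous phase invariant \<open>f\<close> are saturated and relatively open in the unitary
  group.\<close>

lemma projective_rep_conj_continuous:
  fixes f :: "complex ^ 'n::finite ^ 'n \<Rightarrow> 'b::topological_space"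
  assumes "projective_unitary_rep G u" and f: "continuous_on UNIV f"
    and inv: "\<And>c U. cmod c = 1 \<Longrightarrow> f (mat c ** U) = f U"
  shows "continuous_on UNIV (\<lambda>g. f (u g))"
  unfolding continuous_on_open_vimage[OF open_UNIV]
proof (intro allI impI)
  fix O' :: "'b set" assume O': "open O'"
  define W where "W = {U. unitary U} \<inter> f -` O'"
  have "openin (top_of_set {U. unitary U}) W"
    unfolding W_def by (rule continuous_openin_preimage_gen[OF continuous_on_subset[OF f] O']) simp
  moreover have "mat c ** U \<in> W" if "U \<in> W" "cmod c = 1" for U c
  proof -
    have "c * cnj c = 1" using that by (simp add: complex_norm_square[symmetric])
    then have "unitary (mat c :: complex ^ 'n ^ 'n)" by (simp add: unitary_def mat_mult_mat mult.commute)
    then show ?thesis using that by (simp add: W_def inv unitary_mult)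
  qed
  ultimately have "open (u -` W)" using assms(1) unfolding projective_unitary_rep_def by blast
  moreover have "u -` W = (\<lambda>g. f (u g)) -` O'"
    using assms(1) by (auto simp: W_def projective_unitary_rep_def)
  ultimately show "open ((\<lambda>g. f (u g)) -` O' \<inter> UNIV)" by simp
qed

section \<open>Transference\<close>

locale transference = lie_group G \<A>
  for G :: "('g::{t2_space, second_countable_topology}, 'm) monoid_scheme" (structure)
    and \<A> :: "('g, 'e::euclidean_space) atlas" +
  fixes E :: "'d::finite \<Rightarrow> real \<Rightarrow> 'g" and \<mu> :: "'g measure" and k :: "'g \<Rightarrow> real"
    and u :: "'g \<Rightarrow> complex ^ 'n::finite ^ 'n" and L :: "'d \<Rightarrow> complex ^ 'n ^ 'n"
  assumes compact_group: "compact (UNIV :: 'g set)"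
    and haar: "normalized_haar G \<mu>"
    and markov_k: "markov_kernel \<mu> k"
    and rep: "projective_unitary_rep G u"
    and generator: "rep_generator u (E j) (L j)"
begin

lemma rep_unitary: "unitary (u g)"
  using rep by (simp add: projective_unitary_rep_def)

sublocale conjugation_kernel \<mu> k u
proof
  show "sets \<mu> = sets borel" using haar by (simp add: normalized_haar_def)
  have adj: "continuous_on UNIV (adj :: complex ^ 'n ^ 'n \<Rightarrow> _)"
    by (rule linear_continuous_on[OF bounded_linear_adj])
  show "continuous_on UNIV (\<lambda>g. u g ** x ** adj (u g))" for x
    by (rule projective_rep_conj_continuous[OF rep, where f = "\<lambda>U. U ** x ** adj U"])
       (auto intro!: matrix_mult.continuous_on continuous_on_id continuous_on_const adj simp: phase_conj)
  show "continuous_on UNIV (\<lambda>g. adj (u g) ** x ** u g)" for x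
    by (rule projective_rep_conj_continuous[OF rep, where f = "\<lambda>U. adj U ** x ** U"])
       (auto intro!: matrix_mult.continuous_on continuous_on_id continuous_on_const adj simp: phase_conj)
qed (rule compact_group markov_k rep_unitary)+

text \<open>The map \<pi> of the overview; unlike \<open>u\<close> it is multiplicative without
  phases.\<close>

definition conjugate :: "'g \<Rightarrow> complex ^ 'n ^ 'n \<Rightarrow> complex ^ 'n ^ 'n" where
  "conjugate g x = u g ** x ** adj (u g)"

lemma conjugate_mult: "conjugate (g \<otimes> h) x = conjugate g (conjugate h x)"
proof -
  obtain c where c: "cmod c = 1" "u g ** u h = mat c ** u (g \<otimes> h)"
    using rep unfolding projective_unitary_rep_def by blast
  have "conjugate g (conjugate h x) = (u g ** u h) ** x ** adj (u g ** u h)"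
    by (simp add: conjugate_def adj_mult matrix_mul_assoc)
  also have "\<dots> = conjugate (g \<otimes> h) x"
    unfolding c(2) conjugate_def by (rule phase_conj(1)[OF c(1)])
  finally show ?thesis by simp
qed

lemma conjugate_inverse: "adj (u g) ** conjugate g x ** u g = x"
  by (simp add: conjugate_def matrix_mul_assoc[symmetric] unitary_simps[OF rep_unitary])

text \<open>\<open>u \<one>\<close> may be any phase. The map is idempotent by multiplicativity and
  injective by \<open>conjugate_inverse\<close>, hence the identity.\<close>

lemma conjugate_one [simp]: "conjugate \<one> x = x"
proof -
  have "conjugate \<one> (conjugate \<one> x) = conjugate \<one> x" using conjugate_mult[of \<one> \<one> x] by simp
  then show ?thesis using conjugate_inverse by metis
qed

lemma linear_conj: "linear (conjugate g)"
  by (rule linearI) (simp_all add: conjugate_def matrix_mult.add_left matrix_mult.add_right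
      matrix_mult.scaleR_left matrix_mult.scaleR_right)

lemma bounded_linear_conj: "bounded_linear (conjugate g)"
  using linear_conj by (simp add: linear_conv_bounded_linear)

lemma conjugate_mat: "conjugate g (mat c ** x) = mat c ** conjugate g x"
  unfolding conjugate_def by (metis mat_mult_commute matrix_mul_assoc)

lemma complex_linear_conj: "complex_linear l \<Longrightarrow> complex_linear (\<lambda>M. l (conjugate g M))"
  unfolding complex_linear_def
  using bounded_linear_compose[OF _ bounded_linear_conj, of l g] by (simp add: conjugate_mat)

lemma continuous_linear_conj: "bounded_linear l \<Longrightarrow> continuous_on UNIV (\<lambda>g. l (conjugate g x))"
  unfolding conjugate_def by (rule bounded_linear.continuous_on[OF _ continuous_conj])

lemma smooth_linear_conj:
  assumes "bounded_linear l"
  shows "smooth_fun \<A> (\<lambda>g. l (conjugate g x))"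
proof -
  have "smooth_fun \<A> (\<lambda>g. conjugate g x)"
  proof (rule continuous_representation_smooth[OF haar compact_group linear_conj conjugate_mult conjugate_one])
    show "continuous_on UNIV (\<lambda>g. conjugate g x)" for x unfolding conjugate_def by (rule continuous_conj)
  qed
  then show ?thesis
    unfolding smooth_fun_iff C_k_fun_def using C_k_on_bounded_linear_comp[OF assms] by fast
qed

lemma lie_deriv_linear_conj:
  assumes "complex_linear l"
  shows "lie_deriv G (E j) (\<lambda>g. l (conjugate g x)) g = \<i> * l (conjugate g (derivation L x j))"
proof -
  have l: "complex_linear (\<lambda>M. l (conjugate g M))" by (rule complex_linear_conj[OF assms])
  then have bl: "bounded_linear (\<lambda>M. l (conjugate g M))" by (simp add: complex_linear_def)
  have "((\<lambda>t. conjugate (E j t) x) has_vector_derivative mat \<i> ** derivation L x j) (at 0)"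
    unfolding conjugate_def derivation_def by (rule conj_generator_has_derivative[OF generator])
  from bounded_linear.has_vector_derivative[OF bl this]
  have "((\<lambda>t. l (conjugate (g \<otimes> E j t) x)) has_vector_derivative l (conjugate g (mat \<i> ** derivation L x j))) (at 0)"
    by (simp add: conjugate_mult)
  then have "lie_deriv G (E j) (\<lambda>g. l (conjugate g x)) g = l (conjugate g (mat \<i> ** derivation L x j))"
    unfolding lie_deriv_def by (rule vector_derivative_at)
  also have "\<dots> = \<i> * l (conjugate g (derivation L x j))" using l by (simp add: complex_linear_def)
  finally show ?thesis .
qed

lemma grad_sq_linear_conj:
  assumes "complex_linear l"
  shows "grad_sq G E (\<lambda>g. l (conjugate g x)) g = (\<Sum>j\<in>UNIV. (cmod (l (conjugate g (derivation L x j))))^2)"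
  unfolding grad_sq_def lie_deriv_linear_conj[OF assms] by (simp add: norm_mult)

lemma continuous_grad_sq:
  assumes "complex_linear l"
  shows "continuous_on UNIV (grad_sq G E (\<lambda>g. l (conjugate g x)))"
  unfolding grad_sq_linear_conj[OF assms, abs_def]
  by (intro continuous_intros continuous_linear_conj) (use assms in \<open>simp add: complex_linear_def\<close>)

text \<open>Left invariance of Haar measure shifts the translation from the merely integrable kernel
  to the continuous \<open>f\<close>.\<close>

lemma markov_map_eq:
  fixes f :: "'g \<Rightarrow> 'b::{banach, second_countable_topology}"
  assumes "continuous_on UNIV f"
  shows "markov_map G \<mu> k f h = (LINT g|\<mu>. k g *\<^sub>R f (h \<otimes> g))"
proof -
  have k: "k \<in> borel_measurable borel"
    using markov_k haar measurable_cong_sets[of \<mu> borel borel borel]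
    unfolding markov_kernel_def normalized_haar_def by blast
  have "(\<lambda>g. inv h \<otimes> g) \<in> borel \<rightarrow>\<^sub>M borel"
    by (rule borel_measurable_continuous_onI[OF continuous_left_mult])
  from measurable_compose[OF this k]
  have "(\<lambda>g. k (inv h \<otimes> g) *\<^sub>R f g) \<in> borel_measurable borel"
    by (intro borel_measurable_scaleR borel_measurable_continuous_onI[OF assms])
  from haar_integral_left_mult[OF haar this, of h]
  show ?thesis by (simp add: markov_map_def m_assoc[symmetric])
qed

lemma markov_map_linear_conj:
  fixes l :: "complex ^ 'n ^ 'n \<Rightarrow> complex"
  assumes "bounded_linear l"
  shows "markov_map G \<mu> k (\<lambda>g. l (conjugate g x)) = (\<lambda>g. l (conjugate g (channel \<mu> k u x)))"
proof
  fix h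
  have "l (conjugate h (channel \<mu> k u x)) = (LINT g|\<mu>. k g *\<^sub>R l (conjugate h (conjugate g x)))"
    unfolding conjugate_def[of _ x] by (rule channel_linear[OF bounded_linear_compose[OF assms bounded_linear_conj]])
  then show "markov_map G \<mu> k (\<lambda>g. l (conjugate g x)) h = l (conjugate h (channel \<mu> k u x))"
    by (simp add: markov_map_eq[OF continuous_linear_conj[OF assms]] conjugate_mult)
qed

text \<open>If \<open>f\<close> is positive somewhere, finitely many translates of its positivity
  set cover the group. For each of these translations \<open>k\<close> times the translated
  \<open>f\<close> vanishes almost everywhere; finitely many exceptional null sets can be joined, so
  \<open>k\<close> vanishes almost everywhere, against its integral being 1.\<close>

lemma markov_map_nonpos_imp_zero:
  assumes f: "continuous_on UNIV f" "\<And>g. 0 \<le> f g" and le: "\<And>h. markov_map G \<mu> k f h \<le> (0 :: real)"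
  shows "f g = 0"
proof (rule ccontr)
  assume "f g \<noteq> 0"
  then have g: "g \<in> {g. 0 < f g}" using f(2)[of g] by simp
  have "open {g. 0 < f g}" by (intro open_Collect_less f continuous_intros)
  from finite_left_translates_cover[OF compact_group this g]
  obtain H where H: "finite H" "(\<Union>h\<in>H. (\<lambda>g. h \<otimes> g) -` {g. 0 < f g}) = UNIV" by blast
  have cont: "continuous_on UNIV (\<lambda>g. f (h \<otimes> g))" for h
    using continuous_on_compose2[OF f(1) continuous_left_mult] by simp
  have "AE g in \<mu>. k g * f (h \<otimes> g) = 0" for h
  proof (subst integral_nonneg_eq_0_iff_AE[symmetric])
    show "integrable \<mu> (\<lambda>g. k g * f (h \<otimes> g))" using kernel_integrable[OF cont] by simp
    show "AE g in \<mu>. 0 \<le> k g * f (h \<otimes> g)" by (simp add: kernel_nonneg f(2))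
    have "(LINT g|\<mu>. k g * f (h \<otimes> g)) \<le> 0" using le[of h] by (simp add: markov_map_eq[OF f(1)])
    moreover have "(LINT g|\<mu>. k g * f (h \<otimes> g)) \<ge> 0" by (simp add: integral_nonneg kernel_nonneg f(2))
    ultimately show "(LINT g|\<mu>. k g * f (h \<otimes> g)) = 0" by simp
  qed
  then have "AE g in \<mu>. \<forall>h\<in>H. k g * f (h \<otimes> g) = 0" by (intro AE_finite_allI H(1))
  then have "AE g in \<mu>. k g = 0"
  proof (rule AE_mp, intro AE_I2 impI)
    fix g assume z: "\<forall>h\<in>H. k g * f (h \<otimes> g) = 0"
    obtain h where "h \<in> H" "0 < f (h \<otimes> g)" using H(2) by blast
    then show "k g = 0" using z by (metis less_irrefl mult_eq_0_iff)
  qed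
  then have "(LINT g|\<mu>. k g) = 0" by (rule integral_eq_zero_AE)
  then show False using markov_k by (simp add: markov_kernel_def)
qed

lemma derivation_eq_zero:
  assumes "\<And>l. complex_linear l \<Longrightarrow> grad_sq G E (\<lambda>g. l (conjugate g x)) \<one> = 0"
  shows "derivation L x j = 0"
proof -
  have "derivation L x j $ a $ b = 0" for a b
  proof -
    have l: "complex_linear (\<lambda>M :: complex ^ 'n ^ 'n. (adj (mat 1) ** M ** mat 1) $ a $ b)"
      by (rule complex_linear_entry)
    have "(\<Sum>j\<in>UNIV. (cmod (derivation L x j $ a $ b))^2) = 0"
      using assms[OF l] unfolding grad_sq_linear_conj[OF l] by simp
    then show ?thesis by (simp add: sum_nonneg_eq_0_iff)
  qed
  then show ?thesis by (simp add: vec_eq_iff)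
qed

section \<open>The gradient estimate and weighted forms\<close>

lemma weighted_form_le:
  fixes \<kappa> :: real
  assumes hyp: "\<And>(f :: 'g \<Rightarrow> complex) h. smooth_fun \<A> f \<Longrightarrow>
      grad_sq G E (markov_map G \<mu> k f) h \<le> (1 - \<kappa>) * markov_map G \<mu> k (grad_sq G E f) h"
    and s: "0 \<le> s" "s \<le> 1" and A: "positive_op A" and B: "positive_op B"
  shows "Re (weighted_form A B s (derivation L (channel \<mu> k u x)) (derivation L (channel \<mu> k u x)))
    \<le> (1 - \<kappa>) * Re (weighted_form (channel_adj \<mu> k u A) (channel_adj \<mu> k u B) s (derivation L x) (derivation L x))"
proof (cases "0 \<le> 1 - \<kappa>")
  case False
  have "derivation L x j = 0" for x j
  proof (rule derivation_eq_zero)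
    fix l :: "complex ^ 'n ^ 'n \<Rightarrow> complex" assume l: "complex_linear l"
    let ?f = "\<lambda>g. l (conjugate g x)"
    have sm: "smooth_fun \<A> ?f" using l by (intro smooth_linear_conj) (simp add: complex_linear_def)
    show "grad_sq G E ?f \<one> = 0"
    proof (rule markov_map_nonpos_imp_zero[OF continuous_grad_sq[OF l]])
      show "markov_map G \<mu> k (grad_sq G E ?f) h \<le> 0" for h
      proof -
        have "0 \<le> grad_sq G E (markov_map G \<mu> k ?f) h" by (simp add: grad_sq_def sum_nonneg)
        then have "0 \<le> (1 - \<kappa>) * markov_map G \<mu> k (grad_sq G E ?f) h" using hyp[OF sm, of h] by linarith
        then show ?thesis using False by (simp add: zero_le_mult_iff)
      qed
    qed (simp add: grad_sq_def sum_nonneg)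
  qed
  then show ?thesis by (simp add: weighted_form_def matrix_mult.zero_left matrix_mult.zero_right
      linear_0[OF bounded_linear.linear[OF bounded_linear_trace]])
next
  case True
  let ?y = "derivation L (channel \<mu> k u x)"
  obtain U a where U: "unitary U" "A = U ** diag_mat a ** adj U" "\<And>i. 0 \<le> a i"
    by (rule positive_decomposition[OF A]) (rule that)
  obtain V b where V: "unitary V" "B = V ** diag_mat b ** adj V" "\<And>i. 0 \<le> b i"
    by (rule positive_decomposition[OF B]) (rule that)
  obtain U' a' where U': "unitary U'" "channel_adj \<mu> k u A = U' ** diag_mat a' ** adj U'" "\<And>i. 0 \<le> a' i"
    by (rule positive_decomposition[OF positive_channel_adj[OF A]]) (rule that)
  obtain V' b' where V': "unitary V'" "channel_adj \<mu> k u B = V' ** diag_mat b' ** adj V'" "\<And>i. 0 \<le> b' i"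
    by (rule positive_decomposition[OF positive_channel_adj[OF B]]) (rule that)
  define w where "w = (\<lambda>p q. (if s = 0 then 1 else a p powr s) * (if 1 - s = 0 then 1 else b q powr (1 - s)))"
  have w: "0 \<le> w p q" for p q by (simp add: w_def)
  have entry: "(\<Sum>j\<in>UNIV. (cmod ((adj U ** ?y j ** V) $ p $ q))^2)
      \<le> (1 - \<kappa>) * (\<Sum>j\<in>UNIV. mean_entry (derivation L x j) U V p q)" for p q
  proof -
    let ?l = "\<lambda>M. (adj U ** M ** V) $ p $ q"
    have l: "complex_linear ?l" by (rule complex_linear_entry)
    then have bl: "bounded_linear ?l" by (simp add: complex_linear_def)
    have int: "integrable \<mu> (\<lambda>g. k g * (cmod (?l (conjugate g (derivation L x j))))^2)" for j
      using kernel_integrable[OF continuous_entry[of U "derivation L x j" V p q]] by (simp add: conjugate_def)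
    \<comment> \<open>At the identity the conjugation disappears on the left, while on the right the
      Markov map averages over all conjugates of \<open>derivation L x j\<close>.\<close>
    have "(\<Sum>j\<in>UNIV. (cmod (?l (?y j)))^2)
        = grad_sq G E (markov_map G \<mu> k (\<lambda>g. ?l (conjugate g x))) \<one>"
      unfolding markov_map_linear_conj[OF bl] grad_sq_linear_conj[OF l] by simp
    also have "\<dots> \<le> (1 - \<kappa>) * markov_map G \<mu> k (grad_sq G E (\<lambda>g. ?l (conjugate g x))) \<one>"
      by (rule hyp[OF smooth_linear_conj[OF bl]])
    also have "markov_map G \<mu> k (grad_sq G E (\<lambda>g. ?l (conjugate g x))) \<one>
        = (LINT g|\<mu>. (\<Sum>j\<in>UNIV. k g * (cmod (?l (conjugate g (derivation L x j))))^2))"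
      by (simp add: markov_map_eq[OF continuous_grad_sq[OF l]] grad_sq_linear_conj[OF l] sum_distrib_left)
    also have "\<dots> = (\<Sum>j\<in>UNIV. mean_entry (derivation L x j) U V p q)"
      unfolding mean_entry_def using int by (simp add: conjugate_def)
    finally show ?thesis .
  qed
  have "Re (weighted_form A B s (?y) (?y))
      = (\<Sum>j\<in>UNIV. \<Sum>p\<in>UNIV. \<Sum>q\<in>UNIV. w p q * (cmod ((adj U ** ?y j ** V) $ p $ q))^2)"
    unfolding weighted_form_def op_powr_def U(2) V(2) fun_calc_diag[OF U(1)] fun_calc_diag[OF V(1)] trace_weighted Re_sum
      Re_complex_of_real w_def ..
  also have "\<dots> = (\<Sum>p\<in>UNIV. \<Sum>q\<in>UNIV. w p q * (\<Sum>j\<in>UNIV. (cmod ((adj U ** ?y j ** V) $ p $ q))^2))"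
    by (subst sum.swap, rule sum.cong[OF refl], subst sum.swap) (simp add: sum_distrib_left)
  also have "\<dots> \<le> (\<Sum>p\<in>UNIV. \<Sum>q\<in>UNIV. w p q * ((1 - \<kappa>) * (\<Sum>j\<in>UNIV. mean_entry (derivation L x j) U V p q)))"
    by (intro sum_mono mult_left_mono entry w)
  also have "\<dots> = (\<Sum>p\<in>UNIV. \<Sum>q\<in>UNIV. \<Sum>j\<in>UNIV. (1 - \<kappa>) * (w p q * mean_entry (derivation L x j) U V p q))"
    by (simp add: sum_distrib_left mult_ac)
  also have "\<dots> = (1 - \<kappa>) * (\<Sum>j\<in>UNIV. \<Sum>p\<in>UNIV. \<Sum>q\<in>UNIV. w p q * mean_entry (derivation L x j) U V p q)"
    unfolding sum_distrib_left
    by (subst (2) sum.swap, rule sum.cong[OF refl], subst sum.swap) (rule refl)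
  \<comment> \<open>Jensen's inequality is multiplied by \<open>1 - \<kappa>\<close>, whose sign
    therefore matters; this is why the other sign was treated apart.\<close>
  also have "\<dots> \<le> (1 - \<kappa>) * Re (weighted_form (channel_adj \<mu> k u A) (channel_adj \<mu> k u B) s (derivation L x) (derivation L x))"
    unfolding weighted_form_def Re_sum w_def
    by (intro mult_left_mono sum_mono True
        weighted_jensen[OF U(1) V(1) U'(1) V'(1) U(3) V(3) U'(3) V'(3) U(2) V(2) U'(2) V'(2) s])
  finally show ?thesis .
qed

section \<open>The Lipschitz estimate and the norms \<open>norm_2p\<close>\<close>

lemma bdd_above_norm_2p:
  fixes y :: "'d \<Rightarrow> complex ^ 'n ^ 'n"
  shows "bdd_above ((\<lambda>A. sqrt (\<Sum>j\<in>UNIV. (cmod (trace (A ** y j)))^2)) ` {A. schatten_norm (conj_exponent p) A \<le> 1})"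
proof -
  let ?R = "sqrt (real CARD('n))"
  have bound: "sqrt (\<Sum>j\<in>UNIV. (cmod (trace (A ** y j)))^2)
      \<le> sqrt (\<Sum>j\<in>UNIV. (\<Sum>a\<in>UNIV. \<Sum>b\<in>UNIV. ?R * cmod (y j $ b $ a))^2)"
    if "schatten_norm (conj_exponent p) A \<le> 1" for A
  proof (intro real_sqrt_le_mono sum_mono power_mono)
    fix j
    have "cmod (trace (A ** y j)) \<le> (\<Sum>a\<in>UNIV. \<Sum>b\<in>UNIV. cmod (A $ a $ b * y j $ b $ a))"
      unfolding trace_def matrix_matrix_mult_def
      by (simp only: vec_lambda_beta) (intro order_trans[OF norm_sum] sum_mono norm_sum)
    also have "\<dots> \<le> (\<Sum>a\<in>UNIV. \<Sum>b\<in>UNIV. ?R * cmod (y j $ b $ a))"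
      unfolding norm_mult
      by (intro sum_mono mult_right_mono schatten_norm_le_one_bound[OF conj_exponent_pos that]) simp
    finally show "cmod (trace (A ** y j)) \<le> (\<Sum>a\<in>UNIV. \<Sum>b\<in>UNIV. ?R * cmod (y j $ b $ a))" .
  qed simp
  show ?thesis by (rule bdd_aboveI2, rule bound) simp
qed

lemma norm_2p_upper:
  fixes y :: "'d \<Rightarrow> complex ^ 'n ^ 'n"
  assumes "schatten_norm (conj_exponent p) A \<le> 1"
  shows "sqrt (\<Sum>j\<in>UNIV. (cmod (trace (A ** y j)))^2) \<le> norm_2p p y"
  unfolding norm_2p_def by (rule cSUP_upper[OF _ bdd_above_norm_2p]) (use assms in simp)

lemma norm_2p_least:
  fixes y :: "'d \<Rightarrow> complex ^ 'n ^ 'n"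
  assumes "\<And>A. schatten_norm (conj_exponent p) A \<le> 1 \<Longrightarrow> sqrt (\<Sum>j\<in>UNIV. (cmod (trace (A ** y j)))^2) \<le> C"
  shows "norm_2p p y \<le> C"
  unfolding norm_2p_def
proof (rule cSUP_least)
  have "(0 :: complex ^ 'n ^ 'n) \<in> {A. schatten_norm (conj_exponent p) A \<le> 1}"
    by (simp add: schatten_norm_zero[OF conj_exponent_pos])
  then show "{A :: complex ^ 'n ^ 'n. schatten_norm (conj_exponent p) A \<le> 1} \<noteq> {}" by blast
qed (use assms in simp)

text \<open>\<open>lip_grad\<close> is a supremum of reals, so it bounds the gradient only because
  the latter is bounded, by continuity on a compact group.\<close>

lemma grad_le_lip_grad_linear_conj:
  assumes "complex_linear l"
  shows "sqrt (grad_sq G E (\<lambda>g. l (conjugate g x)) g) \<le> lip_grad G E (\<lambda>g. l (conjugate g x))"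
proof -
  have "continuous_on UNIV (\<lambda>g. sqrt (grad_sq G E (\<lambda>g. l (conjugate g x)) g))"
    by (intro continuous_on_real_sqrt continuous_grad_sq[OF assms])
  from compact_continuous_image[OF this compact_group]
  have "bdd_above (range (\<lambda>g. sqrt (grad_sq G E (\<lambda>g. l (conjugate g x)) g)))"
    by (intro bounded_imp_bdd_above compact_imp_bounded)
  then show ?thesis unfolding lip_grad_def by (intro cSUP_upper UNIV_I)
qed

lemma norm_2p_le:
  fixes \<kappa> :: real
  assumes hyp: "\<And>f :: 'g \<Rightarrow> complex. smooth_fun \<A> f \<Longrightarrow>
      lip_grad G E (markov_map G \<mu> k f) \<le> (1 - \<kappa>) * lip_grad G E f"
  shows "norm_2p p (derivation L (channel \<mu> k u x)) \<le> (1 - \<kappa>) * norm_2p p (derivation L x)"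
proof -
  have step: "sqrt (grad_sq G E (\<lambda>g. l (conjugate g (channel \<mu> k u x))) \<one>) \<le> (1 - \<kappa>) * lip_grad G E (\<lambda>g. l (conjugate g x))"
    if l: "complex_linear l" for l x
  proof -
    have bl: "bounded_linear l" using l by (simp add: complex_linear_def)
    have "sqrt (grad_sq G E (\<lambda>g. l (conjugate g (channel \<mu> k u x))) \<one>) \<le> lip_grad G E (\<lambda>g. l (conjugate g (channel \<mu> k u x)))"
      by (rule grad_le_lip_grad_linear_conj[OF l])
    also have "\<dots> \<le> (1 - \<kappa>) * lip_grad G E (\<lambda>g. l (conjugate g x))"
      using hyp[OF smooth_linear_conj[OF bl, of x]] by (simp only: markov_map_linear_conj[OF bl])
    finally show ?thesis .
  qed
  show ?thesis
  proof (cases "0 \<le> 1 - \<kappa>")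
    case False
    have zero: "derivation L x j = 0" for x j
    proof (rule derivation_eq_zero)
      fix l :: "complex ^ 'n ^ 'n \<Rightarrow> complex" assume l: "complex_linear l"
      let ?f = "\<lambda>g. l (conjugate g x)"
      have nn: "0 \<le> sqrt (grad_sq G E f \<one>)" for f :: "'g \<Rightarrow> complex" by (simp add: grad_sq_def sum_nonneg)
      have "0 \<le> (1 - \<kappa>) * lip_grad G E ?f" using step[OF l, of x] nn order_trans by blast
      then have "lip_grad G E ?f \<le> 0" using False by (simp add: zero_le_mult_iff)
      then have "sqrt (grad_sq G E ?f \<one>) = 0"
        using grad_le_lip_grad_linear_conj[OF l, of x \<one>] nn[of ?f] by linarith
      then show "grad_sq G E ?f \<one> = 0" by simp
    qed
    have "norm_2p p (\<lambda>_ :: 'd. 0 :: complex ^ 'n ^ 'n) = 0"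
    proof (rule antisym)
      have tr: "trace (0 :: complex ^ 'n ^ 'n) = 0" by (simp add: trace_def)
      show "norm_2p p (\<lambda>_ :: 'd. 0 :: complex ^ 'n ^ 'n) \<le> 0"
        by (rule norm_2p_least) (simp add: tr matrix_mult.zero_right)
      show "0 \<le> norm_2p p (\<lambda>_ :: 'd. 0 :: complex ^ 'n ^ 'n)"
      proof -
        have "schatten_norm (conj_exponent p) (0 :: complex ^ 'n ^ 'n) \<le> 1"
          by (simp add: schatten_norm_zero[OF conj_exponent_pos])
        from norm_2p_upper[OF this, of "\<lambda>_. 0"] show ?thesis by (simp add: tr matrix_mult.zero_right)
      qed
    qed
    moreover have "derivation L x = (\<lambda>_. 0)" for x using zero by (intro ext)
    ultimately show ?thesis by simp
  next
    case True
    show ?thesis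
    proof (rule norm_2p_least)
      fix A :: "complex ^ 'n ^ 'n" assume A: "schatten_norm (conj_exponent p) A \<le> 1"
      let ?l = "\<lambda>M. trace (A ** M)"
      have l: "complex_linear ?l" by (rule complex_linear_trace)
      have "lip_grad G E (\<lambda>g. ?l (conjugate g x)) \<le> norm_2p p (derivation L x)"
        unfolding lip_grad_def
      proof (rule cSUP_least)
        fix g
        \<comment> \<open>Cyclicity moves the conjugation from \<open>y\<close> to \<open>A\<close>.
          The conjugated \<open>A\<close> stays in the Schatten unit ball, so the supremum over
          \<open>g\<close> is dominated by the supremum over \<open>A\<close>.\<close>
        have "trace (A ** conjugate g y) = trace ((adj (u g) ** A ** u g) ** y)" for y
          using trace_mul_sym[of "A ** u g ** y" "adj (u g)"] by (simp add: conjugate_def matrix_mul_assoc)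
        then have "sqrt (grad_sq G E (\<lambda>g. ?l (conjugate g x)) g)
            = sqrt (\<Sum>j\<in>UNIV. (cmod (trace ((adj (u g) ** A ** u g) ** derivation L x j)))^2)"
          by (simp add: grad_sq_linear_conj[OF l])
        also have "\<dots> \<le> norm_2p p (derivation L x)"
          by (rule norm_2p_upper) (simp add: schatten_norm_conj[OF rep_unitary] A)
        finally show "sqrt (grad_sq G E (\<lambda>g. ?l (conjugate g x)) g) \<le> norm_2p p (derivation L x)" .
      qed simp
      then have "(1 - \<kappa>) * lip_grad G E (\<lambda>g. ?l (conjugate g x)) \<le> (1 - \<kappa>) * norm_2p p (derivation L x)"
        using True by (rule mult_left_mono)
      with step[OF l, of x]
      show "sqrt (\<Sum>j\<in>UNIV. (cmod (trace (A ** derivation L (channel \<mu> k u x) j)))^2) \<le> (1 - \<kappa>) * norm_2p p (derivation L x)"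
        by (simp add: grad_sq_linear_conj[OF l])
    qed
  qed
qed

end

text \<open>The weighted forms are real by \<open>trace_weighted\<close>, so stating (i) with
  \<open>Re\<close> loses nothing. Hypothesis (ii) uses the gradient form of the Lipschitz constant
  on complex functions; the last conjunct ties it to the metric form on real functions, where the
  two agree.\<close>

theorem theorem5p3:
  fixes G :: "('g::{t2_space, second_countable_topology}, 'm) monoid_scheme"
    and \<A> :: "('g, 'e::euclidean_space) atlas"
    and m :: "'g \<Rightarrow> 'g tangent \<Rightarrow> 'g tangent \<Rightarrow> real"
    and X :: "'d::finite \<Rightarrow> 'g \<Rightarrow> 'g tangent"
    and E :: "'d \<Rightarrow> real \<Rightarrow> 'g"
    and \<mu> :: "'g measure"
    and k :: "'g \<Rightarrow> real"
    and u :: "'g \<Rightarrow> complex ^ 'n::finite ^ 'n"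
    and L :: "'d \<Rightarrow> complex ^ 'n ^ 'n"
    and \<kappa> :: real
  assumes "lie_group G \<A>" and "compact (UNIV :: 'g set)"
    and "left_invariant_metric G \<A> m"
    and "lie_algebra_onb G \<A> m X"
    and "\<And>j. is_exponential G \<A> (X j) (E j)"
    and "normalized_haar G \<mu>"
    and "markov_kernel \<mu> k"
    and "projective_unitary_rep G u"
    and "\<And>j. rep_generator u (E j) (L j)"
  shows
    "((\<forall>f :: 'g \<Rightarrow> complex. smooth_fun \<A> f \<longrightarrow>
        (\<forall>h. grad_sq G E (markov_map G \<mu> k f) h
              \<le> (1 - \<kappa>) * markov_map G \<mu> k (grad_sq G E f) h)) \<longrightarrow>
      (\<forall>s A B x. 0 \<le> s \<and> s \<le> 1 \<and> positive_op A \<and> positive_op B \<longrightarrow>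
        Re (weighted_form A B s (derivation L (channel \<mu> k u x)) (derivation L (channel \<mu> k u x)))
          \<le> (1 - \<kappa>) * Re (weighted_form (channel_adj \<mu> k u A) (channel_adj \<mu> k u B) s
                            (derivation L x) (derivation L x)))) \<and>
     ((\<forall>f :: 'g \<Rightarrow> complex. smooth_fun \<A> f \<longrightarrow>
        lip_grad G E (markov_map G \<mu> k f) \<le> (1 - \<kappa>) * lip_grad G E f) \<longrightarrow>
      (\<forall>p x. 1 \<le> p \<longrightarrow>
        norm_2p p (derivation L (channel \<mu> k u x)) \<le> (1 - \<kappa>) * norm_2p p (derivation L x))) \<and>
     (\<forall>f :: 'g \<Rightarrow> real. smooth_fun \<A> f \<longrightarrow> lip_dist \<A> m f = ennreal (lip_grad G E f))"
proof -
  interpret lie_group G \<A> by fact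
  obtain U \<theta> where "(U, \<theta>) \<in> \<A>" "\<one>\<^bsub>G\<^esub> \<in> U" by (rule chart_at)
  then interpret riemannian_lie_group G \<A> U \<theta> m X E
    using assms by unfold_locales auto
  interpret transference G \<A> E \<mu> k u L
    using assms by unfold_locales auto
  show ?thesis
    using weighted_form_le norm_2p_le lip_dist_eq_lip_grad by blast
qed

end
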